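(* Define the operators on $\mathcal R$ $$E_{2,0}=\sum_{k\ge1}c_k[p]\frac{\partial}{\partial\pi_k},\qquad F_{1,0}=u^{-1}\sum_{k\ge1}c_{k-1}[p]\frac{\partial}{\partial\pi_k},$$ $$E_{2,1}=-u\,(t/q)^{1/2}\sum_{k\ge1}\oint\frac{dw}{w}\,w^{-2k}\,V_B^{(-)}(w)V_B^{(+)}(w)\,\langle\varnothing|\widetilde V_F^{(-)}(w)\widetilde V_F^{(+)}(w)|\varnothing\rangle_F\;q^{k}\frac{\partial}{\partial\pi_k},$$ $$F_{1,2}=u\sum_{k\ge1}\oint\frac{dw}{w}\,w^{-2k+2}\,V_B^{(-)}(w)V_B^{(+)}(w)\,\langle\varnothing|\widetilde V_F^{(-)}(w)\widetilde V_F^{(+)}(w)|\varnothing\rangle_F\;q^{k-1}\frac{\partial}{\partial\pi_k}.$$ Then $$[E_{2,1},F_{1,0}]_+=[E_{2,0},F_{1,2}]_+=0 .$$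
   Context: Let $q,t,u$ be indeterminates, $K=\mathbb Q(q^{1/2},t^{1/2},u)$, and $\mathcal R=K[p_1,p_2,\dots]\otimes\Lambda_K(\pi_1,\pi_2,\dots)$, the tensor product of a polynomial ring and an exterior (Grassmann) algebra. $p_k$ and $\pi_k$ act on $\mathcal R$ by multiplication; $\partial/\partial p_k$ is the usual derivative and $\partial/\partial\pi_k$ the left (odd) derivative, so $\{\partial/\partial\pi_k,\pi_l\}=\delta_{kl}$, the $\pi_k$ anticommute among themselves, the $\partial/\partial\pi_k$ anticommute among themselves, and both commute with all $p_l,\partial/\partial p_l$. $[A,B]_+=AB+BA$. All infinite sums of operators below are finite on each element of $\mathcal R$. $\oint\frac{dw}{w}f(w)$ denotes the coefficient of $w^0$ in $f(w)$. The elements $c_k[p]$ are defined by $\sum_{k\ge0}c_k[p]z^k=\exp\left(\sum_{r\ge1}\frac{1-t^r}{r}p_rz^r\right)$. Bosonic vertex operators: $$V_B^{(-)}(w)=\exp\Big(\sum_{k\ge1}\tfrac{1-t^{-k}}{k}p_kw^{2k}\Big),\qquad V_B^{(+)}(w)=\exp\Big(\sum_{k\ge1}(q^k-1)\tfrac{\partial}{\partial p_k}w^{-2k}\Big).$$ Fermionic vertex operators: with auxiliary charged fermions $\psi_m,\psi_m^\dagger$ ($m\ge0$), $\{\psi_m,\psi_n^\dagger\}=\delta_{mn}$, $\psi_m|\varnothing\rangle_F=0$, $\langle\varnothing|\psi_m\psi_n^\dagger|\varnothing\rangle_F=\delta_{mn}$, $$\widetilde V_F^{(-)}(w)=\exp\Big((1-t^{-1})\sum_{k\ge2}t^{2-k}w^{2k-1}\pi_k\sum_{m=0}^{k-2}t^m\psi_m\Big),\qquad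 \widetilde V_F^{(+)}(w)=\exp\Big((q-1)\sum_{k\ge2}q^{k-2}w^{-2k+1}\Big(\sum_{m=0}^{k-2}q^{-m}\psi_m^\dagger\Big)\tfrac{\partial}{\partial\pi_k}\Big).$$ In the vacuum expectation value (taken over the auxiliary fermions only) the $\psi_m,\psi_m^\dagger$ anticommute with $\pi_k,\partial/\partial\pi_k$, and products are normal ordered: all $\pi$'s are placed to the left of all $\partial/\partial\pi$'s, with signs as if they anticommuted. Explicitly, with $\widetilde A_m(w)=(1-t^{-1})\sum_{k\ge m+2}t^{2-k+m}w^{2k-1}\pi_k$ and $\widetilde B_m(w)=(q-1)\sum_{k\ge m+2}q^{k-2-m}w^{-2k+1}\frac{\partial}{\partial\pi_k}$, $$\langle\varnothing|\widetilde V_F^{(-)}(w)\widetilde V_F^{(+)}(w)|\varnothing\rangle_F=\sum_{r\ge0}(-1)^{r(r-1)/2}\sum_{0\le m_1<\dots<m_r}\widetilde A_{m_1}\cdots\widetilde A_{m_r}\widetilde B_{m_1}\cdots\widetilde B_{m_r}.$$ *)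

theory Defs
  imports
    Complex_Main
    "HOL-Library.Poly_Mapping"
    "HOL-Library.Groups_Big_Fun"
    "HOL-Library.FSet"
    "HOL-Computational_Algebra.Polynomial"
    "HOL-Computational_Algebra.Formal_Power_Series"
    "HOL-Computational_Algebra.Fraction_Field"
begin

section \<open>The coefficient field and the superpolynomial ring\<close>

text \<open>The field \<open>\<rat>(q\<^sup>1\<^sup>/\<^sup>2, t\<^sup>1\<^sup>/\<^sup>2, u)\<close> is the fraction field of a polynomial ring in three variables; the
  innermost variable is \<open>q\<^sup>1\<^sup>/\<^sup>2\<close>, the outermost one is \<open>u\<close>.\<close>

type_synonym coef = "rat poly poly poly fract"

definition q_half :: coef where "q_half = Fract [:[:[:0, 1:]:]:] 1"
definition t_half :: coef where "t_half = Fract [:[:0, 1:]:] 1"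
definition u_par :: coef where "u_par = Fract [:0, 1:] 1"
definition q_par :: coef where "q_par = q_half ^ 2"
definition t_par :: coef where "t_par = t_half ^ 2"

text \<open>The ring \<open>K[p\<^sub>1, p\<^sub>2, \<dots>]\<close> is the monoid algebra of finitely supported exponent vectors, and
  \<open>\<R>\<close> is the free module over it on the exterior monomials \<open>\<pi>\<^sub>I = \<pi>\<^bsub>i1\<^esub> \<pi>\<^bsub>i2\<^esub> \<dots>\<close> with
  \<open>i1 < i2 < \<dots>\<close> the elements of the finite set \<open>I\<close>.
  Variables are numbered from 1 in the mathematics and from 0 in these types: position \<open>i\<close> of an
  exponent vector (element \<open>i\<close> of an exterior index set) belongs to \<open>p\<close> (resp. \<open>\<pi>\<close>) with index
  \<open>i + 1\<close>. The variables, multiplications and derivatives below take an index \<open>k\<close> in the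
  mathematical numbering and are meant for \<open>k \<ge> 1\<close> only.\<close>

type_synonym bosonic = "(nat \<Rightarrow>\<^sub>0 nat) \<Rightarrow>\<^sub>0 coef"
type_synonym superring = "nat fset \<Rightarrow>\<^sub>0 bosonic"

definition const :: "coef \<Rightarrow> bosonic" where
  "const c = Poly_Mapping.single 0 c"

definition p_elem :: "nat \<Rightarrow> bosonic" where
  "p_elem k = Poly_Mapping.single (Poly_Mapping.single (k - 1) 1) 1"

definition of_bosonic :: "bosonic \<Rightarrow> superring" where
  "of_bosonic a = Poly_Mapping.single {||} a"

definition pi_elem :: "nat \<Rightarrow> superring" where
  "pi_elem k = Poly_Mapping.single {|k - 1|} 1"

text \<open>The sign in \<open>\<pi>\<^sub>I \<pi>\<^sub>J = \<plusminus>\<pi>\<^bsub>I\<union>J\<^esub>\<close>, with value 0 if \<open>I\<close> and \<open>J\<close> intersect.\<close>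

definition wedge_sign :: "nat fset \<Rightarrow> nat fset \<Rightarrow> bosonic" where
  "wedge_sign I J =
     (if I |\<inter>| J = {||} then (-1) ^ card {(i, j). i |\<in>| I \<and> j |\<in>| J \<and> j < i} else 0)"

definition super_mult :: "superring \<Rightarrow> superring \<Rightarrow> superring" (infixr \<open>\<odot>\<close> 70) where
  "f \<odot> g = (\<Sum>I\<in>Poly_Mapping.keys f. \<Sum>J\<in>Poly_Mapping.keys g.
     Poly_Mapping.single (I |\<union>| J)
       (wedge_sign I J * (Poly_Mapping.lookup f I * Poly_Mapping.lookup g J)))"

type_synonym operator = "superring \<Rightarrow> superring"

definition scale :: "coef \<Rightarrow> operator" where
  "scale c f = of_bosonic (const c) \<odot> f"

definition mult_p :: "nat \<Rightarrow> operator" where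
  "mult_p k f = of_bosonic (p_elem k) \<odot> f"

definition mult_\<pi> :: "nat \<Rightarrow> operator" where
  "mult_\<pi> k f = pi_elem k \<odot> f"

definition bosonic_deriv :: "nat \<Rightarrow> bosonic \<Rightarrow> bosonic" where
  "bosonic_deriv k a = (\<Sum>m\<in>Poly_Mapping.keys a.
     Poly_Mapping.single (m - Poly_Mapping.single (k - 1) 1)
       (of_nat (Poly_Mapping.lookup m (k - 1)) * Poly_Mapping.lookup a m))"

definition deriv_p :: "nat \<Rightarrow> operator" where
  "deriv_p k f = Poly_Mapping.map (bosonic_deriv k) f"

text \<open>The left derivative: \<open>\<pi>\<^sub>k\<close> is moved to the front and then removed.\<close>

definition deriv_\<pi> :: "nat \<Rightarrow> operator" where
  "deriv_\<pi> k f = (\<Sum>I\<in>Poly_Mapping.keys f.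
     if k - 1 |\<in>| I
     then Poly_Mapping.single (I |-| {|k - 1|})
            ((-1) ^ card {i. i |\<in>| I \<and> i < k - 1} * Poly_Mapping.lookup f I)
     else 0)"

definition anticommutator :: "operator \<Rightarrow> operator \<Rightarrow> operator" where
  "anticommutator A B = (\<lambda>f. A (B f) + B (A f))"


subsection \<open>The canonical relations\<close>

lemma lookup_deriv_\<pi>:
  assumes "k \<ge> 1"
  shows "Poly_Mapping.lookup (deriv_\<pi> k f) J =
    (if k - 1 |\<in>| J then 0
     else (-1) ^ card {i. i |\<in>| J \<and> i < k - 1} * Poly_Mapping.lookup f (finsert (k - 1) J))"
proof -
  let ?g = "\<lambda>I. if k - 1 |\<in>| I \<and> I |-| {|k - 1|} = J
      then (-1) ^ card {i. i |\<in>| I \<and> i < k - 1} * Poly_Mapping.lookup f I else 0"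
  have "Poly_Mapping.lookup (deriv_\<pi> k f) J = (\<Sum>I\<in>Poly_Mapping.keys f. ?g I)"
    unfolding deriv_\<pi>_def lookup_sum by (rule sum.cong) (auto simp: lookup_single when_def)
  also have "\<dots> = (\<Sum>I\<in>Poly_Mapping.keys f. if I = finsert (k - 1) J then ?g I else 0)"
    by (rule sum.cong) auto
  also have "\<dots> = ?g (finsert (k - 1) J)"
    by (auto simp: sum.delta in_keys_iff)
  also have "{i. i |\<in>| finsert (k - 1) J \<and> i < k - 1} = {i. i |\<in>| J \<and> i < k - 1}"
    by auto
  finally show ?thesis
    by auto
qed

lemma lookup_mult_\<pi>:
  assumes "k \<ge> 1"
  shows "Poly_Mapping.lookup (mult_\<pi> k f) J =
    (if k - 1 |\<in>| J
     then (-1) ^ card {i. i |\<in>| J \<and> i < k - 1} * Poly_Mapping.lookup f (J |-| {|k - 1|}) else 0)"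
proof -
  let ?g = "\<lambda>I. if finsert (k - 1) I = J
      then wedge_sign {|k - 1|} I * Poly_Mapping.lookup f I else 0"
  have sgn: "wedge_sign {|k - 1|} I =
      (if k - 1 |\<in>| I then 0 else (-1) ^ card {i. i |\<in>| I \<and> i < k - 1})" for I
  proof -
    have "{(i, j). i |\<in>| {|k - 1|} \<and> j |\<in>| I \<and> j < i} = Pair (k - 1) ` {i. i |\<in>| I \<and> i < k - 1}"
      by auto
    then have "card {(i, j). i |\<in>| {|k - 1|} \<and> j |\<in>| I \<and> j < i} = card {i. i |\<in>| I \<and> i < k - 1}"
      by (simp add: card_image inj_on_def)
    then show ?thesis by (auto simp: wedge_sign_def)
  qed
  have "Poly_Mapping.lookup (mult_\<pi> k f) J = (\<Sum>I\<in>Poly_Mapping.keys f. ?g I)"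
    unfolding mult_\<pi>_def super_mult_def pi_elem_def lookup_sum
    by (simp add: lookup_single when_def lookup_sum cong: if_cong)
  also have "\<dots> = (\<Sum>I\<in>Poly_Mapping.keys f. if I = J |-| {|k - 1|} then ?g I else 0)"
  proof (rule sum.cong)
    fix I
    have "J = finsert (k - 1) I \<longleftrightarrow> I = J |-| {|k - 1|} \<and> k - 1 |\<in>| J" if "k - 1 |\<notin>| I"
      using that by auto
    then show "?g I = (if I = J |-| {|k - 1|} then ?g I else 0)"
      unfolding sgn by (cases "k - 1 |\<in>| I") auto
  qed simp
  also have "\<dots> = ?g (J |-| {|k - 1|})"
    by (auto simp: sum.delta in_keys_iff)
  finally have eq: "Poly_Mapping.lookup (mult_\<pi> k f) J = ?g (J |-| {|k - 1|})" .
  have "{i. i |\<in>| J |-| {|k - 1|} \<and> i < k - 1} = {i. i |\<in>| J \<and> i < k - 1}"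
    by auto
  then show ?thesis
    unfolding eq sgn by (cases "k - 1 |\<in>| J") (auto simp: finsert_absorb)
qed

lemma card_below_finsert:
  assumes "a |\<notin>| J"
  shows "card {i. i |\<in>| finsert a J \<and> i < (b::nat)} = card {i. i |\<in>| J \<and> i < b} + (if a < b then 1 else 0)"
proof (cases "a < b")
  case True
  then have "{i. i |\<in>| finsert a J \<and> i < b} = insert a {i. i |\<in>| J \<and> i < b}" by auto
  with True assms show ?thesis by simp
next
  case False
  then have "{i. i |\<in>| finsert a J \<and> i < b} = {i. i |\<in>| J \<and> i < b}" by auto
  with False show ?thesis by simp
qed

lemma card_below_fminus:
  assumes "a |\<in>| J"
  shows "card {i. i |\<in>| J \<and> i < (b::nat)} = card {i. i |\<in>| J |-| {|a|} \<and> i < b} + (if a < b then 1 else 0)"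
  using card_below_finsert[of a "J |-| {|a|}" b] assms by (simp add: finsert_absorb)

lemma deriv_\<pi>_mult_\<pi>:
  assumes "k \<ge> 1" "l \<ge> 1"
  shows "anticommutator (deriv_\<pi> k) (mult_\<pi> l) = (\<lambda>f. if k = l then f else 0)"
proof (rule ext, rule poly_mapping_eqI)
  fix f J
  define a b where "a = k - 1" "b = l - 1"
  have kl: "k = l \<longleftrightarrow> a = b" using assms by (auto simp: a_b_def)
  have neq: "\<lbrakk>a \<noteq> b; b |\<in>| J\<rbrakk> \<Longrightarrow> finsert a J |-| {|b|} = finsert a (J |-| {|b|})" by auto
  have same: "a |\<notin>| J \<Longrightarrow> finsert a J |-| {|a|} = J" "a |\<in>| J \<Longrightarrow> finsert a (J |-| {|a|}) = J" by auto
  show "Poly_Mapping.lookup (anticommutator (deriv_\<pi> k) (mult_\<pi> l) f) J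
      = Poly_Mapping.lookup (if k = l then f else 0) J"
    unfolding anticommutator_def lookup_add lookup_deriv_\<pi>[OF assms(1)] lookup_mult_\<pi>[OF assms(2)]
      kl a_b_def[symmetric]
    using card_below_finsert[of a J b] card_below_fminus[of b J a] neq same
    by (cases "a < b"; cases "b < a")
       (auto simp: power_add power_mult_distrib[symmetric] mult.assoc[symmetric] simp flip: power_mult)
qed

lemma deriv_\<pi>_anticomm:
  assumes "k \<ge> 1" "l \<ge> 1"
  shows "anticommutator (deriv_\<pi> k) (deriv_\<pi> l) = (\<lambda>f. 0)"
proof (rule ext, rule poly_mapping_eqI)
  fix f J
  define a b where "a = k - 1" "b = l - 1"
  show "Poly_Mapping.lookup (anticommutator (deriv_\<pi> k) (deriv_\<pi> l) f) J = Poly_Mapping.lookup 0 J"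
    unfolding anticommutator_def lookup_add lookup_deriv_\<pi>[OF assms(1)] lookup_deriv_\<pi>[OF assms(2)]
      a_b_def[symmetric]
    using card_below_finsert[of a J b] card_below_finsert[of b J a]
    by (cases "a < b"; cases "b < a")
       (auto simp: power_add finsert_commute)
qed

lemma mult_\<pi>_anticomm:
  assumes "k \<ge> 1" "l \<ge> 1"
  shows "anticommutator (mult_\<pi> k) (mult_\<pi> l) = (\<lambda>f. 0)"
proof (rule ext, rule poly_mapping_eqI)
  fix f J
  define a b where "a = k - 1" "b = l - 1"
  have "J |-| {|a|} |-| {|b|} = J |-| {|b|} |-| {|a|}" by auto
  then show "Poly_Mapping.lookup (anticommutator (mult_\<pi> k) (mult_\<pi> l) f) J = Poly_Mapping.lookup 0 J"
    unfolding anticommutator_def lookup_add lookup_mult_\<pi>[OF assms(1)] lookup_mult_\<pi>[OF assms(2)]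
      a_b_def[symmetric]
    using card_below_fminus[of a J b] card_below_fminus[of b J a]
    by (cases "a < b"; cases "b < a")
       (auto simp: power_add)
qed

lemma lookup_of_bosonic_mult:
  "Poly_Mapping.lookup (of_bosonic a \<odot> f) J = a * Poly_Mapping.lookup f J"
proof -
  have "Poly_Mapping.lookup (of_bosonic a \<odot> f) J =
      (\<Sum>I\<in>Poly_Mapping.keys f. if I = J then a * Poly_Mapping.lookup f I else 0)"
    unfolding super_mult_def of_bosonic_def wedge_sign_def lookup_sum
    by (auto simp add: lookup_single when_def lookup_sum cong: if_cong)
  then show ?thesis by (simp add: sum.delta in_keys_iff)
qed

lemma lookup_bosonic_deriv:
  assumes "k \<ge> 1"
  shows "Poly_Mapping.lookup (bosonic_deriv k a) m =
    of_nat (Poly_Mapping.lookup m (k - 1) + 1) * Poly_Mapping.lookup a (m + Poly_Mapping.single (k - 1) 1)"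
proof -
  let ?s = "Poly_Mapping.single (k - 1) (1::nat)"
  have eq: "n = m + ?s" if "n - ?s = m" "Poly_Mapping.lookup n (k - 1) \<noteq> 0" for n
    using that by (auto intro!: poly_mapping_eqI simp: lookup_minus lookup_add lookup_single when_def)
  have "Poly_Mapping.lookup (bosonic_deriv k a) m = (\<Sum>n\<in>Poly_Mapping.keys a.
      if n - ?s = m then of_nat (Poly_Mapping.lookup n (k - 1)) * Poly_Mapping.lookup a n else 0)"
    unfolding bosonic_deriv_def lookup_sum
    by (rule sum.cong) (auto simp: lookup_single when_def)
  also have "\<dots> = (\<Sum>n\<in>Poly_Mapping.keys a.
      if n = m + ?s then of_nat (Poly_Mapping.lookup n (k - 1)) * Poly_Mapping.lookup a n else 0)"
  proof (rule sum.cong)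
    fix n
    show "(if n - ?s = m then of_nat (Poly_Mapping.lookup n (k - 1)) * Poly_Mapping.lookup a n else 0)
      = (if n = m + ?s then of_nat (Poly_Mapping.lookup n (k - 1)) * Poly_Mapping.lookup a n else 0)"
    proof (cases "Poly_Mapping.lookup n (k - 1) = 0")
      case False
      then have "n - ?s = m \<longleftrightarrow> n = m + ?s"
        using eq[of n] by (metis add_diff_cancel_right')
      then show ?thesis by (simp only:)
    qed simp
  qed simp
  finally show ?thesis
    by (auto simp: sum.delta in_keys_iff lookup_add)
qed


section \<open>Infinite sums and formal series of operators\<close>

text \<open>A possibly infinite sum of operators is evaluated pointwise; \<^const>\<open>Sum_any\<close> is the sum over
  the support. In all uses below only finitely many terms are nonzero on a given element
  (the value would be 0 otherwise).\<close>

definition op_sum :: "'i set \<Rightarrow> ('i \<Rightarrow> operator) \<Rightarrow> operator" where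
  "op_sum S A = (\<lambda>f. Sum_any (\<lambda>i. if i \<in> S then A i f else 0))"

text \<open>A formal series in \<open>w\<close> and \<open>w\<^sup>-\<^sup>1\<close> is given by its coefficients: \<open>A n\<close> is the coefficient
  of \<open>w\<^sup>n\<close>.\<close>

type_synonym op_series = "int \<Rightarrow> operator"

definition op_monom :: "int \<Rightarrow> operator \<Rightarrow> op_series" where
  "op_monom n A = (\<lambda>m. if m = n then A else (\<lambda>f. 0))"

definition series_one :: op_series where
  "series_one = op_monom 0 (\<lambda>f. f)"

definition series_sum :: "'i set \<Rightarrow> ('i \<Rightarrow> op_series) \<Rightarrow> op_series" where
  "series_sum S A = (\<lambda>n. op_sum S (\<lambda>i. A i n))"

definition series_scale :: "coef \<Rightarrow> op_series \<Rightarrow> op_series" where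
  "series_scale c A = (\<lambda>n f. scale c (A n f))"

definition series_mult :: "op_series \<Rightarrow> op_series \<Rightarrow> op_series" (infixr \<open>\<star>\<close> 70) where
  "A \<star> B = (\<lambda>n. op_sum UNIV (\<lambda>i f. A i (B (n - i) f)))"

definition series_prod :: "op_series list \<Rightarrow> op_series" where
  "series_prod As = foldr (\<star>) As series_one"

definition series_exp :: "op_series \<Rightarrow> op_series" where
  "series_exp A =
     series_sum UNIV (\<lambda>j. series_scale (1 / of_nat (fact j)) (series_prod (replicate j A)))"

text \<open>\<open>w_power n A\<close> is the series \<open>w\<^sup>n A(w)\<close>, and \<open>contour A\<close> is \<open>\<oint> dw/w A(w)\<close>.\<close>

definition w_power :: "int \<Rightarrow> op_series \<Rightarrow> op_series" where
  "w_power n A = (\<lambda>m. A (m - n))"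

definition contour :: "op_series \<Rightarrow> operator" where
  "contour A = A 0"


section \<open>The vertex operators\<close>

definition c_series :: "bosonic fps" where
  "c_series = Abs_fps (\<lambda>n. const (1 / of_nat (fact n))) oo
     Abs_fps (\<lambda>r. if r = 0 then 0 else const ((1 - t_par ^ r) / of_nat r) * p_elem r)"

definition c_elem :: "nat \<Rightarrow> bosonic" where
  "c_elem k = fps_nth c_series k"

definition V_B_minus :: op_series where
  "V_B_minus = series_exp (series_sum {1..} (\<lambda>k.
     op_monom (2 * int k) (\<lambda>f. scale ((1 - inverse t_par ^ k) / of_nat k) (mult_p k f))))"

definition V_B_plus :: op_series where
  "V_B_plus = series_exp (series_sum {1..} (\<lambda>k.
     op_monom (- 2 * int k) (\<lambda>f. scale (q_par ^ k - 1) (deriv_p k f))))"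

definition A_F :: "nat \<Rightarrow> op_series" where
  "A_F m = series_scale (1 - inverse t_par) (series_sum {m + 2..} (\<lambda>k.
     op_monom (2 * int k - 1) (\<lambda>f. scale (t_par powi (2 - int k + int m)) (mult_\<pi> k f))))"

definition B_F :: "nat \<Rightarrow> op_series" where
  "B_F m = series_scale (q_par - 1) (series_sum {m + 2..} (\<lambda>k.
     op_monom (- 2 * int k + 1) (\<lambda>f. scale (q_par powi (int k - 2 - int m)) (deriv_\<pi> k f))))"

text \<open>The normal-ordered expectation value over the auxiliary fermions of the product of the two
  exponentials \<open>exp (\<Sum>\<^sub>m A\<^sub>m \<psi>\<^sub>m)\<close> and \<open>exp (\<Sum>\<^sub>m \<psi>\<^sup>\<dagger>\<^sub>m B\<^sub>m)\<close>. In degree \<open>r\<close> the surviving terms are the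
  \<open>A\<^bsub>m1\<^esub> \<dots> A\<^bsub>mr\<^esub> B\<^bsub>m1\<^esub> \<dots> B\<^bsub>mr\<^esub>\<close> with \<open>m1 < \<dots> < mr\<close>, and reordering the fermions gives the
  sign \<open>(-1)\<^bsup>r(r-1)/2\<^esup>\<close>.\<close>

definition V_F_vev :: op_series where
  "V_F_vev = series_sum UNIV (\<lambda>r. series_scale ((-1) ^ (r * (r - 1) div 2))
     (series_sum {ms. length ms = r \<and> sorted_wrt (<) ms}
        (\<lambda>ms. series_prod (map A_F ms @ map B_F ms))))"


section \<open>The operators of the algebra\<close>

definition E_2_0 :: operator where
  "E_2_0 = op_sum {1..} (\<lambda>k f. of_bosonic (c_elem k) \<odot> deriv_\<pi> k f)"

definition F_1_0 :: operator where
  "F_1_0 = (\<lambda>f. scale (inverse u_par)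
     (op_sum {1..} (\<lambda>k f. of_bosonic (c_elem (k - 1)) \<odot> deriv_\<pi> k f) f))"

definition E_2_1 :: operator where
  "E_2_1 = (\<lambda>f. scale (- u_par * (t_half / q_half))
     (op_sum {1..} (\<lambda>k f.
        contour (w_power (- 2 * int k) (V_B_minus \<star> V_B_plus \<star> V_F_vev))
          (scale (q_par ^ k) (deriv_\<pi> k f))) f))"

definition F_1_2 :: operator where
  "F_1_2 = (\<lambda>f. scale u_par
     (op_sum {1..} (\<lambda>k f.
        contour (w_power (- 2 * int k + 2) (V_B_minus \<star> V_B_plus \<star> V_F_vev))
          (scale (q_par ^ (k - 1)) (deriv_\<pi> k f))) f))"

end

theory Submission
  imports Defs
begin

text \<open>
  Write \<open>d\<^sub>k = \<partial>/\<partial>\<pi>\<^sub>k\<close>, \<open>c(z) = \<Sum>\<^sub>k c\<^sub>k z\<^sup>k\<close>, \<open>V\<^sub>F(w)\<close> for the fermionic expectation value and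
  \<open>W = V\<^sub>B\<^bsup>(-)\<^esup> V\<^sub>B\<^bsup>(+)\<^esup> V\<^sub>F\<close>. Up to scalar factors both claims say that, for \<open>s = 1\<close> and for \<open>s = 0\<close>, the operators
  \<open>\<Sum>\<^sub>k c\<^bsub>k-s\<^esub> d\<^sub>k\<close> and \<open>\<Sum>\<^sub>k q\<^bsup>k-1+s\<^esup> [w\<^bsup>2k-2+2s\<^esup>] W d\<^sub>k\<close> anticommute, where \<open>[w\<^sup>n]\<close> takes a coefficient.
  Three relations bring the two products to a common form.

  \<^item> \<open>V\<^sub>F\<close> is the normally ordered exponential of an operator bilinear in the \<open>\<pi>\<^sub>k\<close> and the \<open>d\<^sub>l\<close>, hence
    acts as a substitution of Grassmann variables:
    \<open>d\<^sub>j V\<^sub>F = V\<^sub>F \<Sum>\<^sub>l n\<^bsub>jl\<^esub> w\<^bsup>2j-2l\<^esup> d\<^sub>l\<close> for explicit scalars \<open>n\<^bsub>jl\<^esub>\<close> (\<open>deriv_V_F_vev\<close>).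
  \<^item> \<open>V\<^sub>B\<^bsup>(+)\<^esup>\<close> shifts the \<open>p\<^sub>k\<close>, so \<open>V\<^sub>B\<^bsup>(+)\<^esup>(w) c(z) = G(z/w\<^sup>2) c(z) V\<^sub>B\<^bsup>(+)\<^esup>(w)\<close> with
    \<open>G(x) = \<Sum>\<^sub>i g\<^sub>i x\<^sup>i = (1 - x)(1 - qtx) / ((1 - qx)(1 - tx))\<close> (\<open>V_plus_int_c\<close>).
  \<^item> \<open>V\<^sub>B\<^bsup>(-)\<^esup>(w)\<close> is the inverse of \<open>c(w\<^sup>2/t)\<close> (\<open>c_V_minus_cancel\<close>).

  The first two relations turn the anticommutator into a scalar multiple of
  \<open>\<Sum>\<^sub>i c\<^sub>i \<Sum>\<^bsub>k,l\<^esub> q\<^sup>k (g\<^bsub>l-j\<^esub> - n\<^bsub>jl\<^esub>) [w\<^bsup>2k+2l-2-2i\<^esup>] W d\<^sub>k d\<^sub>l\<close> with \<open>j = i + s\<close>. The heart of the matter is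
  the identity \<open>g\<^bsub>l-j\<^esub> - n\<^bsub>jl\<^esub> = \<kappa>\<^sub>j q\<^sup>l - \<alpha> t\<^bsup>-j\<^esup> t\<^sup>l\<close> (\<open>exchange_minus_ferm_coeff\<close>). The term with
  \<open>q\<^sup>k q\<^sup>l\<close> is symmetric in \<open>k, l\<close> and disappears because the \<open>d\<^sub>k\<close> anticommute. In the other term \<open>i\<close> enters
  only through \<open>t\<^bsup>-i\<^esup> c\<^sub>i w\<^bsup>2i\<^esup>\<close>, so the third relation removes \<open>c\<close> together with \<open>V\<^sub>B\<^bsup>(-)\<^esup>\<close>. What remains is the
  coefficient of \<open>w\<^bsup>-2\<^esup>\<close> in \<open>V\<^sub>B\<^bsup>(+)\<^esup> X\<close>, where
  \<open>X = V\<^sub>F (\<Sum>\<^sub>k q\<^sup>k w\<^bsup>-2k\<^esup> d\<^sub>k) (\<Sum>\<^sub>l t\<^sup>l w\<^bsup>-2l\<^esup> d\<^sub>l)\<close>.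

  Since \<open>V\<^sub>B\<^bsup>(+)\<^esup>\<close> has only nonpositive powers of \<open>w\<close>, it is enough that \<open>X\<close> has no powers \<open>w\<^sup>n\<close> with
  \<open>n \<ge> -2\<close> (\<open>pair_op_V_F_vev_zero\<close>). This is not visible from \<open>V\<^sub>F\<close>, which contains arbitrarily high powers.
  However, in \<open>d\<^sub>j X\<close> the identity above applies once more: the \<open>q\<^sup>l\<close> and \<open>t\<^sup>l\<close> parts of \<open>n\<^bsub>jl\<^esub>\<close> are annihilated by
  the two factors already present in \<open>X\<close>, and what is left is \<open>d\<^sub>j X = X \<Sum>\<^bsub>l\<ge>j\<^esub> g\<^bsub>l-j\<^esub> w\<^bsup>2j-2l\<^esup> d\<^sub>l\<close>. An induction
  on the \<open>\<pi>\<close>-degree now reduces the assertion to the component of \<open>X\<close> on the exterior monomial \<open>1\<close>, where \<open>V\<^sub>F\<close> is the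
  identity and all exponents are at most \<open>-4\<close>.

  All these arguments use the operators only through recursions: the exponentials through
  the Euler identity \<open>i E\<^sub>i = \<Sum>\<^sub>k k X\<^sub>k E\<^bsub>i-k\<^esub>\<close> (\<open>conv_exp_euler\<close>), and \<open>V\<^sub>F\<close> through the relation for
  \<open>d\<^sub>j V\<^sub>F\<close> and its component on the monomial \<open>1\<close>, which together determine it.
\<close>

section \<open>Linear operators on the superpolynomial ring\<close>

lemma const_add: "const (a + b) = const a + const b"
  by (simp add: const_def single_add)

lemma const_mult: "const (a * b) = const a * const b"
  by (simp add: const_def mult_single)

lemma const_1 [simp]: "const 1 = 1"
  by (simp add: const_def)

lemma lookup_scale: "Poly_Mapping.lookup (scale c f) I = const c * Poly_Mapping.lookup f I"
  by (simp add: scale_def lookup_of_bosonic_mult)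

interpretation vs: vector_space scale
proof
  fix a b :: coef and x y :: superring
  show "scale a (x + y) = scale a x + scale a y"
    by (rule poly_mapping_eqI) (simp add: lookup_scale lookup_add algebra_simps)
  show "scale (a + b) x = scale a x + scale b x"
    by (rule poly_mapping_eqI) (simp add: lookup_scale lookup_add const_add algebra_simps)
  show "scale a (scale b x) = scale (a * b) x"
    by (rule poly_mapping_eqI) (simp add: lookup_scale const_mult mult.assoc)
  show "scale 1 x = x"
    by (rule poly_mapping_eqI) (simp add: lookup_scale)
qed

abbreviation lin :: "operator \<Rightarrow> bool" where
  "lin \<equiv> module_hom scale scale"

lemma linI:
  assumes "\<And>f g. T (f + g) = T f + T g" and "\<And>c f. T (scale c f) = scale c (T f)"
  shows "lin T"
  using assms by unfold_locales

lemmas lin_add = module_hom.add[where ?s1.0 = scale and ?s2.0 = scale]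
  and lin_scale = module_hom.scale[where ?s1.0 = scale and ?s2.0 = scale]
  and lin_sum = module_hom.sum[where ?s1.0 = scale and ?s2.0 = scale]
  and lin_0 = module_hom.zero[where ?s1.0 = scale and ?s2.0 = scale]
  and lin_neg = module_hom.neg[where ?s1.0 = scale and ?s2.0 = scale]

lemma lin_comp: "lin S \<Longrightarrow> lin T \<Longrightarrow> lin (\<lambda>f. S (T f))"
  by (rule linI) (simp_all add: lin_add lin_scale)

lemma lin_scaleI: "lin T \<Longrightarrow> lin (\<lambda>f. scale c (T f))"
  by (rule linI) (simp_all add: lin_add lin_scale vs.scale_right_distrib vs.scale_left_commute)

lemma lin_sumI: "(\<And>i. i \<in> S \<Longrightarrow> lin (T i)) \<Longrightarrow> lin (\<lambda>f. \<Sum>i\<in>S. T i f)"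
  by (auto intro!: linI sum.cong simp: sum.distrib[symmetric] vs.scale_sum_right lin_add lin_scale)

abbreviation times_b :: "bosonic \<Rightarrow> operator" where
  "times_b a f \<equiv> of_bosonic a \<odot> f"

lemma times_b_times_b: "times_b a (times_b b f) = times_b (a * b) f"
  by (rule poly_mapping_eqI) (simp add: lookup_of_bosonic_mult mult.assoc)

lemma times_b_commute: "times_b a (times_b b f) = times_b b (times_b a f)"
  by (simp add: times_b_times_b mult.commute)

lemma times_b_0 [simp]: "times_b 0 f = 0"
  by (rule poly_mapping_eqI) (simp add: lookup_of_bosonic_mult)

lemma times_b_1 [simp]: "times_b 1 f = f"
  by (rule poly_mapping_eqI) (simp add: lookup_of_bosonic_mult)

lemma times_b_sum: "times_b (sum a S) f = (\<Sum>i\<in>S. times_b (a i) f)"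
  by (rule poly_mapping_eqI) (simp add: lookup_of_bosonic_mult lookup_sum sum_distrib_right)

lemma times_b_const: "times_b (const c) f = scale c f"
  by (simp add: scale_def)

lemma lin_times_b: "lin (times_b a)"
  by (rule linI; rule poly_mapping_eqI)
     (simp_all add: lookup_of_bosonic_mult lookup_add lookup_scale algebra_simps)

lemma mult_p_eq: "mult_p k = times_b (p_elem k)"
  by (simp add: mult_p_def fun_eq_iff)

lemma lin_deriv_\<pi>: "k \<ge> 1 \<Longrightarrow> lin (deriv_\<pi> k)"
  by (rule linI; rule poly_mapping_eqI)
     (simp_all add: lookup_deriv_\<pi> lookup_add lookup_scale algebra_simps)

lemma lin_mult_\<pi>: "k \<ge> 1 \<Longrightarrow> lin (mult_\<pi> k)"
  by (rule linI; rule poly_mapping_eqI)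
     (simp_all add: lookup_mult_\<pi> lookup_add lookup_scale algebra_simps)

lemma bosonic_deriv_0 [simp]: "bosonic_deriv k 0 = 0"
  by (simp add: bosonic_deriv_def)

lemma lookup_deriv_p: "Poly_Mapping.lookup (deriv_p k f) I = bosonic_deriv k (Poly_Mapping.lookup f I)"
  by (simp add: deriv_p_def Poly_Mapping.map.rep_eq when_def)

lemma lookup_const_mult: "Poly_Mapping.lookup (const c * a) m = c * Poly_Mapping.lookup a m"
proof -
  have "const c * a = Poly_Mapping.map ((*) c) a"
    by (simp add: const_def mult_map_scale_conv_mult)
  then show ?thesis by (simp add: Poly_Mapping.map.rep_eq when_def)
qed

lemma bosonic_deriv_add: "k \<ge> 1 \<Longrightarrow> bosonic_deriv k (a + b) = bosonic_deriv k a + bosonic_deriv k b"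
  by (rule poly_mapping_eqI) (simp add: lookup_bosonic_deriv lookup_add algebra_simps)

lemma bosonic_deriv_const: "k \<ge> 1 \<Longrightarrow> bosonic_deriv k (const c * a) = const c * bosonic_deriv k a"
  by (rule poly_mapping_eqI) (simp add: lookup_bosonic_deriv lookup_const_mult distrib_left distrib_right mult.left_commute)

lemma lin_deriv_p: "k \<ge> 1 \<Longrightarrow> lin (deriv_p k)"
  by (rule linI; rule poly_mapping_eqI)
     (simp_all add: lookup_deriv_p lookup_add lookup_scale bosonic_deriv_add bosonic_deriv_const)

lemma deriv_\<pi>_swap:
  assumes "k \<ge> 1" "l \<ge> 1"
  shows "deriv_\<pi> k (deriv_\<pi> l f) = - deriv_\<pi> l (deriv_\<pi> k f)"
  using deriv_\<pi>_anticomm[OF assms] unfolding anticommutator_def fun_eq_iff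
  by (simp add: eq_neg_iff_add_eq_0)

lemma deriv_\<pi>_times_b: "k \<ge> 1 \<Longrightarrow> deriv_\<pi> k (times_b a f) = times_b a (deriv_\<pi> k f)"
  by (rule poly_mapping_eqI) (simp add: lookup_deriv_\<pi> lookup_of_bosonic_mult algebra_simps)

lemma bosonic_deriv_signed:
  assumes "k \<ge> 1"
  shows "bosonic_deriv k ((- 1) ^ n * a) = (- 1) ^ n * bosonic_deriv k a"
proof -
  have "(- 1 :: bosonic) ^ n = const ((- 1) ^ n)"
    by (induction n) (auto simp: const_mult, simp add: const_def single_uminus[symmetric])
  then show ?thesis using assms by (simp add: bosonic_deriv_const)
qed

lemma deriv_\<pi>_deriv_p:
  assumes "k \<ge> 1" "l \<ge> 1"
  shows "deriv_\<pi> k (deriv_p l f) = deriv_p l (deriv_\<pi> k f)"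
  using assms
  by (intro poly_mapping_eqI[of "deriv_\<pi> k (deriv_p l f)"])
     (simp add: lookup_deriv_\<pi> lookup_deriv_p bosonic_deriv_signed)

lemma deriv_p_commute:
  assumes "k \<ge> 1" "l \<ge> 1"
  shows "deriv_p k (deriv_p l f) = deriv_p l (deriv_p k f)"
proof (rule poly_mapping_eqI, rule poly_mapping_eqI)
  fix I m
  show "Poly_Mapping.lookup (Poly_Mapping.lookup (deriv_p k (deriv_p l f)) I) m =
      Poly_Mapping.lookup (Poly_Mapping.lookup (deriv_p l (deriv_p k f)) I) m"
    using assms
    by (cases "k - 1 = l - 1")
       (auto simp: lookup_deriv_p lookup_bosonic_deriv lookup_add lookup_single when_def
          add_ac mult_ac)
qed

lemma bosonic_p_elem_mult:
  "Poly_Mapping.lookup (p_elem l * a) m =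
    (if Poly_Mapping.lookup m (l - 1) = 0 then 0
     else Poly_Mapping.lookup a (m - Poly_Mapping.single (l - 1) 1))"
proof -
  let ?s = "Poly_Mapping.single (l - 1) (1::nat)"
  have "Poly_Mapping.lookup (p_elem l * a) m =
      (\<Sum>n. Poly_Mapping.lookup a n when m = ?s + n)"
    unfolding p_elem_def lookup_mult
    by (subst Sum_any.expand_superset[where A = "{?s}"])
       (auto simp: lookup_single when_def intro!: Sum_any.cong)
  also have "\<dots> = (if Poly_Mapping.lookup m (l - 1) = 0 then 0 else Poly_Mapping.lookup a (m - ?s))"
  proof (cases "Poly_Mapping.lookup m (l - 1) = 0")
    case True
    then have "m \<noteq> ?s + n" for n
      by (auto simp: lookup_add)
    then show ?thesis using True by simp
  next
    case False
    then have "m = ?s + (m - ?s)"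
      by (intro poly_mapping_eqI) (auto simp: lookup_add lookup_minus lookup_single when_def)
    then have "m = ?s + n \<longleftrightarrow> n = m - ?s" for n
      by (metis add_diff_cancel_left')
    then show ?thesis using False by simp
  qed
  finally show ?thesis .
qed

lemma bosonic_deriv_p_elem:
  assumes "k \<ge> 1" "l \<ge> 1"
  shows "bosonic_deriv k (p_elem l * a) = p_elem l * bosonic_deriv k a + (if k = l then a else 0)"
proof (rule poly_mapping_eqI)
  fix m :: "nat \<Rightarrow>\<^sub>0 nat"
  have kl: "k - 1 = l - 1 \<longleftrightarrow> k = l" using assms by auto
  have 1: "m - Poly_Mapping.single (k - 1) 1 + Poly_Mapping.single (k - 1) 1 = m"
    if "Poly_Mapping.lookup m (k - 1) \<noteq> 0"
    using that by (intro poly_mapping_eqI) (auto simp: lookup_add lookup_minus lookup_single when_def)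
  have 2: "m + Poly_Mapping.single (k - 1) 1 - Poly_Mapping.single (l - 1) 1 =
      m - Poly_Mapping.single (l - 1) 1 + Poly_Mapping.single (k - 1) 1" if "k \<noteq> l"
    using that assms
    by (intro poly_mapping_eqI) (auto simp: lookup_add lookup_minus lookup_single when_def)
  have 3: "m + Poly_Mapping.single (k - 1) (1::nat) - Poly_Mapping.single (k - 1) 1 = m"
    by simp
  show "Poly_Mapping.lookup (bosonic_deriv k (p_elem l * a)) m =
      Poly_Mapping.lookup (p_elem l * bosonic_deriv k a + (if k = l then a else 0)) m"
  proof (cases "k = l")
    case True
    show ?thesis
    proof (cases "Poly_Mapping.lookup m (k - 1)")
      case 0
      then show ?thesis
        using True 3 assms(1)
        by (simp add: lookup_bosonic_deriv lookup_add bosonic_p_elem_mult)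
    next
      case (Suc c)
      then have "m - Poly_Mapping.single (k - 1) 1 + Poly_Mapping.single (k - 1) 1 = m"
        using 1 by simp
      then show ?thesis
        using True 3 Suc assms(1)
        by (simp add: lookup_bosonic_deriv lookup_add bosonic_p_elem_mult lookup_minus distrib_right)
    qed
  next
    case False
    then show ?thesis
      using 2 assms
      by (auto simp: lookup_bosonic_deriv[OF assms(1)] lookup_add bosonic_p_elem_mult lookup_minus
          lookup_single when_def kl)
  qed
qed

lemma deriv_p_times_p:
  assumes "k \<ge> 1" "l \<ge> 1"
  shows "deriv_p k (times_b (p_elem l) f) =
    times_b (p_elem l) (deriv_p k f) + (if k = l then f else 0)"
  using assms
  by (intro poly_mapping_eqI[of "deriv_p k (times_b (p_elem l) f)"])
     (simp add: lookup_deriv_p lookup_of_bosonic_mult bosonic_deriv_p_elem lookup_add)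

text \<open>Every exterior monomial other than \<open>1\<close> contains some \<open>\<pi>\<^sub>j\<close>, so its coefficient is visible in \<open>\<partial>/\<partial>\<pi>\<^sub>j\<close>.
  Together with an induction on the \<open>\<pi>\<close>-degree this is the uniqueness principle behind the statements on the
  fermionic operator.\<close>

lemma superring_eqI:
  assumes "\<And>j. j \<ge> 1 \<Longrightarrow> deriv_\<pi> j f = deriv_\<pi> j g"
    and "Poly_Mapping.lookup f {||} = Poly_Mapping.lookup g {||}"
  shows "f = g"
proof (rule poly_mapping_eqI)
  fix I
  show "Poly_Mapping.lookup f I = Poly_Mapping.lookup g I"
  proof (cases "I = {||}")
    case False
    then obtain i where i: "i |\<in>| I" by auto
    let ?J = "I |-| {|i|}"
    have I: "finsert i ?J = I" using i by auto
    have "Poly_Mapping.lookup (deriv_\<pi> (Suc i) f) ?J = Poly_Mapping.lookup (deriv_\<pi> (Suc i) g) ?J"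
      using assms(1)[of "Suc i"] by simp
    then show ?thesis
      using I by (simp add: lookup_deriv_\<pi>)
  qed (use assms(2) in simp)
qed

text \<open>A strict bound, so that the case \<open>d = 0\<close> is \<open>f = 0\<close> and can start an induction.\<close>

definition deg_less :: "nat \<Rightarrow> superring \<Rightarrow> bool" where
  "deg_less d f \<longleftrightarrow> (\<forall>I. Poly_Mapping.lookup f I \<noteq> 0 \<longrightarrow> fcard I < d)"

lemma deg_less_0 [simp]: "deg_less 0 f \<longleftrightarrow> f = 0"
  by (auto simp: deg_less_def intro: poly_mapping_eqI)

lemma deg_less_mono: "deg_less d f \<Longrightarrow> d \<le> e \<Longrightarrow> deg_less e f"
  unfolding deg_less_def by force

lemma deg_less_deriv_\<pi>: "deg_less (Suc d) f \<Longrightarrow> j \<ge> 1 \<Longrightarrow> deg_less d (deriv_\<pi> j f)"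
  unfolding deg_less_def by (auto simp: lookup_deriv_\<pi> split: if_splits)
    (metis Suc_less_eq fcard_finsert_disjoint mult_zero_right)

lemma deg_less_ex: "\<exists>d. deg_less d f"
proof -
  have "fcard I < Suc (\<Sum>I\<in>Poly_Mapping.keys f. fcard I)" if "Poly_Mapping.lookup f I \<noteq> 0" for I
    using that by (simp add: less_Suc_eq_le in_keys_iff member_le_sum)
  then show ?thesis unfolding deg_less_def by blast
qed

text \<open>Only \<open>\<pi>\<^sub>1, \<dots>, \<pi>\<^sub>N\<close> occur in \<open>f\<close>. Stated through the derivatives, this is the condition that truncates every
  sum over \<open>\<partial>/\<partial>\<pi>\<^sub>k\<close>, and it is visibly inherited by images under operators that commute with the
  derivatives up to sign.\<close>

definition index_le :: "nat \<Rightarrow> superring \<Rightarrow> bool" where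
  "index_le N f \<longleftrightarrow> (\<forall>k>N. deriv_\<pi> k f = 0)"

lemma index_le_mono: "index_le N f \<Longrightarrow> N \<le> M \<Longrightarrow> index_le M f"
  unfolding index_le_def by auto

lemma index_le_add: "index_le N f \<Longrightarrow> index_le N g \<Longrightarrow> index_le N (f + g)"
  unfolding index_le_def by (auto simp: lin_add[OF lin_deriv_\<pi>])

lemma index_le_scale: "index_le N f \<Longrightarrow> index_le N (scale c f)"
  unfolding index_le_def by (auto simp: lin_scale[OF lin_deriv_\<pi>])

lemma index_le_deriv_\<pi>: "index_le N f \<Longrightarrow> k \<ge> 1 \<Longrightarrow> index_le N (deriv_\<pi> k f)"
  unfolding index_le_def using deriv_\<pi>_swap[of _ k f] lin_0[OF lin_deriv_\<pi>[of k]] by simp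

lemma index_le_times_b: "index_le N f \<Longrightarrow> index_le N (times_b a f)"
  unfolding index_le_def using lin_0[OF lin_times_b[of a]] by (simp add: deriv_\<pi>_times_b)

lemma index_le_0 [simp]: "index_le N 0"
  unfolding index_le_def by (simp add: lin_0[OF lin_deriv_\<pi>])

lemma index_le_sum: "(\<And>i. i \<in> S \<Longrightarrow> index_le N (f i)) \<Longrightarrow> index_le N (sum f S)"
  by (induction S rule: infinite_finite_induct) (auto intro: index_le_add)

lemma index_le_ex: "\<exists>N. index_le N f"
proof -
  have fin: "finite (\<Union>I\<in>Poly_Mapping.keys f. fset I)" by simp
  then obtain N where N: "\<forall>i\<in>(\<Union>I\<in>Poly_Mapping.keys f. fset I). i < N"
    using finite_nat_bounded by (metis lessThan_iff subsetD)
  have "deriv_\<pi> k f = 0" if "k > N" for k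
  proof (rule poly_mapping_eqI)
    fix J
    have "Poly_Mapping.lookup f (finsert (k - 1) J) = 0"
    proof (rule ccontr)
      assume "Poly_Mapping.lookup f (finsert (k - 1) J) \<noteq> 0"
      then have "k - 1 < N" using N by (auto simp: in_keys_iff)
      with that show False by simp
    qed
    then show "Poly_Mapping.lookup (deriv_\<pi> k f) J = Poly_Mapping.lookup 0 J"
      using that by (simp add: lookup_deriv_\<pi>)
  qed
  then show ?thesis unfolding index_le_def by blast
qed

lemma of_nat_coef_eq_0_iff [simp]: "(of_nat n :: coef) = 0 \<longleftrightarrow> n = 0"
  by (simp add: of_nat_fract Zero_fract_def eq_fract)

lemma op_sum_eq_sum:
  assumes "finite S'" "S' \<subseteq> S" "\<And>i. i \<in> S - S' \<Longrightarrow> A i f = 0"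
  shows "op_sum S A f = (\<Sum>i\<in>S'. A i f)"
proof -
  have "op_sum S A f = (\<Sum>i\<in>S'. if i \<in> S then A i f else 0)"
    unfolding op_sum_def using assms by (intro Sum_any.expand_superset) auto
  also have "\<dots> = (\<Sum>i\<in>S'. A i f)"
    using assms by (intro sum.cong) auto
  finally show ?thesis .
qed

section \<open>Odd derivatives of the fermionic expectation value\<close>

type_synonym series = "int \<Rightarrow> superring"

text \<open>An operator series acting on a series with coefficients in \<open>\<R>\<close>. Products of operator
  series become iterated actions on the constant series of the argument, so that associativity of the
  product, which would need its own convergence argument, never has to be discussed.\<close>

definition act :: "op_series \<Rightarrow> series \<Rightarrow> series" where
  "act A G n = Sum_any (\<lambda>i. A i (G (n - i)))"

definition delta_series :: "superring \<Rightarrow> series" where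
  "delta_series f n = (if n = 0 then f else 0)"

lemma series_mult_apply: "(A \<star> B) n f = act A (\<lambda>n. B n f) n"
  by (simp add: series_mult_def op_sum_def act_def)

lemma series_prod_apply: "series_prod As n f = foldr act As (delta_series f) n"
proof (induction As arbitrary: n)
  case Nil
  show ?case by (simp add: series_prod_def series_one_def op_monom_def delta_series_def)
next
  case (Cons A As)
  have "series_prod (A # As) n f = act A (\<lambda>n. series_prod As n f) n"
    by (simp add: series_prod_def series_mult_apply)
  then show ?case by (simp add: Cons.IH)
qed

definition A_coeff :: "nat \<Rightarrow> nat \<Rightarrow> coef" where
  "A_coeff m k = (if k \<ge> m + 2 then (1 - inverse t_par) * t_par powi (2 - int k + int m) else 0)"

definition B_coeff :: "nat \<Rightarrow> nat \<Rightarrow> coef" where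
  "B_coeff m k = (if k \<ge> m + 2 then (q_par - 1) * q_par powi (int k - 2 - int m) else 0)"

text \<open>Truncated versions of the two fermionic series. Being finite sums they are total and
  linear on all series. They agree with the original ones in each given coefficient
  once the bounds are large enough.\<close>

definition A_trunc :: "nat \<Rightarrow> nat \<Rightarrow> series \<Rightarrow> series" where
  "A_trunc K m G n = (\<Sum>k=1..K. scale (A_coeff m k) (mult_\<pi> k (G (n - 2 * int k + 1))))"

definition B_trunc :: "nat \<Rightarrow> nat \<Rightarrow> series \<Rightarrow> series" where
  "B_trunc N m G n = (\<Sum>k=1..N. scale (B_coeff m k) (deriv_\<pi> k (G (n + 2 * int k - 1))))"

text \<open>The normal-ordered sum over all sets of auxiliary indices from a list, in recursive form: an index
  \<open>m\<close> is either absent or contributes \<open>A\<^sub>m\<close> on the far left and \<open>B\<^sub>m\<close> on the far right. In this arrangement the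
  signs \<open>(-1)\<^bsup>r(r-1)/2\<^esup>\<close> are all absorbed, see \<open>vev_term_Cons\<close>.\<close>

fun vev_trunc :: "nat \<Rightarrow> nat \<Rightarrow> nat list \<Rightarrow> series \<Rightarrow> series" where
  "vev_trunc K N [] G = G"
| "vev_trunc K N (m # ms) G =
     (\<lambda>n. vev_trunc K N ms G n + A_trunc K m (vev_trunc K N ms (B_trunc N m G)) n)"

definition shift_linear :: "(series \<Rightarrow> series) \<Rightarrow> bool" where
  "shift_linear T \<longleftrightarrow> (\<forall>F G n. T (\<lambda>n. F n + G n) n = T F n + T G n) \<and>
     (\<forall>c F n. T (\<lambda>n. scale c (F n)) n = scale c (T F n)) \<and>
     (\<forall>s F n. T (\<lambda>n. F (n + s)) n = T F (n + s))"

lemma shift_linear_add: "shift_linear T \<Longrightarrow> T (\<lambda>n. F n + G n) = (\<lambda>n. T F n + T G n)"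
  by (auto simp: shift_linear_def fun_eq_iff)

lemma shift_linear_scale: "shift_linear T \<Longrightarrow> T (\<lambda>n. scale c (F n)) = (\<lambda>n. scale c (T F n))"
  by (auto simp: shift_linear_def fun_eq_iff)

lemma shift_linear_shift: "shift_linear T \<Longrightarrow> T (\<lambda>n. F (n + s)) = (\<lambda>n. T F (n + s))"
  by (auto simp: shift_linear_def fun_eq_iff)

lemma shift_linear_0: "shift_linear T \<Longrightarrow> T (\<lambda>n. 0) = (\<lambda>n. 0)"
  using shift_linear_scale[of T 0 "\<lambda>n. 0"] by simp

lemma shift_linear_neg: "shift_linear T \<Longrightarrow> T (\<lambda>n. - F n) = (\<lambda>n. - T F n)"
  using shift_linear_scale[of T "- 1" F] by simp

lemma shift_linear_sum: "shift_linear T \<Longrightarrow> T (\<lambda>n. \<Sum>i\<in>S. F i n) = (\<lambda>n. \<Sum>i\<in>S. T (F i) n)"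
proof (induction S rule: infinite_finite_induct)
  case (insert x S)
  then show ?case using shift_linear_add[of T "F x" "\<lambda>n. \<Sum>i\<in>S. F i n"] by simp
qed (simp_all add: shift_linear_0)

lemma shift_linear_sum_list: "shift_linear T \<Longrightarrow> T (\<lambda>n. \<Sum>i\<leftarrow>xs. F i n) = (\<lambda>n. \<Sum>i\<leftarrow>xs. T (F i) n)"
proof (induction xs)
  case (Cons x xs)
  then show ?case using shift_linear_add[of T "F x" "\<lambda>n. \<Sum>i\<leftarrow>xs. F i n"] by simp
qed (simp_all add: shift_linear_0)

lemma shift_linear_comp: "shift_linear S \<Longrightarrow> shift_linear T \<Longrightarrow> shift_linear (\<lambda>F. S (T F))"
  unfolding shift_linear_def[of "\<lambda>F. S (T F)"] by (simp add: shift_linear_add shift_linear_scale shift_linear_shift)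

lemma shift_linear_addI: "shift_linear S \<Longrightarrow> shift_linear T \<Longrightarrow> shift_linear (\<lambda>F n. S F n + T F n)"
  unfolding shift_linear_def[of "\<lambda>F n. S F n + T F n"]
  by (simp add: shift_linear_add shift_linear_scale shift_linear_shift vs.scale_right_distrib)

lemma shift_linear_A_trunc: "shift_linear (A_trunc K m)"
  unfolding shift_linear_def A_trunc_def
  by (auto simp: sum.distrib[symmetric] vs.scale_sum_right lin_add[OF lin_mult_\<pi>]
      lin_scale[OF lin_mult_\<pi>] vs.scale_right_distrib vs.scale_left_commute algebra_simps
      intro!: sum.cong)

lemma shift_linear_B_trunc: "shift_linear (B_trunc K m)"
  unfolding shift_linear_def B_trunc_def
  by (auto simp: sum.distrib[symmetric] vs.scale_sum_right lin_add[OF lin_deriv_\<pi>]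
      lin_scale[OF lin_deriv_\<pi>] vs.scale_right_distrib vs.scale_left_commute algebra_simps
      intro!: sum.cong)

lemma shift_linear_vev_trunc: "shift_linear (vev_trunc K N ms)"
proof (induction ms)
  case Nil
  then show ?case by (simp add: shift_linear_def)
next
  case (Cons m ms)
  show ?case unfolding vev_trunc.simps
    by (intro shift_linear_addI Cons shift_linear_comp[OF shift_linear_A_trunc] shift_linear_comp[OF Cons shift_linear_B_trunc])
qed

lemma deriv_B_trunc:
  assumes "j \<ge> 1"
  shows "deriv_\<pi> j (B_trunc N m G n) = - B_trunc N m (\<lambda>n. deriv_\<pi> j (G n)) n"
proof -
  have "deriv_\<pi> j (B_trunc N m G n) =
      (\<Sum>k=1..N. - scale (B_coeff m k) (deriv_\<pi> k (deriv_\<pi> j (G (n + 2 * int k - 1)))))"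
    unfolding B_trunc_def lin_sum[OF lin_deriv_\<pi>[OF assms]]
  proof (rule sum.cong)
    fix k assume "k \<in> {1..N}"
    then show "deriv_\<pi> j (scale (B_coeff m k) (deriv_\<pi> k (G (n + 2 * int k - 1)))) =
        - scale (B_coeff m k) (deriv_\<pi> k (deriv_\<pi> j (G (n + 2 * int k - 1))))"
      using deriv_\<pi>_swap[of j k "G (n + 2 * int k - 1)"] assms
      by (simp add: lin_scale[OF lin_deriv_\<pi>])
  qed simp
  then show ?thesis by (simp add: sum_negf B_trunc_def)
qed

lemma B_trunc_anticomm: "B_trunc N x (B_trunc N m G) n = - B_trunc N m (B_trunc N x G) n"
proof -
  have "B_trunc N x (B_trunc N m G) n =
      (\<Sum>k=1..N. scale (B_coeff x k) (- B_trunc N m (\<lambda>n. deriv_\<pi> k (G n)) (n + 2 * int k - 1)))"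
    unfolding B_trunc_def[of N x]
    by (intro sum.cong refl arg_cong2[where f = scale] deriv_B_trunc) auto
  also have "\<dots> = - (\<Sum>k=1..N. B_trunc N m (\<lambda>n. scale (B_coeff x k) (deriv_\<pi> k (G (n + 2 * int k - 1)))) n)"
    using shift_linear_scale[OF shift_linear_B_trunc[of N m]]
      shift_linear_shift[OF shift_linear_B_trunc[of N m], of "\<lambda>n. deriv_\<pi> _ (G n)" "2 * int _ - 1"]
    by (simp add: sum_negf add_diff_eq)
  also have "(\<Sum>k=1..N. B_trunc N m (\<lambda>n. scale (B_coeff x k) (deriv_\<pi> k (G (n + 2 * int k - 1)))) n)
      = B_trunc N m (B_trunc N x G) n"
    unfolding B_trunc_def[of N x, abs_def] shift_linear_sum[OF shift_linear_B_trunc] ..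
  finally show ?thesis .
qed

lemma eq_neg_self_imp_0:
  fixes f :: superring
  assumes "f = - f"
  shows "f = 0"
proof -
  have "scale (of_nat 2) f = f + f"
    using vs.scale_left_distrib[of 1 1 f] by simp
  also have "\<dots> = 0"
    by (subst (2) assms) simp
  finally show ?thesis
    unfolding vs.scale_eq_0_iff of_nat_coef_eq_0_iff by simp
qed

lemma B_trunc_square: "B_trunc N m (B_trunc N m G) n = 0"
  by (rule eq_neg_self_imp_0, rule B_trunc_anticomm)

lemma deriv_A_trunc:
  assumes "j \<ge> 1" "j \<le> K"
  shows "deriv_\<pi> j (A_trunc K m G n) =
    scale (A_coeff m j) (G (n - 2 * int j + 1)) - A_trunc K m (\<lambda>n. deriv_\<pi> j (G n)) n"
proof -
  have swap: "deriv_\<pi> j (mult_\<pi> k g) = (if j = k then g else 0) - mult_\<pi> k (deriv_\<pi> j g)"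
    if "k \<ge> 1" for k g
    using deriv_\<pi>_mult_\<pi>[OF assms(1) that] unfolding anticommutator_def fun_eq_iff
    by (simp add: eq_diff_eq)
  have "deriv_\<pi> j (A_trunc K m G n) =
      (\<Sum>k=1..K. (if j = k then scale (A_coeff m k) (G (n - 2 * int k + 1)) else 0)
        - scale (A_coeff m k) (mult_\<pi> k (deriv_\<pi> j (G (n - 2 * int k + 1)))))"
    unfolding A_trunc_def lin_sum[OF lin_deriv_\<pi>[OF assms(1)]]
    by (intro sum.cong refl)
       (simp add: lin_scale[OF lin_deriv_\<pi>] assms(1)[simplified] swap vs.scale_right_diff_distrib)
  also have "\<dots> = scale (A_coeff m j) (G (n - 2 * int j + 1)) - A_trunc K m (\<lambda>n. deriv_\<pi> j (G n)) n"
    using assms by (simp add: sum_subtractf A_trunc_def sum.delta)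
  finally show ?thesis .
qed

text \<open>The series \<open>(d\<^sub>j + \<Sum>\<^sub>m a\<^sub>m(j) w\<^bsup>2j-1\<^esup> B\<^sub>m) G\<close>, where \<open>a\<^sub>m(j)\<close> is the coefficient of \<open>\<pi>\<^sub>j\<close> in \<open>A\<^sub>m\<close>: what \<open>d\<^sub>j\<close> becomes
  after it has been moved to the right of the expectation value.\<close>

definition deriv_image :: "nat \<Rightarrow> nat list \<Rightarrow> nat \<Rightarrow> series \<Rightarrow> series" where
  "deriv_image N ms j G n =
     deriv_\<pi> j (G n) + (\<Sum>m\<leftarrow>ms. scale (A_coeff m j) (B_trunc N m G (n + (1 - 2 * int j))))"

lemma B_trunc_deriv_image:
  assumes "j \<ge> 1"
  shows "B_trunc N x (deriv_image N ms j G) n = - deriv_image N ms j (B_trunc N x G) n"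
proof -
  have "B_trunc N x (deriv_image N ms j G) n = B_trunc N x (\<lambda>n. deriv_\<pi> j (G n)) n +
      (\<Sum>m\<leftarrow>ms. scale (A_coeff m j) (B_trunc N x (B_trunc N m G) (n + (1 - 2 * int j))))"
    unfolding deriv_image_def[abs_def] shift_linear_add[OF shift_linear_B_trunc] shift_linear_sum_list[OF shift_linear_B_trunc]
      shift_linear_scale[OF shift_linear_B_trunc] shift_linear_shift[OF shift_linear_B_trunc] ..
  also have "\<dots> = - deriv_image N ms j (B_trunc N x G) n"
    unfolding deriv_image_def using B_trunc_anticomm[of N x]
    by (simp add: deriv_B_trunc[OF assms] uminus_sum_list_map comp_def)
  finally show ?thesis .
qed

text \<open>When \<open>d\<^sub>j\<close> passes a factor \<open>A\<^sub>x\<close> it either contracts with it, which leaves \<open>a\<^sub>x(j) B\<^sub>x\<close> on the right, or changes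
  sign. Since \<open>B\<^sub>x\<close> anticommutes with \<open>d\<^sub>j\<close> and all \<open>B\<^sub>m\<close>, this sign is compensated on the right, and the unwanted
  contraction term on the other branch of the recursion vanishes because \<open>B\<^sub>x\<^sup>2 = 0\<close>.\<close>

lemma deriv_vev_trunc:
  assumes "j \<ge> 1" "j \<le> K"
  shows "deriv_\<pi> j (vev_trunc K N ms G n) = vev_trunc K N ms (deriv_image N ms j G) n"
proof (induction ms arbitrary: G n)
  case Nil
  show ?case by (simp add: deriv_image_def)
next
  case (Cons x ms)
  let ?U = "vev_trunc K N ms" and ?B = "B_trunc N x" and ?A = "A_trunc K x"
  have split: "deriv_image N (x # ms) j G =
      (\<lambda>n. deriv_image N ms j G n + scale (A_coeff x j) (?B G (n + (1 - 2 * int j))))"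
    by (simp add: deriv_image_def fun_eq_iff add_ac)
  have B: "?B (deriv_image N (x # ms) j G) = (\<lambda>n. - deriv_image N ms j (?B G) n)"
    unfolding split shift_linear_add[OF shift_linear_B_trunc] shift_linear_scale[OF shift_linear_B_trunc] shift_linear_shift[OF shift_linear_B_trunc]
    by (simp add: B_trunc_square B_trunc_deriv_image[OF assms(1)])
  have "deriv_\<pi> j (vev_trunc K N (x # ms) G n) =
      ?U (deriv_image N ms j G) n + (scale (A_coeff x j) (?U (?B G) (n + (1 - 2 * int j)))
        - ?A (?U (deriv_image N ms j (?B G))) n)"
    by (simp add: lin_add[OF lin_deriv_\<pi>[OF assms(1)]] deriv_A_trunc[OF assms] Cons algebra_simps)
  also have "\<dots> = vev_trunc K N (x # ms) (deriv_image N (x # ms) j G) n"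
    unfolding vev_trunc.simps B shift_linear_neg[OF shift_linear_vev_trunc] shift_linear_neg[OF shift_linear_A_trunc]
    unfolding split shift_linear_add[OF shift_linear_vev_trunc] shift_linear_scale[OF shift_linear_vev_trunc]
      shift_linear_shift[OF shift_linear_vev_trunc]
    by simp
  finally show ?case .
qed

lemma vev_trunc_vacuum:
  "Poly_Mapping.lookup (vev_trunc K N ms G n) {||} = Poly_Mapping.lookup (G n) {||}"
proof (induction ms arbitrary: G n)
  case (Cons m ms)
  have "Poly_Mapping.lookup (A_trunc K m H n) {||} = 0" for H
    unfolding A_trunc_def lookup_sum by (auto simp: lookup_scale lookup_mult_\<pi> intro!: sum.neutral)
  then show ?case by (simp add: lookup_add Cons)
qed simp

text \<open>Moving \<open>B\<^sub>m\<close> across \<open>r\<close> anticommuting factors gives \<open>(-1)\<^sup>r\<close>, the quotient of the normal-ordering signs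
  for \<open>r + 1\<close> and \<open>r\<close> pairs.\<close>

lemma B_trunc_foldr:
  "B_trunc N m (foldr (B_trunc N) ms G) n =
    scale ((- 1) ^ length ms) (foldr (B_trunc N) ms (B_trunc N m G) n)"
proof (induction ms arbitrary: n)
  case (Cons x ms)
  have IH: "B_trunc N m (foldr (B_trunc N) ms G) =
      (\<lambda>n. scale ((- 1) ^ length ms) (foldr (B_trunc N) ms (B_trunc N m G) n))"
    by (rule ext) (rule Cons)
  have "B_trunc N m (foldr (B_trunc N) (x # ms) G) n =
      - B_trunc N x (B_trunc N m (foldr (B_trunc N) ms G)) n"
    unfolding foldr.simps comp_apply by (rule B_trunc_anticomm)
  also have "\<dots> = - scale ((- 1) ^ length ms) (foldr (B_trunc N) (x # ms) (B_trunc N m G) n)"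
    unfolding IH shift_linear_scale[OF shift_linear_B_trunc] by simp
  finally show ?case by simp
qed simp

definition vev_term :: "nat \<Rightarrow> nat \<Rightarrow> nat list \<Rightarrow> series \<Rightarrow> series" where
  "vev_term K N ms G n = scale ((- 1) ^ (length ms * (length ms - 1) div 2))
     (foldr (A_trunc K) ms (foldr (B_trunc N) ms G) n)"

lemma shift_linear_foldr_A: "shift_linear (foldr (A_trunc K) ms)"
proof (induction ms)
  case Nil
  then show ?case by (simp add: shift_linear_def)
next
  case (Cons m ms)
  from shift_linear_comp[OF shift_linear_A_trunc Cons] show ?case by (simp add: comp_def)
qed

lemma vev_term_Cons: "vev_term K N (m # ms) G n = A_trunc K m (vev_term K N ms (B_trunc N m G)) n"
proof -
  let ?r = "length ms"
  have B: "B_trunc N m (foldr (B_trunc N) ms G) =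
      (\<lambda>n. scale ((- 1) ^ ?r) (foldr (B_trunc N) ms (B_trunc N m G) n))"
    by (rule ext) (rule B_trunc_foldr)
  have "Suc ?r * ?r = ?r * (?r - 1) + ?r * 2"
    by (cases ?r) auto
  then have s: "Suc ?r * ?r div 2 = ?r * (?r - 1) div 2 + ?r"
    by simp
  show ?thesis
    unfolding vev_term_def[abs_def] shift_linear_scale[OF shift_linear_A_trunc]
    using s by (simp add: B shift_linear_scale[OF shift_linear_foldr_A] shift_linear_scale[OF shift_linear_A_trunc] power_add
        power_mult_distrib[symmetric] mult.assoc flip: power_mult)
qed

lemma vev_trunc_eq_sum:
  "vev_trunc K N xs G n = (\<Sum>ms\<leftarrow>subseqs xs. vev_term K N ms G n)"
proof (induction xs arbitrary: G n)
  case Nil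
  show ?case by (simp add: vev_term_def)
next
  case (Cons x xs)
  have IH: "vev_trunc K N xs (B_trunc N x G) =
      (\<lambda>n. \<Sum>ms\<leftarrow>subseqs xs. vev_term K N ms (B_trunc N x G) n)"
    by (rule ext) (rule Cons)
  show ?case
    by (simp add: Cons[of G] IH shift_linear_sum_list[OF shift_linear_A_trunc] Let_def comp_def vev_term_Cons add.commute)
qed

text \<open>The strictly increasing index lists below \<open>N\<close> are enumerated by a recursion on lists, which is how
  the sum in the definition of the expectation value meets the recursion of \<open>vev_trunc\<close>.\<close>

lemma subseqs_upt_iff:
  "ms \<in> set (subseqs [0..<N]) \<longleftrightarrow> sorted_wrt (<) ms \<and> set ms \<subseteq> {..<N}"
proof -
  have sorted: "sorted_wrt (<) ys" if "ys \<in> set (subseqs xs)" "sorted_wrt (<) xs" for ys xs :: "nat list"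
    using that
  proof (induction xs arbitrary: ys)
    case (Cons x xs)
    have "set zs \<subseteq> set xs" if "zs \<in> set (subseqs xs)" for zs
      using that subseqs_powset[of xs] by blast
    then have "\<forall>z\<in>set zs. x < z" if "zs \<in> set (subseqs xs)" for zs
      using that Cons.prems(2) by auto
    with Cons show ?case by (auto simp: Let_def)
  qed simp
  have sub: "set ys \<subseteq> {..<N}" if "ys \<in> set (subseqs [0..<N])" for ys
  proof -
    have "set ys \<in> set ` set (subseqs [0..<N])" using that by simp
    then show ?thesis unfolding subseqs_powset by auto
  qed
  have "ms \<in> set (subseqs [0..<N])" if "sorted_wrt (<) ms" "set ms \<subseteq> {..<N}"
  proof -
    have "set ms \<in> set ` set (subseqs [0..<N])"
      unfolding subseqs_powset using that(2) by auto
    then obtain ys where ys: "ys \<in> set (subseqs [0..<N])" "set ys = set ms" by auto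
    then have "ys = ms"
      using sorted[OF ys(1)] that(1) strict_sorted_equal by auto
    with ys show ?thesis by simp
  qed
  then show ?thesis using sorted sub by auto
qed

lemma A_F_apply:
  "A_F m i f = (if \<exists>k\<ge>m + 2. i = 2 * int k - 1
    then scale (A_coeff m (nat ((i + 1) div 2))) (mult_\<pi> (nat ((i + 1) div 2)) f) else 0)"
proof -
  let ?T = "\<lambda>k. op_monom (2 * int k - 1) (\<lambda>f. scale (t_par powi (2 - int k + int m)) (mult_\<pi> k f))"
  have A: "A_F m i f = scale (1 - inverse t_par) (op_sum {m + 2..} (\<lambda>k. ?T k i) f)"
    by (simp add: A_F_def series_scale_def series_sum_def)
  show ?thesis
  proof (cases "\<exists>k\<ge>m + 2. i = 2 * int k - 1")
    case True
    then obtain k where k: "k \<ge> m + 2" "i = 2 * int k - 1" by auto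
    then have "op_sum {m + 2..} (\<lambda>k. ?T k i) f = (\<Sum>k\<in>{k}. ?T k i f)"
      by (intro op_sum_eq_sum) (auto simp: op_monom_def)
    then show ?thesis
      unfolding A using True k by (simp add: A_coeff_def op_monom_def)
  next
    case False
    then have "op_sum {m + 2..} (\<lambda>k. ?T k i) f = (\<Sum>k\<in>{}. ?T k i f)"
      by (intro op_sum_eq_sum) (auto simp: op_monom_def)
    then show ?thesis
      using A by (subst if_not_P[OF False]) simp
  qed
qed

lemma B_F_apply:
  "B_F m i f = (if \<exists>k\<ge>m + 2. i = - 2 * int k + 1
    then scale (B_coeff m (nat ((1 - i) div 2))) (deriv_\<pi> (nat ((1 - i) div 2)) f) else 0)"
proof -
  let ?T = "\<lambda>k. op_monom (- 2 * int k + 1) (\<lambda>f. scale (q_par powi (int k - 2 - int m)) (deriv_\<pi> k f))"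
  have B: "B_F m i f = scale (q_par - 1) (op_sum {m + 2..} (\<lambda>k. ?T k i) f)"
    by (simp add: B_F_def series_scale_def series_sum_def)
  show ?thesis
  proof (cases "\<exists>k\<ge>m + 2. i = - 2 * int k + 1")
    case True
    then obtain k where k: "k \<ge> m + 2" "i = - 2 * int k + 1" by auto
    then have "op_sum {m + 2..} (\<lambda>k. ?T k i) f = (\<Sum>k\<in>{k}. ?T k i f)"
      by (intro op_sum_eq_sum) (auto simp: op_monom_def)
    then show ?thesis
      unfolding B using True k by (simp add: B_coeff_def op_monom_def)
  next
    case False
    then have "op_sum {m + 2..} (\<lambda>k. ?T k i) f = (\<Sum>k\<in>{}. ?T k i f)"
      by (intro op_sum_eq_sum) (auto simp: op_monom_def)
    then show ?thesis
      using B by (subst if_not_P[OF False]) simp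
  qed
qed

text \<open>\<open>A\<^sub>m\<close> raises the exponent, so only boundedly many of its terms reach a given coefficient of a
  series that is bounded below.\<close>

lemma act_A_F:
  assumes "\<And>n. n < L \<Longrightarrow> G n = 0" and "n - 2 * int K - 1 < L"
  shows "act (A_F m) G n = A_trunc K m G n"
proof -
  have "act (A_F m) G n = (\<Sum>i\<in>(\<lambda>k. 2 * int k - 1) ` {1..K}. A_F m i (G (n - i)))"
    unfolding act_def
  proof (rule Sum_any.expand_superset)
    show "{i. A_F m i (G (n - i)) \<noteq> 0} \<subseteq> (\<lambda>k. 2 * int k - 1) ` {1..K}"
    proof
      fix i assume "i \<in> {i. A_F m i (G (n - i)) \<noteq> 0}"
      then have nz: "A_F m i (G (n - i)) \<noteq> 0" by simp
      then obtain k where k: "k \<ge> m + 2" "i = 2 * int k - 1"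
        by (auto simp: A_F_apply split: if_splits)
      have "k \<le> K"
      proof (rule ccontr)
        assume "\<not> k \<le> K"
        then have "G (n - i) = 0" using assms k by auto
        with nz k show False
          by (simp add: A_F_apply lin_0[OF lin_mult_\<pi>])
      qed
      with k show "i \<in> (\<lambda>k. 2 * int k - 1) ` {1..K}" by auto
    qed
  qed simp
  also have "\<dots> = (\<Sum>k=1..K. A_F m (2 * int k - 1) (G (n - (2 * int k - 1))))"
    by (subst sum.reindex) (auto simp: inj_on_def)
  also have "\<dots> = A_trunc K m G n"
    unfolding A_trunc_def
    by (intro sum.cong refl) (auto simp: A_F_apply A_coeff_def algebra_simps)
  finally show ?thesis .
qed

lemma act_B_F:
  assumes "\<And>n. index_le N (G n)"
  shows "act (B_F m) G n = B_trunc N m G n"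
proof -
  have "act (B_F m) G n = (\<Sum>i\<in>(\<lambda>k. - 2 * int k + 1) ` {1..N}. B_F m i (G (n - i)))"
    unfolding act_def
  proof (rule Sum_any.expand_superset)
    show "{i. B_F m i (G (n - i)) \<noteq> 0} \<subseteq> (\<lambda>k. - 2 * int k + 1) ` {1..N}"
    proof
      fix i assume "i \<in> {i. B_F m i (G (n - i)) \<noteq> 0}"
      then have nz: "B_F m i (G (n - i)) \<noteq> 0" by simp
      then obtain k where k: "k \<ge> m + 2" "i = - 2 * int k + 1"
        by (auto simp: B_F_apply split: if_splits)
      have "k \<le> N"
      proof (rule ccontr)
        assume "\<not> k \<le> N"
        then have "deriv_\<pi> k (G (n - i)) = 0" using assms by (auto simp: index_le_def)
        with nz k show False
          by (simp add: B_F_apply)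
      qed
      with k show "i \<in> (\<lambda>k. - 2 * int k + 1) ` {1..N}" by auto
    qed
  qed simp
  also have "\<dots> = (\<Sum>k=1..N. B_F m (- 2 * int k + 1) (G (n - (- 2 * int k + 1))))"
    by (subst sum.reindex) (auto simp: inj_on_def)
  also have "\<dots> = B_trunc N m G n"
    unfolding B_trunc_def
    by (intro sum.cong refl) (auto simp: B_F_apply B_coeff_def algebra_simps)
  finally show ?thesis .
qed

lemma index_le_delta: "index_le N f \<Longrightarrow> index_le N (delta_series f n)"
  by (simp add: delta_series_def)

lemma index_le_B_trunc:
  assumes "\<And>n. index_le N (G n)"
  shows "index_le N (B_trunc N m G n)"
  unfolding B_trunc_def by (auto intro!: index_le_sum index_le_scale index_le_deriv_\<pi> assms)

lemma foldr_act_B_F: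
  assumes "\<And>n. index_le N (G n)"
  shows "foldr act (map B_F ms) G = foldr (B_trunc N) ms G \<and>
    (\<forall>n. index_le N (foldr (B_trunc N) ms G n))"
proof (induction ms)
  case (Cons m ms)
  then have eq: "foldr act (map B_F ms) G = foldr (B_trunc N) ms G"
    and le: "\<And>n. index_le N (foldr (B_trunc N) ms G n)" by auto
  show ?case
    using act_B_F[of N "foldr (B_trunc N) ms G" m] index_le_B_trunc[of N "foldr (B_trunc N) ms G" m]
    by (auto simp: eq le fun_eq_iff)
qed (simp add: assms)

lemma foldr_B_trunc_zero_below:
  assumes "\<And>n. n < L \<Longrightarrow> G n = 0" and "n < L - 2 * int N * int (length ms)"
  shows "foldr (B_trunc N) ms G n = 0"
  using assms(2)
proof (induction ms arbitrary: n)
  case (Cons m ms)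
  have "foldr (B_trunc N) ms G (n + 2 * int k - 1) = 0" if "k \<in> {1..N}" for k
    using that Cons.prems by (intro Cons.IH) (auto simp: algebra_simps)
  then show ?case
    by (auto simp: B_trunc_def[of N m] lin_0[OF lin_deriv_\<pi>] intro!: sum.neutral)
qed (simp add: assms)

text \<open>Only the \<open>B\<^sub>m\<close> with \<open>m < N\<close> involve a derivative with index at most \<open>N\<close>; this makes the sum over auxiliary
  indices finite on each element.\<close>

lemma foldr_B_trunc_large:
  assumes "m \<in> set ms" "m \<ge> N"
  shows "foldr (B_trunc N) ms G = (\<lambda>n. 0)"
  using assms(1)
proof (induction ms)
  case (Cons x ms)
  show ?case
  proof (cases "m = x")
    case True
    have "B_trunc N x H n = 0" for H n
      unfolding B_trunc_def using True assms(2) by (intro sum.neutral) (auto simp: B_coeff_def)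
    then show ?thesis by (simp add: fun_eq_iff)
  next
    case False
    then show ?thesis using Cons by (simp add: shift_linear_0[OF shift_linear_B_trunc])
  qed
qed simp

lemma foldr_act_A_F:
  assumes "\<And>n. n < L \<Longrightarrow> G n = 0" and "n0 - 2 * int K - 1 < L"
  shows "n \<le> n0 \<Longrightarrow> foldr act (map A_F ms) G n = foldr (A_trunc K) ms G n"
    and "n < L \<Longrightarrow> foldr act (map A_F ms) G n = 0"
proof (induction ms arbitrary: n)
  case (Cons m ms)
  {
    case 1
    have "foldr act (map A_F (m # ms)) G n = A_trunc K m (foldr act (map A_F ms) G) n"
      using Cons.IH(2) assms(2) 1 by (simp add: act_A_F[where L = L])
    also have "\<dots> = A_trunc K m (foldr (A_trunc K) ms G) n"
      unfolding A_trunc_def[of K m]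
      by (intro sum.cong refl arg_cong2[where f = scale] arg_cong2[where f = mult_\<pi>] Cons.IH(1))
         (use 1 in auto)
    finally show ?case by simp
  next
    case 2
    have "n - 2 * int 0 - 1 < L" using 2 by simp
    then have "foldr act (map A_F (m # ms)) G n = A_trunc 0 m (foldr act (map A_F ms) G) n"
      using Cons.IH(2) by (simp only: list.map foldr.simps comp_apply act_A_F[where L = L])
    then show ?case by (simp add: A_trunc_def)
  }
qed (simp_all add: assms)

lemma vev_summand:
  assumes "index_le N f" and "n + 2 * int N * int (length ms) \<le> int K"
  shows "series_prod (map A_F ms @ map B_F ms) n f =
    foldr (A_trunc K) ms (foldr (B_trunc N) ms (delta_series f)) n"
proof -
  let ?G = "foldr (B_trunc N) ms (delta_series f)"
  have "series_prod (map A_F ms @ map B_F ms) n f = foldr act (map A_F ms) ?G n"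
    using foldr_act_B_F[of N "delta_series f" ms] index_le_delta[OF assms(1)]
    by (simp add: series_prod_apply)
  also have "\<dots> = foldr (A_trunc K) ms ?G n"
  proof (rule foldr_act_A_F(1))
    show "?G n = 0" if "n < - 2 * int N * int (length ms)" for n
      using that by (intro foldr_B_trunc_zero_below[where L = 0]) (auto simp: delta_series_def)
  qed (use assms(2) in auto)
  finally show ?thesis .
qed

lemma length_subseqs: "ys \<in> set (subseqs xs) \<Longrightarrow> length ys \<le> length xs"
  by (induction xs arbitrary: ys) (auto simp: Let_def le_SucI)

text \<open>The bound on \<open>K\<close> depends only on \<open>n\<close> and \<open>N\<close>: a product of at most \<open>N\<close> factors \<open>B\<^sub>m\<close> lowers the exponent by
  at most \<open>2N\<^sup>2\<close>. Hence one truncation serves all arguments in \<open>deriv_V_F_vev\<close> at once.\<close>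

lemma V_F_vev_eq_trunc:
  assumes "index_le N f" and "n + 2 * int N * int N \<le> int K"
  shows "V_F_vev n f = vev_trunc K N [0..<N] (delta_series f) n"
proof -
  let ?S = "set (subseqs [0..<N])"
  let ?P = "\<lambda>ms. series_prod (map A_F ms @ map B_F ms)"
  let ?sgn = "\<lambda>r. (- 1 :: coef) ^ (r * (r - 1) div 2)"
  have zero: "?P ms n f = 0" if "sorted_wrt (<) ms" "ms \<notin> ?S" for ms
  proof -
    from that obtain m where "m \<in> set ms" "m \<ge> N"
      unfolding subseqs_upt_iff by force
    then show ?thesis
      using foldr_B_trunc_large[of m ms N] shift_linear_0[OF shift_linear_foldr_A]
        vev_summand[OF assms(1), of n ms "nat (n + 2 * int N * int (length ms))"]
      by simp
  qed
  have inner: "op_sum {ms. length ms = r \<and> sorted_wrt (<) ms} (\<lambda>ms. ?P ms n) f =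
      (\<Sum>ms | ms \<in> ?S \<and> length ms = r. ?P ms n f)" for r
  proof (rule op_sum_eq_sum)
    show "finite {ms. ms \<in> ?S \<and> length ms = r}" by simp
    show "{ms. ms \<in> ?S \<and> length ms = r} \<subseteq> {ms. length ms = r \<and> sorted_wrt (<) ms}"
      by (auto simp: subseqs_upt_iff)
  qed (use zero in blast)
  have empty: "{ms. ms \<in> ?S \<and> length ms = r} = {}" if "r > N" for r
    using that length_subseqs[of _ "[0..<N]"] by (fastforce dest: leD)
  have "V_F_vev n f = op_sum UNIV (\<lambda>r f. scale (?sgn r)
      (op_sum {ms. length ms = r \<and> sorted_wrt (<) ms} (\<lambda>ms. ?P ms n) f)) f"
    by (simp add: V_F_vev_def series_sum_def series_scale_def)
  also have "\<dots> = (\<Sum>r\<in>{..N}. scale (?sgn r) (\<Sum>ms | ms \<in> ?S \<and> length ms = r. ?P ms n f))"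
    unfolding inner[symmetric] by (rule op_sum_eq_sum) (auto simp: inner empty)
  also have "\<dots> = (\<Sum>r\<in>{..N}. \<Sum>ms | ms \<in> ?S \<and> length ms = r. vev_term K N ms (delta_series f) n)"
    unfolding vs.scale_sum_right
  proof (intro sum.cong refl)
    fix r ms assume "r \<in> {..N}" "ms \<in> {ms. ms \<in> ?S \<and> length ms = r}"
    then have r: "r \<le> N" "length ms = r" by auto
    have "n + 2 * int N * int (length ms) \<le> n + 2 * int N * int N"
      using r by (intro add_left_mono mult_left_mono) auto
    then show "scale (?sgn r) (?P ms n f) = vev_term K N ms (delta_series f) n"
      using r assms by (simp add: vev_term_def vev_summand)
  qed
  also have "\<dots> = (\<Sum>ms\<in>?S. vev_term K N ms (delta_series f) n)"
    using length_subseqs[of _ "[0..<N]"]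
    by (intro sum.group) auto
  also have "\<dots> = (\<Sum>ms\<leftarrow>subseqs [0..<N]. vev_term K N ms (delta_series f) n)"
    using distinct_set_subseqs[of "[0..<N]"]
    by (simp add: distinct_map sum_list_distinct_conv_sum_set)
  also have "\<dots> = vev_trunc K N [0..<N] (delta_series f) n"
    by (simp add: vev_trunc_eq_sum)
  finally show ?thesis .
qed

text \<open>The matrix of the linear substitution of the \<open>\<pi>\<^sub>k\<close> effected by the expectation value (with the powers of
  \<open>w\<close> stripped off). The summand vanishes unless \<open>m + 2 \<le> min j l\<close>. For \<open>j = 0\<close> and
  \<open>l \<ge> 1\<close> the value is 0.\<close>

definition ferm_coeff :: "nat \<Rightarrow> nat \<Rightarrow> coef" where
  "ferm_coeff j l = (if j = l then 1 else 0) + (\<Sum>m<l. A_coeff m j * B_coeff m l)"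

lemma deriv_V_F_vev:
  assumes "index_le N f" "j \<ge> 1"
  shows "deriv_\<pi> j (V_F_vev n f) =
    (\<Sum>l=1..N. scale (ferm_coeff j l) (V_F_vev (n - 2 * int j + 2 * int l) (deriv_\<pi> l f)))"
proof -
  define K where "K = nat (\<bar>n\<bar> + 2 * int N + 2 * int N * int N + int j)"
  have jK: "j \<le> K"
  proof -
    have "0 \<le> 2 * int N * int N" by simp
    then have "int j \<le> \<bar>n\<bar> + 2 * int N + 2 * int N * int N + int j" by linarith
    then show ?thesis unfolding K_def by linarith
  qed
  let ?U = "vev_trunc K N [0..<N]"
  have U: "V_F_vev n' g = ?U (delta_series g) n'" if "index_le N g" "n' \<le> n + 2 * int N" for n' g
    using that by (intro V_F_vev_eq_trunc) (auto simp: K_def)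
  have d: "(\<lambda>n. deriv_\<pi> l (delta_series f n)) = delta_series (deriv_\<pi> l f)" if "l \<ge> 1" for l
    using that by (auto simp: delta_series_def fun_eq_iff lin_0[OF lin_deriv_\<pi>])
  have B: "?U (B_trunc N m (delta_series f)) (n + (1 - 2 * int j)) =
      (\<Sum>l=1..N. scale (B_coeff m l) (V_F_vev (n - 2 * int j + 2 * int l) (deriv_\<pi> l f)))" for m
  proof -
    have "B_trunc N m (delta_series f) =
        (\<lambda>n. \<Sum>l=1..N. scale (B_coeff m l) (delta_series (deriv_\<pi> l f) (n + (2 * int l - 1))))"
      unfolding B_trunc_def
      by (intro ext sum.cong refl arg_cong2[where f = scale]) (simp add: d[symmetric] add_diff_eq)
    then have "?U (B_trunc N m (delta_series f)) (n + (1 - 2 * int j)) =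
        (\<Sum>l=1..N. scale (B_coeff m l) (?U (delta_series (deriv_\<pi> l f)) (n + (1 - 2 * int j) + (2 * int l - 1))))"
      by (simp add: shift_linear_sum[OF shift_linear_vev_trunc] shift_linear_scale[OF shift_linear_vev_trunc]
          shift_linear_shift[OF shift_linear_vev_trunc])
    also have "\<dots> = (\<Sum>l=1..N. scale (B_coeff m l) (V_F_vev (n - 2 * int j + 2 * int l) (deriv_\<pi> l f)))"
      by (intro sum.cong refl arg_cong2[where f = scale])
         (use assms in \<open>auto simp: U index_le_deriv_\<pi> algebra_simps\<close>)
    finally show ?thesis .
  qed
  have "deriv_\<pi> j (V_F_vev n f) = ?U (deriv_image N [0..<N] j (delta_series f)) n"
    using assms jK by (simp add: U deriv_vev_trunc)
  also have "\<dots> = ?U (delta_series (deriv_\<pi> j f)) n +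
      (\<Sum>m\<leftarrow>[0..<N]. scale (A_coeff m j) (?U (B_trunc N m (delta_series f)) (n + (1 - 2 * int j))))"
    unfolding deriv_image_def[abs_def] shift_linear_add[OF shift_linear_vev_trunc] shift_linear_sum_list[OF shift_linear_vev_trunc]
      shift_linear_scale[OF shift_linear_vev_trunc] shift_linear_shift[OF shift_linear_vev_trunc] d[OF assms(2)] ..
  also have "\<dots> = V_F_vev n (deriv_\<pi> j f) + (\<Sum>m<N. \<Sum>l=1..N.
      scale (A_coeff m j * B_coeff m l) (V_F_vev (n - 2 * int j + 2 * int l) (deriv_\<pi> l f)))"
    using assms
    by (simp add: B U index_le_deriv_\<pi> interv_sum_list_conv_sum_set_nat atLeast0LessThan
        vs.scale_sum_right)
  also have "(\<Sum>m<N. \<Sum>l=1..N.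
      scale (A_coeff m j * B_coeff m l) (V_F_vev (n - 2 * int j + 2 * int l) (deriv_\<pi> l f))) =
      (\<Sum>l=1..N. scale (\<Sum>m<l. A_coeff m j * B_coeff m l) (V_F_vev (n - 2 * int j + 2 * int l) (deriv_\<pi> l f)))"
  proof (subst sum.swap, intro sum.cong refl, subst vs.scale_sum_left[symmetric])
    fix l assume l: "l \<in> {1..N}"
    have "(\<Sum>m<N. A_coeff m j * B_coeff m l) = (\<Sum>m<l. A_coeff m j * B_coeff m l)"
      using l by (intro sum.mono_neutral_right) (auto simp: B_coeff_def)
    then show "scale (\<Sum>m<N. A_coeff m j * B_coeff m l) (V_F_vev (n - 2 * int j + 2 * int l) (deriv_\<pi> l f)) =
      scale (\<Sum>m<l. A_coeff m j * B_coeff m l) (V_F_vev (n - 2 * int j + 2 * int l) (deriv_\<pi> l f))"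
      by simp
  qed
  also have "V_F_vev n (deriv_\<pi> j f) = (\<Sum>l=1..N. scale (if j = l then 1 else 0)
      (V_F_vev (n - 2 * int j + 2 * int l) (deriv_\<pi> l f)))"
  proof (cases "j \<le> N")
    case True
    have "(\<Sum>l=1..N. scale (if j = l then 1 else 0) (V_F_vev (n - 2 * int j + 2 * int l) (deriv_\<pi> l f)))
      = (\<Sum>l=1..N. if j = l then V_F_vev (n - 2 * int j + 2 * int l) (deriv_\<pi> l f) else 0)"
      by (intro sum.cong) auto
    then show ?thesis using True assms by simp
  next
    case False
    then have 0: "deriv_\<pi> j f = 0" using assms by (simp add: index_le_def)
    have "delta_series 0 = (\<lambda>n. 0)" by (simp add: delta_series_def fun_eq_iff)
    then have "V_F_vev n 0 = 0" using U[of 0 n] shift_linear_0[OF shift_linear_vev_trunc] by simp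
    then show ?thesis using False 0 by (auto intro!: sum.neutral[symmetric])
  qed
  finally show ?thesis
    by (simp add: ferm_coeff_def vs.scale_left_distrib sum.distrib)
qed

text \<open>Every term with at least one pair \<open>A\<^sub>m, B\<^sub>m\<close> has a \<open>\<pi>\<close> on the left and does not contribute.\<close>

lemma V_F_vev_vacuum:
  "Poly_Mapping.lookup (V_F_vev n f) {||} = (if n = 0 then Poly_Mapping.lookup f {||} else 0)"
proof -
  obtain N where N: "index_le N f" using index_le_ex by blast
  show ?thesis
    using V_F_vev_eq_trunc[OF N, of n "nat (n + 2 * int N * int N)"]
    by (simp add: vev_trunc_vacuum delta_series_def)
qed

section \<open>The exchange coefficients\<close>

lemma q_par_eq: "q_par = Fract [:[:[:0, 0, 1:]:]:] 1"
  by (simp add: q_par_def q_half_def power2_eq_square)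

lemma t_par_eq: "t_par = Fract [:[:0, 0, 1:]:] 1"
  by (simp add: t_par_def t_half_def power2_eq_square)

lemma q_par_nonzero [simp]: "q_par \<noteq> 0"
  by (simp add: q_par_eq Zero_fract_def eq_fract)

lemma t_par_nonzero [simp]: "t_par \<noteq> 0"
  by (simp add: t_par_eq Zero_fract_def eq_fract)

lemma q_par_neq_t_par: "q_par \<noteq> t_par"
  by (simp add: t_par_eq q_par_eq eq_fract)

text \<open>The partial fraction decomposition is
  \<open>(1 - x)(1 - qtx) / ((1 - qx)(1 - tx)) = 1 + \<alpha>/(1 - qx) - \<alpha>/(1 - tx)\<close>, where \<open>\<alpha>\<close> is the following
  constant; the coefficients of this series are the exchange coefficients \<open>g\<^sub>i\<close>.\<close>

definition residue_const :: coef where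
  "residue_const = (q_par - 1) * (1 - t_par) / (q_par - t_par)"

definition exchange_coeff :: "nat \<Rightarrow> coef" where
  "exchange_coeff i = (if i = 0 then 1 else residue_const * (q_par ^ i - t_par ^ i))"

lemma geometric_powi:
  fixes x y :: "'a :: field"
  assumes "y \<noteq> 0"
  shows "(y - x) * (\<Sum>m<M. x ^ m * y powi (l - 1 - int m)) = y powi l - x ^ M * y powi (l - int M)"
proof (induction M)
  case (Suc M)
  have "y powi (l - int M) = y * y powi (l - 1 - int M)"
    using power_int_add_1'[of y "l - 1 - int M"] assms by simp
  with Suc show ?case by (simp add: algebra_simps)
qed simp

text \<open>Both \<open>g\<^bsub>l-j\<^esub>\<close> and the geometric sum in \<open>n\<^bsub>jl\<^esub>\<close> change their form at \<open>l = j\<close>, but the difference does not notice: as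
  a function of \<open>l\<close> it is a combination of \<open>q\<^sup>l\<close> and \<open>t\<^sup>l\<close> throughout. The coefficient of \<open>t\<^sup>l\<close> is proportional to
  \<open>t\<^bsup>-j\<^esup>\<close> for all \<open>j\<close>, including \<open>j = 0\<close>, and this is what lets \<open>V\<^sub>B\<^bsup>(-)\<^esup>\<close> cancel. The coefficient of \<open>q\<^sup>l\<close> has an
  exceptional value at \<open>j = 0\<close>, but that term is killed by antisymmetry.\<close>

lemma exchange_minus_ferm_coeff:
  assumes "l \<ge> 1"
  shows "(if j \<le> l then exchange_coeff (l - j) else 0) - ferm_coeff j l =
    (if j = 0 then residue_const else residue_const * inverse t_par ^ j * t_par / q_par) * q_par ^ l
      - residue_const * inverse t_par ^ j * t_par ^ l"
proof (cases "j = 0")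
  case True
  then show ?thesis using assms
    by (simp add: ferm_coeff_def A_coeff_def exchange_coeff_def algebra_simps)
next
  case False
  define M where "M = min j l - 1"
  let ?q = q_par and ?t = t_par and ?c = "residue_const"
  have summand: "A_coeff m j * B_coeff m l =
      (1 - inverse ?t) * (?q - 1) * ?t^2 * inverse ?t ^ j * (?t ^ m * ?q powi (int l - 1 - 1 - int m))"
    if "m < M" for m
  proof -
    have "?t powi (2 - int j + int m) = ?t^2 * inverse ?t ^ j * ?t ^ m"
      by (simp add: power_int_add power_int_diff power_inverse field_simps)
    then show ?thesis using that by (auto simp: A_coeff_def B_coeff_def M_def)
  qed
  have "(\<Sum>m<l. A_coeff m j * B_coeff m l) = (\<Sum>m<M. A_coeff m j * B_coeff m l)"
    by (rule sum.mono_neutral_right) (auto simp: M_def A_coeff_def B_coeff_def)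
  also have "\<dots> = (1 - inverse ?t) * (?q - 1) * ?t^2 * inverse ?t ^ j *
      (\<Sum>m<M. ?t ^ m * ?q powi (int l - 1 - 1 - int m))"
    unfolding sum_distrib_left by (intro sum.cong refl) (simp add: summand)
  also have "(\<Sum>m<M. ?t ^ m * ?q powi (int l - 1 - 1 - int m)) =
      (?q powi (int l - 1) - ?t ^ M * ?q powi (int l - 1 - int M)) / (?q - ?t)"
    using geometric_powi[of ?q ?t "int l - 1" M] q_par_neq_t_par by (simp add: field_simps)
  also have "(1 - inverse ?t) * (?q - 1) * ?t^2 * inverse ?t ^ j *
      ((?q powi (int l - 1) - ?t ^ M * ?q powi (int l - 1 - int M)) / (?q - ?t)) =
      - ?c * ?t * inverse ?t ^ j * (?q powi (int l - 1) - ?t ^ M * ?q powi (int l - 1 - int M))"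
    using q_par_neq_t_par by (simp add: residue_const_def field_simps power2_eq_square)
  finally have sum: "ferm_coeff j l = (if j = l then 1 else 0)
      - ?c * ?t * inverse ?t ^ j * (?q powi (int l - 1) - ?t ^ M * ?q powi (int l - 1 - int M))"
    by (simp add: ferm_coeff_def)
  have q1: "?q powi (int l - 1) = ?q ^ l / ?q"
    by (simp add: power_int_diff)
  show ?thesis
  proof (cases "j \<le> l")
    case True
    then have M: "M = j - 1" by (simp add: M_def)
    have q2: "?q powi (int l - 1 - int M) = ?q ^ (l - j)"
      using True False by (simp add: M of_nat_diff flip: power_int_of_nat)
    have t2: "?t * inverse ?t ^ j * ?t ^ M = 1"
      using False by (cases j) (simp_all add: M field_simps)
    have t3: "inverse ?t ^ j * ?t ^ l = ?t ^ (l - j)"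
      using True by (simp add: power_diff power_inverse field_simps)
    have e: "exchange_coeff (l - j) - (if j = l then 1 else 0) = ?c * (?q ^ (l - j) - ?t ^ (l - j))"
      using True by (auto simp: exchange_coeff_def)
    have "(if j \<le> l then exchange_coeff (l - j) else 0) - ferm_coeff j l =
        ?c * (?q ^ (l - j) - ?t ^ (l - j)) + ?c * ?t * inverse ?t ^ j * (?q ^ l / ?q)
          - ?c * (?t * inverse ?t ^ j * ?t ^ M) * ?q ^ (l - j)"
      using True e unfolding sum q1 q2 by (simp add: algebra_simps)
    also have "\<dots> = ?c * inverse ?t ^ j * ?t / ?q * ?q ^ l - ?c * (inverse ?t ^ j * ?t ^ l)"
      unfolding t2 t3 by (simp add: algebra_simps)
    finally show ?thesis using False by (simp add: algebra_simps)
  next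
    case gt: False
    then have M: "M = l - 1" by (simp add: M_def)
    have q2: "?q powi (int l - 1 - int M) = 1"
      using assms by (simp add: M of_nat_diff)
    have t2: "?t * ?t ^ M = ?t ^ l"
      using assms by (cases l) (simp_all add: M)
    have "(if j \<le> l then exchange_coeff (l - j) else 0) - ferm_coeff j l =
        ?c * inverse ?t ^ j * (?t * (?q ^ l / ?q) - ?t * ?t ^ M)"
      using gt unfolding sum q1 q2 by (simp add: algebra_simps)
    then show ?thesis using False unfolding t2 by (simp add: algebra_simps)
  qed
qed

text \<open>The logarithmic derivative of \<open>G\<close>. It is the form in which \<open>G\<close> arises when \<open>V\<^sub>B\<^bsup>(+)\<^esup>\<close> is moved across the
  \<open>c\<^sub>j\<close>.\<close>

lemma exchange_coeff_euler:
  includes fps_syntax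
  shows "of_nat i * exchange_coeff i =
    (\<Sum>r=1..i. (1 - t_par ^ r) * (q_par ^ r - 1) * exchange_coeff (i - r))"
proof -
  let ?q = q_par and ?t = t_par
  let ?L = "\<lambda>a :: coef. 1 - fps_const a * fps_X"
  let ?geo = "\<lambda>a :: coef. Abs_fps (\<lambda>n. a ^ n)"
  \<comment> \<open>Here \<open>P\<close> and \<open>Q\<close> are the denominator and the numerator of \<open>G\<close>, and \<open>H\<close> is the series \<open>\<Sum>\<^sub>r (1 - t\<^sup>r)(q\<^sup>r - 1) x\<^sup>r\<close>.\<close>
  define F where "F = Abs_fps exchange_coeff"
  define H where "H = ?geo ?q - ?geo 1 - ?geo (?t * ?q) + ?geo ?t"
  define P where "P = ?L ?q * ?L ?t"
  define Q where "Q = ?L 1 * ?L (?t * ?q)"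
  have geo: "?L a * ?geo a = 1" for a
  proof (rule fps_ext)
    fix n show "(?L a * ?geo a) $ n = 1 $ n"
      by (cases n) (simp_all add: algebra_simps mult.assoc[of "fps_const a"])
  qed
  have G1: "residue_const * (?q - ?t) = (?q - 1) * (1 - ?t)"
    using q_par_neq_t_par by (simp add: residue_const_def)
  have PF: "P * F = Q"
  proof -
    have "P = 1 - fps_const (?q + ?t) * fps_X + fps_const (?q * ?t) * fps_X * fps_X"
      by (simp add: P_def algebra_simps flip: fps_const_add fps_const_mult)
    moreover have "Q = 1 - fps_const (1 + ?q * ?t) * fps_X + fps_const (?q * ?t) * fps_X * fps_X"
      by (simp add: Q_def algebra_simps flip: fps_const_add fps_const_mult)
    moreover have "(1 - fps_const (?q + ?t) * fps_X + fps_const (?q * ?t) * fps_X * fps_X) * F =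
        1 - fps_const (1 + ?q * ?t) * fps_X + fps_const (?q * ?t) * fps_X * fps_X" (is "?l = ?r")
    proof (rule fps_ext)
      fix n
      have l: "?l = F - fps_X * (fps_const (?q + ?t) * F) + fps_X * (fps_X * (fps_const (?q * ?t) * F))"
        by (simp add: algebra_simps)
      have r: "?r = 1 - fps_X * fps_const (1 + ?q * ?t) + fps_X * (fps_X * fps_const (?q * ?t))"
        by (simp add: algebra_simps)
      consider "n = 0" | "n = 1" | "n = 2" | k where "n = Suc (Suc (Suc k))"
        by (metis One_nat_def Suc_1 not0_implies_Suc)
      then show "?l $ n = ?r $ n"
      proof cases
        case 2
        then show ?thesis unfolding l r
          using G1 by (simp add: F_def exchange_coeff_def algebra_simps)
      next
        case 3
        have "residue_const * (?q\<^sup>2 - ?t\<^sup>2) = (residue_const * (?q - ?t)) * (?q + ?t)"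
          by (simp add: power2_eq_square algebra_simps)
        moreover note G1
        ultimately show ?thesis unfolding l r using 3
          by (simp add: F_def exchange_coeff_def numeral_2_eq_2 algebra_simps)
      next
        case 4
        then show ?thesis unfolding l r
          by (simp add: F_def exchange_coeff_def algebra_simps)
      qed (simp add: l r F_def exchange_coeff_def)
    qed
    ultimately show ?thesis by simp
  qed
  let ?D = "\<lambda>G :: coef fps. fps_X * fps_deriv G"
  have DL: "?D (?L a) = ?L a - 1" for a
    by (simp add: algebra_simps flip: fps_const_neg)
  have Dmult: "?D (G * G') = ?D G * G' + G * ?D G'" for G G'
    by (simp add: algebra_simps)
  have DP: "?D P = 2 * P - ?L ?q - ?L ?t"
    unfolding P_def Dmult DL by (simp add: algebra_simps)
  have DQ: "?D Q = 2 * Q - ?L 1 - ?L (?t * ?q)"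
    unfolding Q_def Dmult DL by (simp add: algebra_simps)
  have DF: "?D P * F + P * ?D F = ?D Q"
    using Dmult[of P F] PF by simp
  have rearrange: "x * y * (z * w) * (a - b - c + d) =
      z * w * y * (x * a) - x * y * w * (z * b) - x * y * z * (w * c) + z * w * x * (y * d)"
    for x y z w a b c d :: "coef fps"
    by (simp add: algebra_simps)
  have PQH: "P * Q * H = Q * (?L ?q + ?L ?t) - P * (?L 1 + ?L (?t * ?q))"
  proof -
    have "P * Q * H = Q * ?L ?t * (?L ?q * ?geo ?q) - P * ?L (?t * ?q) * (?L 1 * ?geo 1)
        - P * ?L 1 * (?L (?t * ?q) * ?geo (?t * ?q)) + Q * ?L ?q * (?L ?t * ?geo ?t)"
      unfolding H_def P_def Q_def by (rule rearrange)
    then show ?thesis unfolding geo by (simp add: algebra_simps)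
  qed
  have "P * P * (?D F - H * F) = P * (P * ?D F) - P * H * (P * F)"
    by (simp add: algebra_simps)
  also have "P * ?D F = ?D Q - ?D P * F"
    using DF by (simp add: algebra_simps)
  also have "P * (?D Q - ?D P * F) - P * H * (P * F) = P * ?D Q - ?D P * (P * F) - P * (P * F) * H"
    by (simp add: algebra_simps)
  also have "\<dots> = 0"
    unfolding PF PQH DP DQ by (simp add: algebra_simps)
  finally have "P * P * (?D F - H * F) = 0" .
  moreover have "P $ 0 = 1" by (simp add: P_def)
  then have "P \<noteq> 0" by auto
  ultimately have DFH: "?D F = H * F" by simp
  have "of_nat i * exchange_coeff i = ?D F $ i"
    by (cases i) (simp_all add: F_def)
  also have "\<dots> = (\<Sum>r=0..i. H $ r * exchange_coeff (i - r))"
    unfolding DFH by (simp add: fps_mult_nth F_def)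
  also have "\<dots> = (\<Sum>r=1..i. H $ r * exchange_coeff (i - r))"
    by (rule sum.mono_neutral_right) (auto simp: H_def not_less_eq_eq)
  also have "\<dots> = (\<Sum>r=1..i. (1 - t_par ^ r) * (q_par ^ r - 1) * exchange_coeff (i - r))"
    by (intro sum.cong refl) (simp add: H_def algebra_simps power_mult_distrib)
  finally show ?thesis .
qed

section \<open>Uniqueness and vanishing for the fermionic expectation value\<close>

lemma V_F_vev_0: "V_F_vev n 0 = 0"
proof (rule superring_eqI)
  fix j :: nat assume "j \<ge> 1"
  then show "deriv_\<pi> j (V_F_vev n 0) = deriv_\<pi> j 0"
    by (simp add: deriv_V_F_vev[of 0] lin_0[OF lin_deriv_\<pi>])
qed (simp add: V_F_vev_vacuum)

text \<open>By the uniqueness principle: \<open>deriv_V_F_vev\<close> reduces the \<open>\<pi>\<close>-degree of the argument, and the components on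
  the monomial \<open>1\<close> are known.\<close>

lemma V_F_vev_combination:
  assumes "deg_less d f" "deg_less d g"
  shows "V_F_vev n (f + scale c g) = V_F_vev n f + scale c (V_F_vev n g)"
  using assms
proof (induction d arbitrary: n f g)
  case (Suc d)
  obtain N1 N2 where "index_le N1 f" "index_le N2 g" using index_le_ex by blast
  then obtain N where N: "index_le N f" "index_le N g"
    using index_le_mono max.cobounded1 max.cobounded2 by blast
  show ?case
  proof (rule superring_eqI)
    fix j :: nat assume j: "j \<ge> 1"
    have *: "V_F_vev m (deriv_\<pi> l (f + scale c g)) = V_F_vev m (deriv_\<pi> l f) + scale c (V_F_vev m (deriv_\<pi> l g))"
      if "l \<ge> 1" for l m
      using that Suc by (simp add: lin_add[OF lin_deriv_\<pi>] lin_scale[OF lin_deriv_\<pi>] deg_less_deriv_\<pi>)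
    have "deriv_\<pi> j (V_F_vev n (f + scale c g)) =
        (\<Sum>l=1..N. scale (ferm_coeff j l) (V_F_vev (n - 2 * int j + 2 * int l) (deriv_\<pi> l f)) +
          scale c (scale (ferm_coeff j l) (V_F_vev (n - 2 * int j + 2 * int l) (deriv_\<pi> l g))))"
      unfolding deriv_V_F_vev[OF index_le_add[OF N(1) index_le_scale[OF N(2)]] j]
      by (intro sum.cong refl) (simp add: * vs.scale_right_distrib vs.scale_left_commute)
    then show "deriv_\<pi> j (V_F_vev n (f + scale c g)) =
        deriv_\<pi> j (V_F_vev n f + scale c (V_F_vev n g))"
      using j by (simp add: lin_add[OF lin_deriv_\<pi>] lin_scale[OF lin_deriv_\<pi>] deriv_V_F_vev[OF N(1)]
          deriv_V_F_vev[OF N(2)] sum.distrib vs.scale_sum_right)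
  qed (simp add: V_F_vev_vacuum lookup_add lookup_scale)
qed (simp add: V_F_vev_0)

lemma lin_V_F_vev: "lin (V_F_vev n)"
proof -
  have *: "V_F_vev n (f + scale c g) = V_F_vev n f + scale c (V_F_vev n g)" for f g c
  proof -
    obtain d1 d2 where "deg_less d1 f" "deg_less d2 g" using deg_less_ex by blast
    then have "deg_less (max d1 d2) f" "deg_less (max d1 d2) g"
      by (auto elim: deg_less_mono)
    then show ?thesis by (rule V_F_vev_combination)
  qed
  show ?thesis
    using *[of _ 1] *[of 0] by (intro linI) (simp_all add: V_F_vev_0)
qed

definition vacuum_part :: operator where
  "vacuum_part f = Poly_Mapping.single {||} (Poly_Mapping.lookup f {||})"

lemma lin_vacuum_part: "lin vacuum_part"
  by (rule linI; rule poly_mapping_eqI)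
     (auto simp: vacuum_part_def lookup_single lookup_add lookup_scale when_def)

lemma vacuum_part_V_F_vev: "vacuum_part (V_F_vev n f) = (if n = 0 then vacuum_part f else 0)"
  by (simp add: vacuum_part_def V_F_vev_vacuum)

lemma lookup_vacuum_part: "Poly_Mapping.lookup (vacuum_part f) {||} = Poly_Mapping.lookup f {||}"
  by (simp add: vacuum_part_def)

text \<open>Again by uniqueness. This covers both multiplication by bosonic elements and \<open>V\<^sub>B\<^bsup>(+)\<^esup>\<close>.\<close>

lemma V_F_vev_commute:
  assumes D: "lin D" and comm: "\<And>j f. j \<ge> 1 \<Longrightarrow> deriv_\<pi> j (D f) = D (deriv_\<pi> j f)"
    and vac: "\<And>f. vacuum_part (D f) = D (vacuum_part f)"
  shows "D (V_F_vev n f) = V_F_vev n (D f)"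
proof -
  obtain d where "deg_less d f" using deg_less_ex by blast
  then show ?thesis
  proof (induction d arbitrary: n f)
    case 0
    then show ?case by (simp add: V_F_vev_0 lin_0[OF D])
  next
    case (Suc d)
    obtain N where N: "index_le N f" using index_le_ex by blast
    have N': "index_le N (D f)"
      using N unfolding index_le_def by (simp add: comm lin_0[OF D])
    show ?case
    proof (rule superring_eqI)
      fix j :: nat assume j: "j \<ge> 1"
      show "deriv_\<pi> j (D (V_F_vev n f)) = deriv_\<pi> j (V_F_vev n (D f))"
        unfolding comm[OF j] deriv_V_F_vev[OF N j] deriv_V_F_vev[OF N' j] lin_sum[OF D]
        by (intro sum.cong refl)
           (simp add: lin_scale[OF D] comm Suc.IH deg_less_deriv_\<pi>[OF Suc.prems])
    next
      have "vacuum_part (D (V_F_vev n f)) = vacuum_part (V_F_vev n (D f))"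
        by (simp add: vac vacuum_part_V_F_vev lin_0[OF D])
      then show "Poly_Mapping.lookup (D (V_F_vev n f)) {||} =
          Poly_Mapping.lookup (V_F_vev n (D f)) {||}"
        by (metis lookup_vacuum_part)
    qed
  qed
qed

lemma V_F_vev_zero_below:
  assumes "index_le N f" "deg_less d f" "n < - 2 * int N * int d"
  shows "V_F_vev n f = 0"
  using assms
proof (induction d arbitrary: n f)
  case 0
  then show ?case by (simp add: V_F_vev_0)
next
  case (Suc d)
  show ?case
  proof (rule superring_eqI)
    fix j :: nat assume j: "j \<ge> 1"
    have "V_F_vev (n - 2 * int j + 2 * int l) (deriv_\<pi> l f) = 0" if "l \<in> {1..N}" for l
    proof (rule Suc.IH)
      show "n - 2 * int j + 2 * int l < - 2 * int N * int d"
        using Suc.prems(3) that j by (auto simp: algebra_simps)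
    qed (use Suc.prems that in \<open>auto intro: index_le_deriv_\<pi> deg_less_deriv_\<pi>\<close>)
    then show "deriv_\<pi> j (V_F_vev n f) = deriv_\<pi> j 0"
      by (simp add: deriv_V_F_vev[OF Suc.prems(1) j] lin_0[OF lin_deriv_\<pi>] j[simplified])
  next
    have "0 \<le> 2 * int N * int (Suc d)" by simp
    then have "n < 0" using Suc.prems(3) by linarith
    then show "Poly_Mapping.lookup (V_F_vev n f) {||} = Poly_Mapping.lookup 0 {||}"
      by (simp add: V_F_vev_vacuum)
  qed
qed

lemma antisymmetric_sum_zero:
  assumes "\<And>k l. k \<in> S \<Longrightarrow> l \<in> S \<Longrightarrow> (h k l :: superring) = - h l k"
  shows "(\<Sum>k\<in>S. \<Sum>l\<in>S. h k l) = 0"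
proof (rule eq_neg_self_imp_0)
  have "(\<Sum>k\<in>S. \<Sum>l\<in>S. h k l) = (\<Sum>l\<in>S. \<Sum>k\<in>S. h k l)" by (rule sum.swap)
  also have "\<dots> = (\<Sum>l\<in>S. \<Sum>k\<in>S. - h l k)" by (intro sum.cong refl assms)
  also have "\<dots> = - (\<Sum>k\<in>S. \<Sum>l\<in>S. h k l)" by (simp add: sum_negf)
  finally show "(\<Sum>k\<in>S. \<Sum>l\<in>S. h k l) = - (\<Sum>k\<in>S. \<Sum>l\<in>S. h k l)" .
qed

text \<open>The coefficient of \<open>w\<^sup>n\<close> in \<open>V(w) (\<Sum>\<^sub>k q\<^sup>k w\<^bsup>-2k\<^esup> d\<^sub>k) (\<Sum>\<^sub>l t\<^sup>l w\<^bsup>-2l\<^esup> d\<^sub>l)\<close>, on elements in which only the first \<open>N\<close>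
  of the \<open>\<pi>\<^sub>k\<close> occur.\<close>

definition pair_op :: "nat \<Rightarrow> op_series \<Rightarrow> int \<Rightarrow> operator" where
  "pair_op N V n f = (\<Sum>k=1..N. \<Sum>l=1..N. scale (q_par ^ k * t_par ^ l)
     (V (n + 2 * int k + 2 * int l) (deriv_\<pi> k (deriv_\<pi> l f))))"

lemma lin_pair_op:
  assumes "\<And>n. lin (V n)"
  shows "lin (pair_op N V n)"
  unfolding pair_op_def[abs_def]
proof (intro lin_sumI lin_scaleI)
  fix k l assume "k \<in> {1..N}" "l \<in> {1..N}"
  then show "lin (\<lambda>f. V (n + 2 * int k + 2 * int l) (deriv_\<pi> k (deriv_\<pi> l f)))"
    using lin_comp[OF assms lin_comp[OF lin_deriv_\<pi>[of k] lin_deriv_\<pi>[of l]]] by simp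
qed

text \<open>Let \<open>X\<close> denote the series of operators. In \<open>d\<^sub>j X\<close> the coefficients \<open>n\<^bsub>jm\<^esub>\<close> may be replaced by \<open>g\<^bsub>m-j\<^esub>\<close>, because their
  \<open>q\<^sup>m\<close> part is antisymmetrised against \<open>\<Sum>\<^sub>k q\<^sup>k d\<^sub>k\<close> and their \<open>t\<^sup>m\<close> part against \<open>\<Sum>\<^sub>l t\<^sup>l d\<^sub>l\<close>. As \<open>g\<close>
  is supported on \<open>m \<ge> j\<close>, the exponent \<open>n\<close> can only grow while the \<open>\<pi>\<close>-degree drops, so the bound on \<open>n\<close>
  survives the induction.\<close>

lemma pair_op_V_F_vev_zero:
  assumes "index_le N f" "n \<ge> - 2"
  shows "pair_op N V_F_vev n f = 0"
proof -
  obtain d where "deg_less d f" using deg_less_ex by blast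
  then show ?thesis using assms
  proof (induction d arbitrary: n f)
    case 0
    then show ?case using lin_0[OF lin_pair_op[OF lin_V_F_vev]] by simp
  next
    case (Suc d)
    note N = Suc.prems(2)
    let ?d = deriv_\<pi>
    show ?case
    proof (rule superring_eqI)
      fix j :: nat assume j: "j \<ge> 1"
      define \<kappa> where "\<kappa> = (if j = 0 then residue_const else residue_const * inverse t_par ^ j * t_par / q_par)"
      define \<beta> where "\<beta> = residue_const * inverse t_par ^ j"
      define w where "w k l m = V_F_vev (n - 2 * int j + 2 * int k + 2 * int l + 2 * int m)
        (?d m (?d k (?d l f)))" for k l m
      let ?S = "{1..N}"
      have ferm: "ferm_coeff j m = (if j \<le> m then exchange_coeff (m - j) else 0)
          - \<kappa> * q_par ^ m + \<beta> * t_par ^ m" if "m \<in> ?S" for m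
        using exchange_minus_ferm_coeff[of m j] that unfolding \<kappa>_def \<beta>_def by (simp add: algebra_simps)
      have "?d j (pair_op N V_F_vev n f) = (\<Sum>k\<in>?S. \<Sum>l\<in>?S. \<Sum>m\<in>?S.
          scale (q_par ^ k * t_par ^ l * ferm_coeff j m) (w k l m))"
        unfolding pair_op_def lin_sum[OF lin_deriv_\<pi>[OF j]]
      proof (intro sum.cong refl)
        fix k l assume kl: "k \<in> ?S" "l \<in> ?S"
        have "?d j (V_F_vev (n + 2 * int k + 2 * int l) (?d k (?d l f))) =
            (\<Sum>m\<in>?S. scale (ferm_coeff j m) (w k l m))"
        proof -
          have "index_le N (?d k (?d l f))"
            using kl N by (simp add: index_le_deriv_\<pi>)
          moreover have "n + 2 * int k + 2 * int l - 2 * int j = n - 2 * int j + 2 * int k + 2 * int l"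
            by simp
          ultimately show ?thesis
            by (simp only: deriv_V_F_vev[OF _ j] w_def)
        qed
        then show "?d j (scale (q_par ^ k * t_par ^ l)
            (V_F_vev (n + 2 * int k + 2 * int l) (?d k (?d l f)))) =
            (\<Sum>m\<in>?S. scale (q_par ^ k * t_par ^ l * ferm_coeff j m) (w k l m))"
          using j by (simp add: lin_scale[OF lin_deriv_\<pi>] vs.scale_sum_right)
      qed
      also have "\<dots> = (\<Sum>k\<in>?S. \<Sum>l\<in>?S. \<Sum>m\<in>?S.
          scale (q_par ^ k * t_par ^ l * (if j \<le> m then exchange_coeff (m - j) else 0)) (w k l m)
          - scale (\<kappa> * q_par ^ k * t_par ^ l * q_par ^ m) (w k l m)
          + scale (\<beta> * q_par ^ k * t_par ^ l * t_par ^ m) (w k l m))"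
      proof (intro sum.cong refl)
        fix k l m assume m: "m \<in> ?S"
        have e: "q_par ^ k * t_par ^ l * ferm_coeff j m =
            q_par ^ k * t_par ^ l * (if j \<le> m then exchange_coeff (m - j) else 0)
            - \<kappa> * q_par ^ k * t_par ^ l * q_par ^ m + \<beta> * q_par ^ k * t_par ^ l * t_par ^ m"
          unfolding ferm[OF m] by (simp only: ring_distribs mult_ac)
        show "scale (q_par ^ k * t_par ^ l * ferm_coeff j m) (w k l m) =
            scale (q_par ^ k * t_par ^ l * (if j \<le> m then exchange_coeff (m - j) else 0)) (w k l m)
            - scale (\<kappa> * q_par ^ k * t_par ^ l * q_par ^ m) (w k l m)
            + scale (\<beta> * q_par ^ k * t_par ^ l * t_par ^ m) (w k l m)"
          by (simp only: e vs.scale_left_distrib vs.scale_left_diff_distrib)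
      qed
      also have "\<dots> = (\<Sum>k\<in>?S. \<Sum>l\<in>?S. \<Sum>m\<in>?S.
          scale (q_par ^ k * t_par ^ l * (if j \<le> m then exchange_coeff (m - j) else 0)) (w k l m))
          - (\<Sum>k\<in>?S. \<Sum>l\<in>?S. \<Sum>m\<in>?S. scale (\<kappa> * q_par ^ k * t_par ^ l * q_par ^ m) (w k l m))
          + (\<Sum>k\<in>?S. \<Sum>l\<in>?S. \<Sum>m\<in>?S. scale (\<beta> * q_par ^ k * t_par ^ l * t_par ^ m) (w k l m))"
        by (simp add: sum.distrib sum_subtractf)
      also have "(\<Sum>k\<in>?S. \<Sum>l\<in>?S. \<Sum>m\<in>?S. scale (\<kappa> * q_par ^ k * t_par ^ l * q_par ^ m) (w k l m))
          = (\<Sum>l\<in>?S. \<Sum>k\<in>?S. \<Sum>m\<in>?S. scale (\<kappa> * q_par ^ k * t_par ^ l * q_par ^ m) (w k l m))"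
        by (rule sum.swap)
      also have "\<dots> = 0"
      proof (rule sum.neutral, rule ballI, rule antisymmetric_sum_zero)
        fix l k m assume "l \<in> ?S" "k \<in> ?S" "m \<in> ?S"
        then have "w k l m = - w m l k"
          unfolding w_def using deriv_\<pi>_swap[of m k "?d l f"]
          by (simp add: lin_neg[OF lin_V_F_vev] add_ac)
        then show "scale (\<kappa> * q_par ^ k * t_par ^ l * q_par ^ m) (w k l m) =
            - scale (\<kappa> * q_par ^ m * t_par ^ l * q_par ^ k) (w m l k)"
          by (simp add: mult_ac)
      qed
      also have "(\<Sum>k\<in>?S. \<Sum>l\<in>?S. \<Sum>m\<in>?S. scale (\<beta> * q_par ^ k * t_par ^ l * t_par ^ m) (w k l m)) = 0"
      proof (rule sum.neutral, rule ballI, rule antisymmetric_sum_zero)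
        fix k l m assume "k \<in> ?S" "l \<in> ?S" "m \<in> ?S"
        then have "?d m (?d k (?d l f)) = - ?d l (?d k (?d m f))"
          using deriv_\<pi>_swap[of m k "?d l f"] deriv_\<pi>_swap[of m l f] deriv_\<pi>_swap[of k l "?d m f"]
          by (simp add: lin_neg[OF lin_deriv_\<pi>])
        then have "w k l m = - w k m l"
          unfolding w_def by (simp add: lin_neg[OF lin_V_F_vev] add_ac)
        then show "scale (\<beta> * q_par ^ k * t_par ^ l * t_par ^ m) (w k l m) =
            - scale (\<beta> * q_par ^ k * t_par ^ m * t_par ^ l) (w k m l)"
          by (simp add: mult_ac)
      qed
      also have "(\<Sum>k\<in>?S. \<Sum>l\<in>?S. \<Sum>m\<in>?S.
          scale (q_par ^ k * t_par ^ l * (if j \<le> m then exchange_coeff (m - j) else 0)) (w k l m)) =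
          (\<Sum>k\<in>?S. \<Sum>m\<in>?S. \<Sum>l\<in>?S.
          scale (q_par ^ k * t_par ^ l * (if j \<le> m then exchange_coeff (m - j) else 0)) (w k l m))"
        by (intro sum.cong refl sum.swap)
      also have "\<dots> = (\<Sum>m\<in>?S. \<Sum>k\<in>?S. \<Sum>l\<in>?S.
          scale (q_par ^ k * t_par ^ l * (if j \<le> m then exchange_coeff (m - j) else 0)) (w k l m))"
        by (rule sum.swap)
      also have "\<dots> = (\<Sum>m\<in>?S. scale (if j \<le> m then exchange_coeff (m - j) else 0)
          (pair_op N V_F_vev (n - 2 * int j + 2 * int m) (?d m f)))"
      proof (intro sum.cong refl)
        fix m assume m: "m \<in> ?S"
        have "?d m (?d k (?d l f)) = ?d k (?d l (?d m f))" if "k \<in> ?S" "l \<in> ?S" for k l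
          using that m deriv_\<pi>_swap[of m k "?d l f"] deriv_\<pi>_swap[of m l f]
          by (simp add: lin_neg[OF lin_deriv_\<pi>])
        then show "(\<Sum>k\<in>?S. \<Sum>l\<in>?S. scale (q_par ^ k * t_par ^ l *
              (if j \<le> m then exchange_coeff (m - j) else 0)) (w k l m)) =
            scale (if j \<le> m then exchange_coeff (m - j) else 0)
              (pair_op N V_F_vev (n - 2 * int j + 2 * int m) (?d m f))"
          unfolding pair_op_def vs.scale_sum_right
          by (intro sum.cong refl) (simp add: w_def add_ac mult_ac)
      qed
      also have "\<dots> = 0"
      proof (intro sum.neutral ballI)
        fix m assume m: "m \<in> ?S"
        show "scale (if j \<le> m then exchange_coeff (m - j) else 0)
            (pair_op N V_F_vev (n - 2 * int j + 2 * int m) (?d m f)) = 0"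
          using m Suc.prems
          by (auto simp: Suc.IH index_le_deriv_\<pi> deg_less_deriv_\<pi>)
      qed
      finally show "?d j (pair_op N V_F_vev n f) = ?d j 0"
        using j by (simp add: lin_0[OF lin_deriv_\<pi>])
    next
      show "Poly_Mapping.lookup (pair_op N V_F_vev n f) {||} = Poly_Mapping.lookup 0 {||}"
        unfolding pair_op_def using Suc.prems(3)
        by (auto simp: lookup_sum lookup_scale V_F_vev_vacuum intro!: sum.neutral)
    qed
  qed
qed

section \<open>Exponentials of commuting families\<close>

lemma sum_triangle_swap:
  "(\<Sum>k=1..i. \<Sum>l=1..i - k. h k l) = (\<Sum>l=1..i. \<Sum>k=1..i - (l::nat). (h k l :: 'a :: comm_monoid_add))"
  unfolding sum.Sigma[OF finite_atLeastAtMost ballI[OF finite_atLeastAtMost]]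
  by (rule sum.reindex_bij_witness[where i = "\<lambda>(l, k). (k, l)" and j = "\<lambda>(k, l). (l, k)"]) auto

lemma sum_triangle_swap':
  "(\<Sum>r=1..j. \<Sum>s\<le>j - r. h r s) = (\<Sum>s\<le>j. \<Sum>r=1..j - (s::nat). (h r s :: 'a :: comm_monoid_add))"
  unfolding sum.Sigma[OF finite_atLeastAtMost ballI[OF finite_atMost]]
    sum.Sigma[OF finite_atMost ballI[OF finite_atLeastAtMost]]
  by (rule sum.reindex_bij_witness[where i = "\<lambda>(l, k). (k, l)" and j = "\<lambda>(k, l). (l, k)"]) auto

lemma sum_triangle_diagonal:
  "(\<Sum>r=1..j. \<Sum>s\<le>j - r. h r s) = (\<Sum>u\<le>j. \<Sum>r=1..(u::nat). (h r (u - r) :: 'a :: comm_monoid_add))"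
  unfolding sum.Sigma[OF finite_atLeastAtMost ballI[OF finite_atMost]]
    sum.Sigma[OF finite_atMost ballI[OF finite_atLeastAtMost]]
  by (rule sum.reindex_bij_witness[where i = "\<lambda>(u, r). (r, u - r)" and j = "\<lambda>(r, s). (r + s, r)"]) auto

lemma sum_triangle_diagonal':
  "(\<Sum>i\<le>K. \<Sum>a\<le>K - i. h i a) = (\<Sum>s\<le>K. \<Sum>i\<le>(s::nat). (h i (s - i) :: 'a :: comm_monoid_add))"
  unfolding sum.Sigma[OF finite_atMost ballI[OF finite_atMost]]
  by (rule sum.reindex_bij_witness[where i = "\<lambda>(u, r). (r, u - r)" and j = "\<lambda>(r, s). (r + s, r)"]) auto

text \<open>For a family \<open>X\<^sub>1, X\<^sub>2, \<dots>\<close> of operators these are the coefficients of the powers and of the exponential of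
  \<open>\<Sum>\<^sub>k X\<^sub>k z\<^sup>k\<close>. The series \<open>c(z)\<close> and both bosonic vertex operators are of this form.\<close>

fun conv_power :: "(nat \<Rightarrow> operator) \<Rightarrow> nat \<Rightarrow> nat \<Rightarrow> operator" where
  "conv_power X 0 i f = (if i = 0 then f else 0)"
| "conv_power X (Suc j) i f = (\<Sum>k=1..i. X k (conv_power X j (i - k) f))"

definition conv_exp :: "(nat \<Rightarrow> operator) \<Rightarrow> nat \<Rightarrow> operator" where
  "conv_exp X i f = (\<Sum>j\<le>i. scale (1 / of_nat (fact j)) (conv_power X j i f))"

lemma scale_of_nat_cancel:
  assumes "n > 0" "scale (of_nat n) f = scale (of_nat n) g"
  shows "f = g"
  using assms by (simp add: vs.scale_cancel_left)

lemma scale_of_nat_add: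
  "scale (of_nat (a + b)) f = scale (of_nat a) f + scale (of_nat b) f"
  by (simp add: vs.scale_left_distrib)

locale commuting_family =
  fixes X :: "nat \<Rightarrow> operator"
  assumes lin_X: "k \<ge> 1 \<Longrightarrow> lin (X k)"
    and commute: "k \<ge> 1 \<Longrightarrow> l \<ge> 1 \<Longrightarrow> X k (X l f) = X l (X k f)"
begin

lemma conv_power_zero: "i < j \<Longrightarrow> conv_power X j i f = 0"
proof (induction j arbitrary: i)
  case (Suc j)
  then show ?case by (auto simp: lin_0[OF lin_X] intro!: sum.neutral)
qed simp

lemma lin_conv_power: "lin (conv_power X j i)"
proof (induction j arbitrary: i)
  case 0
  show ?case by (rule linI) auto
next
  case (Suc j)
  have "lin (\<lambda>f. \<Sum>k=1..i. X k (conv_power X j (i - k) f))"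
    using lin_comp[OF lin_X Suc] by (intro lin_sumI) auto
  then show ?case by (simp add: fun_eq_iff[symmetric])
qed

lemma lin_conv_exp: "lin (conv_exp X i)"
  unfolding conv_exp_def[abs_def] by (intro lin_sumI lin_scaleI lin_conv_power)

lemma conv_power_euler:
  "scale (of_nat i) (conv_power X (Suc j) i f) =
    scale (of_nat (Suc j)) (\<Sum>k=1..i. scale (of_nat k) (X k (conv_power X j (i - k) f)))"
proof (induction j arbitrary: i)
  case 0
  have "scale (of_nat i) (X k (conv_power X 0 (i - k) f)) =
      scale (of_nat k) (X k (conv_power X 0 (i - k) f))" if "k \<in> {1..i}" for k
    using that lin_0[OF lin_X[of k]] by (cases "i = k") auto
  then have "(\<Sum>k=1..i. scale (of_nat i) (X k (conv_power X 0 (i - k) f))) =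
      (\<Sum>k=1..i. scale (of_nat k) (X k (conv_power X 0 (i - k) f)))"
    by (intro sum.cong refl)
  then show ?case
    by (simp only: conv_power.simps(2) vs.scale_sum_right of_nat_Suc of_nat_0 add_0_right
        vs.scale_one)
next
  case (Suc j)
  let ?P = "conv_power X"
  have *: "scale (of_nat i) (X k (?P (Suc j) (i - k) f)) =
      scale (of_nat k) (X k (?P (Suc j) (i - k) f)) + scale (of_nat (Suc j))
        (\<Sum>l=1..i - k. scale (of_nat l) (X l (X k (?P j (i - k - l) f))))" if k: "k \<in> {1..i}" for k
  proof -
    have "scale (of_nat i) (X k (?P (Suc j) (i - k) f)) =
        scale (of_nat k) (X k (?P (Suc j) (i - k) f)) + X k (scale (of_nat (i - k)) (?P (Suc j) (i - k) f))"
      using k scale_of_nat_add[of k "i - k"] by (simp add: lin_scale[OF lin_X] del: conv_power.simps)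
    also have "X k (scale (of_nat (i - k)) (?P (Suc j) (i - k) f)) = scale (of_nat (Suc j))
        (\<Sum>l=1..i - k. scale (of_nat l) (X l (X k (?P j (i - k - l) f))))"
      unfolding Suc using k
      by (simp add: lin_scale[OF lin_X] lin_sum[OF lin_X] commute[of k] del: conv_power.simps of_nat_Suc)
    finally show ?thesis .
  qed
  have "scale (of_nat i) (?P (Suc (Suc j)) i f) = (\<Sum>k=1..i. scale (of_nat i) (X k (?P (Suc j) (i - k) f)))"
    by (simp only: conv_power.simps(2)[of X "Suc j"] vs.scale_sum_right)
  also have "\<dots> = (\<Sum>k=1..i. scale (of_nat k) (X k (?P (Suc j) (i - k) f))) + scale (of_nat (Suc j))
      (\<Sum>k=1..i. \<Sum>l=1..i - k. scale (of_nat l) (X l (X k (?P j (i - k - l) f))))"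
    unfolding vs.scale_sum_right[of "of_nat (Suc j)" _ "{1..i}"] sum.distrib[symmetric]
    by (intro sum.cong refl *)
  also have "(\<Sum>k=1..i. \<Sum>l=1..i - k. scale (of_nat l) (X l (X k (?P j (i - k - l) f)))) =
      (\<Sum>l=1..i. scale (of_nat l) (X l (?P (Suc j) (i - l) f)))"
  proof (subst sum_triangle_swap, intro sum.cong refl)
    fix l assume "l \<in> {1..i}"
    then show "(\<Sum>k=1..i - l. scale (of_nat l) (X l (X k (?P j (i - k - l) f)))) =
        scale (of_nat l) (X l (?P (Suc j) (i - l) f))"
      by (simp add: lin_sum[OF lin_X] vs.scale_sum_right add.commute)
  qed
  also have "(\<Sum>k=1..i. scale (of_nat k) (X k (?P (Suc j) (i - k) f))) + scale (of_nat (Suc j))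
      (\<Sum>l=1..i. scale (of_nat l) (X l (?P (Suc j) (i - l) f))) = scale (of_nat (Suc (Suc j)))
      (\<Sum>k=1..i. scale (of_nat k) (X k (?P (Suc j) (i - k) f)))"
    using scale_of_nat_add[of 1 "Suc j"] by simp
  finally show ?case .
qed

lemma conv_exp_0 [simp]: "conv_exp X 0 f = f"
  by (simp add: conv_exp_def)

text \<open>The coefficient form of \<open>z E' = (z X') E\<close> for \<open>E = exp X\<close>. It determines \<open>E\<close> recursively and replaces the
  definition of the exponential in everything that follows.\<close>

lemma conv_exp_euler:
  "scale (of_nat i) (conv_exp X i f) = (\<Sum>k=1..i. scale (of_nat k) (X k (conv_exp X (i - k) f)))"
proof (cases i)
  case (Suc i')
  let ?P = "conv_power X" and ?c = "\<lambda>j. 1 / of_nat (fact j) :: coef"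
  have c: "?c (Suc j) * of_nat (Suc j) = ?c j" for j
  proof -
    have "(of_nat (Suc j) :: coef) \<noteq> 0" unfolding of_nat_coef_eq_0_iff by simp
    then show ?thesis
      by (simp only: fact_Suc of_nat_mult of_nat_id) (simp add: divide_simps del: of_nat_Suc of_nat_fact)
  qed
  have "scale (of_nat i) (conv_exp X i f) = (\<Sum>j\<le>i. scale (of_nat i) (scale (?c j) (?P j i f)))"
    by (simp add: conv_exp_def vs.scale_sum_right)
  also have "\<dots> = (\<Sum>j\<le>i'. scale (of_nat i) (scale (?c (Suc j)) (?P (Suc j) i f)))"
    unfolding Suc sum.atMost_Suc_shift by simp
  also have "\<dots> = (\<Sum>j\<le>i'. \<Sum>k=1..i. scale (of_nat k) (X k (scale (?c j) (?P j (i - k) f))))"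
  proof (intro sum.cong refl)
    fix j
    have "scale (of_nat i) (scale (?c (Suc j)) (?P (Suc j) i f)) =
        scale (?c (Suc j)) (scale (of_nat i) (?P (Suc j) i f))"
      by (rule vs.scale_left_commute)
    also have "\<dots> = scale (?c j) (\<Sum>k=1..i. scale (of_nat k) (X k (?P j (i - k) f)))"
      unfolding conv_power_euler vs.scale_scale c ..
    also have "\<dots> = (\<Sum>k=1..i. scale (of_nat k) (X k (scale (?c j) (?P j (i - k) f))))"
      unfolding vs.scale_sum_right
      by (intro sum.cong refl) (simp add: lin_scale[OF lin_X] mult.commute)
    finally show "scale (of_nat i) (scale (?c (Suc j)) (?P (Suc j) i f)) =
        (\<Sum>k=1..i. scale (of_nat k) (X k (scale (?c j) (?P j (i - k) f))))" .
  qed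
  also have "\<dots> = (\<Sum>k=1..i. \<Sum>j\<le>i'. scale (of_nat k) (X k (scale (?c j) (?P j (i - k) f))))"
    by (rule sum.swap)
  also have "\<dots> = (\<Sum>k=1..i. scale (of_nat k) (X k (conv_exp X (i - k) f)))"
  proof (intro sum.cong refl)
    fix k assume k: "k \<in> {1..i}"
    have "conv_exp X (i - k) f = (\<Sum>j\<le>i'. scale (?c j) (?P j (i - k) f))"
      unfolding conv_exp_def using k Suc
      by (intro sum.mono_neutral_left) (auto simp: conv_power_zero)
    then show "(\<Sum>j\<le>i'. scale (of_nat k) (X k (scale (?c j) (?P j (i - k) f)))) =
        scale (of_nat k) (X k (conv_exp X (i - k) f))"
      using k by (simp add: lin_sum[OF lin_X] vs.scale_sum_right)
  qed
  finally show ?thesis .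
qed simp

lemma conv_exp_commute:
  assumes D: "lin D" and comm: "\<And>k f. k \<ge> 1 \<Longrightarrow> D (X k f) = X k (D f)"
  shows "D (conv_exp X i f) = conv_exp X i (D f)"
proof (induction i rule: less_induct)
  case (less i)
  show ?case
  proof (cases "i = 0")
    case False
    have "scale (of_nat i) (D (conv_exp X i f)) = scale (of_nat i) (conv_exp X i (D f))"
      unfolding lin_scale[OF D, symmetric] conv_exp_euler lin_sum[OF D]
      by (intro sum.cong refl) (simp add: lin_scale[OF D] comm less)
    then show ?thesis using False scale_of_nat_cancel by blast
  qed simp
qed

lemma series_sum_apply:
  assumes "\<sigma> \<noteq> (0::int)"
  shows "series_sum {1..} (\<lambda>k. op_monom (\<sigma> * int k) (X k)) n f =
    (if n \<in> (\<lambda>k. \<sigma> * int k) ` {1..} then X (nat (n div \<sigma>)) f else 0)"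
proof (cases "n \<in> (\<lambda>k. \<sigma> * int k) ` {1..}")
  case True
  then obtain k where k: "k \<ge> 1" "n = \<sigma> * int k" by auto
  then have "op_sum {1..} (\<lambda>k. op_monom (\<sigma> * int k) (X k) n) f =
      (\<Sum>k\<in>{k}. op_monom (\<sigma> * int k) (X k) n f)"
    using assms by (intro op_sum_eq_sum) (auto simp: op_monom_def)
  then show ?thesis
    using True k assms by (simp add: series_sum_def op_monom_def)
next
  case False
  then have "op_sum {1..} (\<lambda>k. op_monom (\<sigma> * int k) (X k) n) f =
      (\<Sum>k\<in>{}. op_monom (\<sigma> * int k) (X k) n f)"
    by (intro op_sum_eq_sum) (auto simp: op_monom_def)
  then show ?thesis unfolding series_sum_def by (subst if_not_P[OF False]) simp
qed

lemma series_prod_replicate: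
  assumes "\<sigma> \<noteq> (0::int)"
  defines "S \<equiv> series_sum {1..} (\<lambda>k. op_monom (\<sigma> * int k) (X k))"
  shows "series_prod (replicate j S) (\<sigma> * int a) f = conv_power X j a f"
    and "n \<notin> range (\<lambda>a. \<sigma> * int a) \<Longrightarrow> series_prod (replicate j S) n f = 0"
proof (induction j arbitrary: a n)
  case 0
  {
    case 1
    show ?case using assms(1) by (simp add: series_prod_apply delta_series_def)
  next
    case 2
    have "n \<noteq> 0" using 2 rangeI[of "\<lambda>a. \<sigma> * int a" 0] by auto
    then show ?case by (simp add: series_prod_apply delta_series_def)
  }
next
  case (Suc j)
  have step: "series_prod (replicate (Suc j) S) n f =
      Sum_any (\<lambda>i. S i (series_prod (replicate j S) (n - i) f))" for n
    by (simp add: series_prod_apply act_def)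
  have supp: "\<exists>k b. k \<ge> 1 \<and> i = \<sigma> * int k \<and> n = \<sigma> * int (k + b)"
    if nz: "S i (series_prod (replicate j S) (n - i) f) \<noteq> 0" for i n
  proof -
    obtain k where k: "k \<ge> 1" "i = \<sigma> * int k"
      using nz unfolding S_def series_sum_apply[OF assms(1)] by (auto split: if_splits)
    have "n - i \<in> range (\<lambda>a. \<sigma> * int a)"
    proof (rule ccontr)
      assume "n - i \<notin> range (\<lambda>a. \<sigma> * int a)"
      then have "series_prod (replicate j S) (n - i) f = 0" by (rule Suc.IH(2))
      with nz k assms(1) lin_0[OF lin_X[of k]] show False
        unfolding S_def series_sum_apply[OF assms(1)] by simp
    qed
    then obtain b where "n - i = \<sigma> * int b" by auto
    then have "n = \<sigma> * int (k + b)" using k by (simp add: algebra_simps)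
    with k show ?thesis by blast
  qed
  {
    case 1
    have "series_prod (replicate (Suc j) S) (\<sigma> * int a) f =
        (\<Sum>i\<in>(\<lambda>k. \<sigma> * int k) ` {1..a}. S i (series_prod (replicate j S) (\<sigma> * int a - i) f))"
      unfolding step
    proof (rule Sum_any.expand_superset)
      show "{i. S i (series_prod (replicate j S) (\<sigma> * int a - i) f) \<noteq> 0} \<subseteq> (\<lambda>k. \<sigma> * int k) ` {1..a}"
      proof
        fix i assume "i \<in> {i. S i (series_prod (replicate j S) (\<sigma> * int a - i) f) \<noteq> 0}"
        then obtain k b where k: "k \<ge> 1" "i = \<sigma> * int k" "\<sigma> * int a = \<sigma> * int (k + b)"
          using supp by blast
        then have "a = k + b" using assms(1) by (simp only: mult_cancel_left of_nat_eq_iff) simp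
        with k show "i \<in> (\<lambda>k. \<sigma> * int k) ` {1..a}" by auto
      qed
    qed simp
    also have "\<dots> = (\<Sum>k=1..a. S (\<sigma> * int k) (series_prod (replicate j S) (\<sigma> * int a - \<sigma> * int k) f))"
      using assms(1) by (subst sum.reindex) (auto simp: inj_on_def)
    also have "\<dots> = (\<Sum>k=1..a. X k (conv_power X j (a - k) f))"
    proof (intro sum.cong refl)
      fix k assume k: "k \<in> {1..a}"
      then have "\<sigma> * int a - \<sigma> * int k = \<sigma> * int (a - k)"
        by (simp add: of_nat_diff right_diff_distrib)
      then have "series_prod (replicate j S) (\<sigma> * int a - \<sigma> * int k) f = conv_power X j (a - k) f"
        using Suc.IH(1) by simp
      then show "S (\<sigma> * int k) (series_prod (replicate j S) (\<sigma> * int a - \<sigma> * int k) f) =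
          X k (conv_power X j (a - k) f)"
        using k assms(1) unfolding S_def series_sum_apply[OF assms(1)] by auto
    qed
    finally show ?case by simp
  next
    case 2
    have "S i (series_prod (replicate j S) (n - i) f) = 0" for i
      using supp[of i n] 2 by blast
    then show ?case unfolding step by simp
  }
qed

text \<open>The parameter \<open>\<sigma>\<close> is the exponent of \<open>w\<close> carried by \<open>z\<close>: 2 for \<open>V\<^sub>B\<^bsup>(-)\<^esup>\<close> and \<open>-2\<close> for \<open>V\<^sub>B\<^bsup>(+)\<^esup>\<close>.\<close>

lemma series_exp_apply:
  assumes "\<sigma> \<noteq> (0::int)"
  defines "S \<equiv> series_sum {1..} (\<lambda>k. op_monom (\<sigma> * int k) (X k))"
  shows "series_exp S (\<sigma> * int a) f = conv_exp X a f"
    and "n \<notin> range (\<lambda>a. \<sigma> * int a) \<Longrightarrow> series_exp S n f = 0"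
proof -
  have e: "series_exp S n f =
      op_sum UNIV (\<lambda>j f. scale (1 / of_nat (fact j)) (series_prod (replicate j S) n f)) f" for n
    by (simp add: series_exp_def series_sum_def series_scale_def)
  show "series_exp S (\<sigma> * int a) f = conv_exp X a f"
    unfolding e conv_exp_def unfolding S_def series_prod_replicate[OF assms(1)]
    by (rule op_sum_eq_sum) (auto simp: conv_power_zero)
  show "series_exp S n f = 0" if "n \<notin> range (\<lambda>a. \<sigma> * int a)"
    unfolding e unfolding S_def series_prod_replicate(2)[OF assms(1) that]
    by (simp add: op_sum_def)
qed

lemma act_series_exp:
  assumes "\<sigma> \<noteq> (0::int)" and "\<And>a. a > d \<Longrightarrow> conv_exp X a (G (n - \<sigma> * int a)) = 0"
  shows "act (series_exp (series_sum {1..} (\<lambda>k. op_monom (\<sigma> * int k) (X k)))) G n =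
    (\<Sum>a\<le>d. conv_exp X a (G (n - \<sigma> * int a)))"
proof -
  let ?V = "series_exp (series_sum {1..} (\<lambda>k. op_monom (\<sigma> * int k) (X k)))"
  have "act ?V G n = (\<Sum>i\<in>(\<lambda>a. \<sigma> * int a) ` {..d}. ?V i (G (n - i)))"
    unfolding act_def
  proof (rule Sum_any.expand_superset)
    show "{i. ?V i (G (n - i)) \<noteq> 0} \<subseteq> (\<lambda>a. \<sigma> * int a) ` {..d}"
    proof
      fix i assume "i \<in> {i. ?V i (G (n - i)) \<noteq> 0}"
      then have nz: "?V i (G (n - i)) \<noteq> 0" by simp
      then obtain a where a: "i = \<sigma> * int a"
        using series_exp_apply(2)[OF assms(1)] by blast
      with nz have "conv_exp X a (G (n - \<sigma> * int a)) \<noteq> 0"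
        using series_exp_apply(1)[OF assms(1)] by simp
      then have "a \<le> d" using assms(2) by (meson not_le)
      with a show "i \<in> (\<lambda>a. \<sigma> * int a) ` {..d}" by auto
    qed
  qed simp
  also have "\<dots> = (\<Sum>a\<le>d. ?V (\<sigma> * int a) (G (n - \<sigma> * int a)))"
    using assms(1) by (subst sum.reindex) (auto simp: inj_on_def)
  finally show ?thesis unfolding series_exp_apply(1)[OF assms(1)] .
qed

end

section \<open>The bosonic vertex operators\<close>

definition minus_family :: "nat \<Rightarrow> operator" where
  "minus_family k f = scale ((1 - inverse t_par ^ k) / of_nat k) (mult_p k f)"

definition plus_family :: "nat \<Rightarrow> operator" where
  "plus_family k f = scale (q_par ^ k - 1) (deriv_p k f)"

definition c_family :: "nat \<Rightarrow> operator" where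
  "c_family k f = scale ((1 - t_par ^ k) / of_nat k) (mult_p k f)"

lemma commuting_scaled_family:
  assumes "\<And>k. k \<ge> 1 \<Longrightarrow> lin (Y k)" "\<And>k l f. k \<ge> 1 \<Longrightarrow> l \<ge> 1 \<Longrightarrow> Y k (Y l f) = Y l (Y k f)"
  shows "commuting_family (\<lambda>k f. scale (a k) (Y k f))"
proof (rule commuting_family.intro)
  fix k :: nat assume "k \<ge> 1"
  then show "lin (\<lambda>f. scale (a k) (Y k f))" by (intro lin_scaleI assms)
next
  fix k l :: nat and f assume "k \<ge> 1" "l \<ge> 1"
  then show "scale (a k) (Y k (scale (a l) (Y l f))) = scale (a l) (Y l (scale (a k) (Y k f)))"
    using assms(2)[of k l f] by (simp add: lin_scale[OF assms(1)] mult.commute)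
qed

interpretation minus: commuting_family minus_family
proof -
  have "commuting_family (\<lambda>k f. scale ((1 - inverse t_par ^ k) / of_nat k) (times_b (p_elem k) f))"
    by (rule commuting_scaled_family[where Y = "\<lambda>k. times_b (p_elem k)"])
       (auto simp: lin_times_b times_b_commute)
  then show "commuting_family minus_family"
    by (simp add: minus_family_def[abs_def] mult_p_eq)
qed

interpretation c: commuting_family c_family
proof -
  have "commuting_family (\<lambda>k f. scale ((1 - t_par ^ k) / of_nat k) (times_b (p_elem k) f))"
    by (rule commuting_scaled_family[where Y = "\<lambda>k. times_b (p_elem k)"])
       (auto simp: lin_times_b times_b_commute)
  then show "commuting_family c_family"
    by (simp add: c_family_def[abs_def] mult_p_eq)
qed

interpretation plus: commuting_family plus_family
proof -
  have "commuting_family (\<lambda>k f. scale (q_par ^ k - 1) (deriv_p k f))"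
    by (rule commuting_scaled_family) (simp_all add: lin_deriv_p deriv_p_commute)
  then show "commuting_family plus_family"
    by (simp add: plus_family_def[abs_def])
qed

abbreviation V_minus :: "nat \<Rightarrow> operator" where "V_minus \<equiv> conv_exp minus_family"
abbreviation V_plus :: "nat \<Rightarrow> operator" where "V_plus \<equiv> conv_exp plus_family"

abbreviation times_c :: "nat \<Rightarrow> operator" where "times_c k \<equiv> times_b (c_elem k)"

text \<open>Multiplication turns the composition of power series that defines the \<open>c\<^sub>k\<close> into the exponential of a
  commuting family of operators.\<close>

lemma times_c_eq: "times_c n f = conv_exp c_family n f"
proof -
  define L where "L = Abs_fps (\<lambda>r. if r = 0 then 0 else const ((1 - t_par ^ r) / of_nat r) * p_elem r)"
  have pow: "times_b (fps_nth (L ^ j) n) f = conv_power c_family j n f" for j n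
  proof (induction j arbitrary: n)
    case 0
    then show ?case by simp
  next
    case (Suc j)
    have "times_b (fps_nth (L ^ Suc j) n) f =
        (\<Sum>k=0..n. times_b (fps_nth L k) (times_b (fps_nth (L ^ j) (n - k)) f))"
      by (simp add: fps_mult_nth times_b_sum times_b_times_b)
    also have "\<dots> = (\<Sum>k=1..n. times_b (fps_nth L k) (times_b (fps_nth (L ^ j) (n - k)) f))"
      by (rule sum.mono_neutral_right) (auto simp: L_def not_less_eq_eq)
    also have "\<dots> = conv_power c_family (Suc j) n f"
      unfolding Suc conv_power.simps
      by (intro sum.cong refl)
         (auto simp: L_def c_family_def mult_p_eq times_b_times_b[symmetric] times_b_const)
    finally show ?case .
  qed
  have "c_elem n = (\<Sum>j=0..n. const (1 / of_nat (fact j)) * fps_nth (L ^ j) n)"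
    unfolding c_elem_def c_series_def L_def[symmetric] fps_compose_nth by simp
  then show ?thesis
    by (simp add: conv_exp_def times_b_sum times_b_times_b[symmetric] times_b_const pow atLeast0AtMost)
qed

lemma times_c_0 [simp]: "times_c 0 f = f"
  by (simp add: times_c_eq)

lemma times_c_euler:
  "scale (of_nat n) (times_c n f) =
    (\<Sum>r=1..n. scale (1 - t_par ^ r) (times_b (p_elem r) (times_c (n - r) f)))"
  unfolding times_c_eq c.conv_exp_euler
  by (intro sum.cong refl) (simp add: c_family_def mult_p_eq)

lemma deriv_\<pi>_V_minus: "j \<ge> 1 \<Longrightarrow> deriv_\<pi> j (V_minus i f) = V_minus i (deriv_\<pi> j f)"
  by (rule minus.conv_exp_commute[OF lin_deriv_\<pi>])
     (simp_all add: minus_family_def mult_p_eq lin_scale[OF lin_deriv_\<pi>] deriv_\<pi>_times_b)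

lemma deriv_\<pi>_V_plus: "j \<ge> 1 \<Longrightarrow> deriv_\<pi> j (V_plus i f) = V_plus i (deriv_\<pi> j f)"
  by (rule plus.conv_exp_commute[OF lin_deriv_\<pi>])
     (simp_all add: plus_family_def lin_scale[OF lin_deriv_\<pi>] deriv_\<pi>_deriv_p)

lemma times_b_V_minus: "times_b a (V_minus i f) = V_minus i (times_b a f)"
  by (rule minus.conv_exp_commute[OF lin_times_b])
     (simp add: minus_family_def mult_p_eq lin_scale[OF lin_times_b] times_b_commute[of a])

lemma vacuum_part_V_plus: "vacuum_part (V_plus i f) = V_plus i (vacuum_part f)"
proof (rule plus.conv_exp_commute[OF lin_vacuum_part])
  fix k :: nat and f assume "k \<ge> 1"
  have "vacuum_part (deriv_p k f) = deriv_p k (vacuum_part f)"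
    by (rule poly_mapping_eqI) (simp add: vacuum_part_def lookup_deriv_p lookup_single when_def)
  then show "vacuum_part (plus_family k f) = plus_family k (vacuum_part f)"
    by (simp add: plus_family_def lin_scale[OF lin_vacuum_part])
qed

lemma V_plus_V_F_vev: "V_plus i (V_F_vev n f) = V_F_vev n (V_plus i f)"
  by (rule V_F_vev_commute[OF plus.lin_conv_exp deriv_\<pi>_V_plus vacuum_part_V_plus])

lemma times_b_V_F_vev: "times_b a (V_F_vev n f) = V_F_vev n (times_b a f)"
  by (rule V_F_vev_commute[OF lin_times_b deriv_\<pi>_times_b])
     (simp_all, rule poly_mapping_eqI,
      simp add: vacuum_part_def lookup_of_bosonic_mult lookup_single when_def)

text \<open>The grading in which \<open>p\<^sub>k\<close> has weight \<open>k\<close>. The coefficient \<open>i\<close> of \<open>V\<^sub>B\<^bsup>(+)\<^esup>\<close> lowers it by \<open>i\<close>, hence only finitely many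
  coefficients act nontrivially on a given element.\<close>

definition p_weight :: "(nat \<Rightarrow>\<^sub>0 nat) \<Rightarrow> nat" where
  "p_weight m = (\<Sum>i\<in>Poly_Mapping.keys m. Suc i * Poly_Mapping.lookup m i)"

lemma p_weight_add_single:
  assumes "k \<ge> 1"
  shows "p_weight (m + Poly_Mapping.single (k - 1) 1) = p_weight m + k"
proof -
  let ?s = "Poly_Mapping.single (k - 1) (1::nat)"
  let ?S = "insert (k - 1) (Poly_Mapping.keys m)"
  have *: "p_weight n = (\<Sum>i\<in>?S. Suc i * Poly_Mapping.lookup n i)" if "Poly_Mapping.keys n \<subseteq> ?S" for n
    unfolding p_weight_def using that by (intro sum.mono_neutral_left) (auto simp: in_keys_iff)
  have "Poly_Mapping.keys (m + ?s) \<subseteq> ?S"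
    using keys_add[of m ?s] by auto
  then have "p_weight (m + ?s) = (\<Sum>i\<in>?S. Suc i * Poly_Mapping.lookup m i + (if i = k - 1 then Suc i else 0))"
    unfolding *[OF \<open>Poly_Mapping.keys (m + ?s) \<subseteq> ?S\<close>]
    by (intro sum.cong refl) (auto simp: lookup_add lookup_single when_def algebra_simps)
  also have "\<dots> = p_weight m + Suc (k - 1)"
    unfolding sum.distrib *[OF subset_insertI] by (simp add: sum.delta)
  finally show ?thesis using assms by simp
qed

text \<open>The bound is an integer: a negative bound forces \<open>f = 0\<close>.\<close>

definition p_weight_le :: "int \<Rightarrow> superring \<Rightarrow> bool" where
  "p_weight_le d f \<longleftrightarrow>
    (\<forall>I m. Poly_Mapping.lookup (Poly_Mapping.lookup f I) m \<noteq> 0 \<longrightarrow> int (p_weight m) \<le> d)"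

lemma p_weight_le_sum: "(\<And>i. i \<in> S \<Longrightarrow> p_weight_le d (f i)) \<Longrightarrow> p_weight_le d (sum f S)"
proof (induction S rule: infinite_finite_induct)
  case (insert x S)
  then have "p_weight_le d (f x)" "p_weight_le d (sum f S)" by auto
  then have "p_weight_le d (f x + sum f S)"
    unfolding p_weight_le_def lookup_add by (metis add.right_neutral)
  then show ?case using insert by simp
qed (simp_all add: p_weight_le_def)

lemma p_weight_le_scale: "p_weight_le d f \<Longrightarrow> p_weight_le d (scale c f)"
  by (auto simp: p_weight_le_def lookup_scale lookup_const_mult)

lemma p_weight_le_deriv_p:
  assumes "p_weight_le d f" "k \<ge> 1"
  shows "p_weight_le (d - int k) (deriv_p k f)"
  unfolding p_weight_le_def
proof (intro allI impI)
  fix I m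
  assume "Poly_Mapping.lookup (Poly_Mapping.lookup (deriv_p k f) I) m \<noteq> 0"
  then have "Poly_Mapping.lookup (Poly_Mapping.lookup f I) (m + Poly_Mapping.single (k - 1) 1) \<noteq> 0"
    using assms(2) by (auto simp: lookup_deriv_p lookup_bosonic_deriv)
  then have "int (p_weight (m + Poly_Mapping.single (k - 1) 1)) \<le> d"
    using assms(1) unfolding p_weight_le_def by blast
  then show "int (p_weight m) \<le> d - int k"
    unfolding p_weight_add_single[OF assms(2)] by simp
qed

lemma p_weight_le_ex: "\<exists>d. p_weight_le d f"
proof -
  let ?S = "\<Union>I\<in>Poly_Mapping.keys f. p_weight ` Poly_Mapping.keys (Poly_Mapping.lookup f I)"
  have "finite ?S" by simp
  have "p_weight_le (int (\<Sum>?S)) f"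
    unfolding p_weight_le_def
  proof (intro allI impI)
    fix I m assume nz: "Poly_Mapping.lookup (Poly_Mapping.lookup f I) m \<noteq> 0"
    then have "I \<in> Poly_Mapping.keys f" "m \<in> Poly_Mapping.keys (Poly_Mapping.lookup f I)"
      by (auto simp: in_keys_iff)
    then have "p_weight m \<in> ?S" by blast
    then have "p_weight m \<le> \<Sum>?S"
      using member_le_sum[OF _ _ \<open>finite ?S\<close>, of "p_weight m" "\<lambda>x. x"] by simp
    then show "int (p_weight m) \<le> int (\<Sum>?S)"
      by (simp only: of_nat_le_iff)
  qed
  then show ?thesis by blast
qed

lemma p_weight_le_V_plus: "p_weight_le d f \<Longrightarrow> p_weight_le (d - int i) (V_plus i f)"
proof (induction i rule: less_induct)
  case (less i)
  show ?case
  proof (cases "i = 0")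
    case False
    have "p_weight_le (d - int i) (\<Sum>k=1..i. scale (of_nat k) (plus_family k (V_plus (i - k) f)))"
    proof (rule p_weight_le_sum)
      fix k assume k: "k \<in> {1..i}"
      then have "p_weight_le (d - int (i - k)) (V_plus (i - k) f)"
        using less.IH[of "i - k"] less.prems False by simp
      then have "p_weight_le (d - int (i - k) - int k) (deriv_p k (V_plus (i - k) f))"
        using k by (intro p_weight_le_deriv_p) auto
      then show "p_weight_le (d - int i) (scale (of_nat k) (plus_family k (V_plus (i - k) f)))"
        using k unfolding plus_family_def by (intro p_weight_le_scale) (simp add: of_nat_diff)
    qed
    then have "p_weight_le (d - int i) (scale (1 / of_nat i) (scale (of_nat i) (V_plus i f)))"
      unfolding plus.conv_exp_euler by (rule p_weight_le_scale)
    then show ?thesis using False by simp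
  qed (use less in simp)
qed

lemma V_plus_locally_nilpotent: "\<exists>d. \<forall>i>d. V_plus i f = 0"
proof -
  obtain d where d: "p_weight_le d f" using p_weight_le_ex by blast
  have "V_plus i f = 0" if "i > nat d" for i
  proof -
    have "p_weight_le (d - int i) (V_plus i f)" by (rule p_weight_le_V_plus[OF d])
    moreover have "d - int i < 0" using that by linarith
    ultimately have "Poly_Mapping.lookup (Poly_Mapping.lookup (V_plus i f) I) m = 0" for I m
      unfolding p_weight_le_def by (meson not_less of_nat_0_le_iff order_trans)
    then show ?thesis by (intro poly_mapping_eqI) simp
  qed
  then show ?thesis by blast
qed

text \<open>Extending the coefficients by 0 to negative indices removes case distinctions from the exchange relations.\<close>

definition V_plus_int :: "int \<Rightarrow> operator" where
  "V_plus_int i f = (if i < 0 then 0 else V_plus (nat i) f)"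

lemma lin_V_plus_int: "lin (V_plus_int i)"
proof (cases "i < 0")
  case True
  then show ?thesis by (intro linI) (simp_all add: V_plus_int_def)
next
  case False
  then have "V_plus_int i = V_plus (nat i)" by (simp add: V_plus_int_def fun_eq_iff)
  then show ?thesis by (simp add: plus.lin_conv_exp)
qed

text \<open>From \<open>[\<partial>/\<partial>p\<^sub>k, p\<^sub>l] = \<delta>\<^bsub>kl\<^esub>\<close>: conjugation by \<open>V\<^sub>B\<^bsup>(+)\<^esup>\<close> is the shift \<open>p\<^sub>l \<mapsto> p\<^sub>l + (q\<^sup>l - 1) w\<^bsup>-2l\<^esup>\<close>.\<close>

lemma V_plus_p:
  assumes l: "l \<ge> 1"
  shows "V_plus i (times_b (p_elem l) f) =
    times_b (p_elem l) (V_plus i f) + (if l \<le> i then scale (q_par ^ l - 1) (V_plus (i - l) f) else 0)"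
proof (induction i rule: less_induct)
  case (less i)
  let ?p = "times_b (p_elem l)" and ?X = plus_family and ?c = "q_par ^ l - 1"
  show ?case
  proof (cases "i = 0")
    case False
    have X: "?X k (?p g) = ?p (?X k g) + (if k = l then scale ?c g else 0)" if "k \<ge> 1" for k g
      using that l by (simp add: plus_family_def deriv_p_times_p lin_scale[OF lin_times_b]
          vs.scale_right_distrib)
    have "scale (of_nat i) (V_plus i (?p f)) =
        (\<Sum>k=1..i. scale (of_nat k) (?X k (V_plus (i - k) (?p f))))"
      by (rule plus.conv_exp_euler)
    also have "\<dots> = (\<Sum>k=1..i. ?p (scale (of_nat k) (?X k (V_plus (i - k) f)))
        + (if k = l then scale (of_nat l) (scale ?c (V_plus (i - l) f)) else 0)
        + (if k \<le> i - l \<and> l \<le> i then scale ?c (scale (of_nat k) (?X k (V_plus (i - l - k) f))) else 0))"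
    proof (intro sum.cong refl)
      fix k assume k: "k \<in> {1..i}"
      have eq: "l \<le> i - k \<longleftrightarrow> k \<le> i - l \<and> l \<le> i" and eq': "i - k - l = i - l - k"
        using k l by auto
      have "V_plus (i - k) (?p f) =
          ?p (V_plus (i - k) f) + (if l \<le> i - k then scale ?c (V_plus (i - k - l) f) else 0)"
        using k False by (intro less) auto
      then show "scale (of_nat k) (?X k (V_plus (i - k) (?p f))) =
        ?p (scale (of_nat k) (?X k (V_plus (i - k) f)))
        + (if k = l then scale (of_nat l) (scale ?c (V_plus (i - l) f)) else 0)
        + (if k \<le> i - l \<and> l \<le> i then scale ?c (scale (of_nat k) (?X k (V_plus (i - l - k) f))) else 0)"
        unfolding eq eq' using k
        by (simp add: lin_add[OF plus.lin_X] lin_scale[OF plus.lin_X] X vs.scale_right_distrib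
            lin_scale[OF lin_times_b] lin_0[OF plus.lin_X] vs.scale_left_commute del: vs.scale_scale)
    qed
    also have "\<dots> = ?p (scale (of_nat i) (V_plus i f))
        + (if l \<le> i then scale (of_nat l) (scale ?c (V_plus (i - l) f)) else 0)
        + (if l \<le> i then scale ?c (scale (of_nat (i - l)) (V_plus (i - l) f)) else 0)"
    proof -
      have "(\<Sum>k=1..i. if k \<le> i - l \<and> l \<le> i then scale ?c (scale (of_nat k) (?X k (V_plus (i - l - k) f))) else 0)
        = (if l \<le> i then scale ?c (scale (of_nat (i - l)) (V_plus (i - l) f)) else 0)"
      proof (cases "l \<le> i")
        case True
        have "(\<Sum>k=1..i. if k \<le> i - l \<and> l \<le> i then scale ?c (scale (of_nat k) (?X k (V_plus (i - l - k) f))) else 0)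
          = (\<Sum>k=1..i - l. scale ?c (scale (of_nat k) (?X k (V_plus (i - l - k) f))))"
          using True by (intro sum.mono_neutral_cong_right) auto
        also have "\<dots> = scale ?c (scale (of_nat (i - l)) (V_plus (i - l) f))"
          unfolding plus.conv_exp_euler vs.scale_sum_right ..
        finally show ?thesis using True by simp
      qed simp
      then show ?thesis
        using l by (simp add: sum.distrib plus.conv_exp_euler lin_sum[OF lin_times_b] sum.delta
            del: vs.scale_scale)
    qed
    also have "\<dots> = scale (of_nat i) (?p (V_plus i f) + (if l \<le> i then scale ?c (V_plus (i - l) f) else 0))"
    proof (cases "l \<le> i")
      case True
      have split: "scale (of_nat i) g = scale (of_nat l) g + scale (of_nat (i - l)) g" for g
        using scale_of_nat_add[of l "i - l" g] True by simp
      show ?thesis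
        by (simp only: True if_True lin_scale[OF lin_times_b] vs.scale_right_distrib add.assoc
            split[of "scale ?c _"] vs.scale_left_commute[of ?c "of_nat (i - l)"])
    qed (simp add: lin_scale[OF lin_times_b])
    finally show ?thesis using False scale_of_nat_cancel by blast
  qed (use l in simp)
qed

lemma V_plus_int_p:
  assumes "l \<ge> 1"
  shows "V_plus_int i (times_b (p_elem l) f) =
    times_b (p_elem l) (V_plus_int i f) + scale (q_par ^ l - 1) (V_plus_int (i - int l) f)"
proof (cases "i < 0")
  case True
  then show ?thesis by (simp add: V_plus_int_def lin_0[OF lin_times_b])
next
  case False
  then obtain n where i: "i = int n" using nonneg_int_cases[of i] by auto
  have "nat (int n - int l) = n - l" by simp
  then show ?thesis using V_plus_p[OF assms, of n f] i by (simp add: V_plus_int_def)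
qed

text \<open>The relation \<open>V\<^sub>B\<^bsup>(+)\<^esup>(w) c(z) = G(z/w\<^sup>2) c(z) V\<^sub>B\<^bsup>(+)\<^esup>(w)\<close>. The Euler identity for \<open>c(z)\<close> reduces it to the shift of
  the \<open>p\<^sub>r\<close>: with \<open>s\<close> the index of \<open>g\<^sub>s\<close>, the terms without a shift add up to \<open>(j - s) g\<^sub>s\<close> and those with a
  shift to \<open>s g\<^sub>s\<close>, the latter being the Euler identity for \<open>G\<close>.\<close>

lemma V_plus_int_c:
  "V_plus_int n (times_c j f) =
    (\<Sum>s\<le>j. scale (exchange_coeff s) (times_c (j - s) (V_plus_int (n - int s) f)))"
proof (induction j arbitrary: n rule: less_induct)
  case (less j)
  show ?case
  proof (cases "j = 0")
    case True
    then show ?thesis by (simp add: exchange_coeff_def)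
  next
    case False
    let ?V = V_plus_int and ?g = exchange_coeff and ?p = "\<lambda>r. times_b (p_elem r)"
    let ?a = "\<lambda>r. 1 - t_par ^ r" and ?b = "\<lambda>r. q_par ^ r - 1"
    have "scale (of_nat j) (?V n (times_c j f)) =
        (\<Sum>r=1..j. scale (?a r) (?V n (?p r (times_c (j - r) f))))"
      unfolding lin_scale[OF lin_V_plus_int, symmetric] times_c_euler lin_sum[OF lin_V_plus_int] ..
    also have "\<dots> = (\<Sum>r=1..j. (\<Sum>s\<le>j - r. scale (?g s) (scale (?a r) (?p r (times_c (j - s - r) (?V (n - int s) f)))))
        + (\<Sum>s\<le>j - r. scale (?a r * ?b r * ?g s) (times_c (j - (r + s)) (?V (n - int (r + s)) f))))"
    proof (intro sum.cong refl)
      fix r assume r: "r \<in> {1..j}"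
      have IH: "?V m (times_c (j - r) f) =
          (\<Sum>s\<le>j - r. scale (?g s) (times_c (j - r - s) (?V (m - int s) f)))" for m
        using r by (intro less) auto
      have "scale (?a r) (?p r (?V n (times_c (j - r) f))) =
          (\<Sum>s\<le>j - r. scale (?g s) (scale (?a r) (?p r (times_c (j - s - r) (?V (n - int s) f)))))"
        unfolding IH lin_sum[OF lin_times_b] vs.scale_sum_right
        by (intro sum.cong refl) (simp add: lin_scale[OF lin_times_b] mult.commute add.commute[of r])
      moreover have "scale (?a r) (scale (?b r) (?V (n - int r) (times_c (j - r) f))) =
          (\<Sum>s\<le>j - r. scale (?a r * ?b r * ?g s) (times_c (j - (r + s)) (?V (n - int (r + s)) f)))"
        unfolding IH vs.scale_sum_right
        by (intro sum.cong refl) (simp add: mult.assoc diff_diff_eq)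
      ultimately show "scale (?a r) (?V n (?p r (times_c (j - r) f))) =
          (\<Sum>s\<le>j - r. scale (?g s) (scale (?a r) (?p r (times_c (j - s - r) (?V (n - int s) f)))))
        + (\<Sum>s\<le>j - r. scale (?a r * ?b r * ?g s) (times_c (j - (r + s)) (?V (n - int (r + s)) f)))"
        using r by (simp add: V_plus_int_p vs.scale_right_distrib del: vs.scale_scale)
    qed
    also have "\<dots> = (\<Sum>s\<le>j. scale (?g s) (scale (of_nat (j - s)) (times_c (j - s) (?V (n - int s) f))))
        + (\<Sum>s\<le>j. scale (of_nat s * ?g s) (times_c (j - s) (?V (n - int s) f)))"
      unfolding sum.distrib
    proof (rule arg_cong2[where f = "(+)"])
      show "(\<Sum>r=1..j. \<Sum>s\<le>j - r. scale (?g s) (scale (?a r) (?p r (times_c (j - s - r) (?V (n - int s) f)))))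
        = (\<Sum>s\<le>j. scale (?g s) (scale (of_nat (j - s)) (times_c (j - s) (?V (n - int s) f))))"
        unfolding sum_triangle_swap' times_c_euler vs.scale_sum_right ..
      show "(\<Sum>r=1..j. \<Sum>s\<le>j - r. scale (?a r * ?b r * ?g s) (times_c (j - (r + s)) (?V (n - int (r + s)) f)))
        = (\<Sum>s\<le>j. scale (of_nat s * ?g s) (times_c (j - s) (?V (n - int s) f)))"
        unfolding sum_triangle_diagonal exchange_coeff_euler vs.scale_sum_left
        by (intro sum.cong refl) auto
    qed
    also have "\<dots> = scale (of_nat j) (\<Sum>s\<le>j. scale (?g s) (times_c (j - s) (?V (n - int s) f)))"
      unfolding sum.distrib[symmetric] vs.scale_sum_right
    proof (intro sum.cong refl)
      fix s assume "s \<in> {..j}"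
      then show "scale (?g s) (scale (of_nat (j - s)) (times_c (j - s) (?V (n - int s) f))) +
          scale (of_nat s * ?g s) (times_c (j - s) (?V (n - int s) f)) =
          scale (of_nat j) (scale (?g s) (times_c (j - s) (?V (n - int s) f)))"
        by (simp add: vs.scale_left_distrib[symmetric] of_nat_diff algebra_simps
          del: vs.scale_left_distrib)
    qed
    finally show ?thesis using False scale_of_nat_cancel by blast
  qed
qed

text \<open>The relation \<open>c(w\<^sup>2/t) V\<^sub>B\<^bsup>(-)\<^esup>(w) = 1\<close>: the exponents are
  negatives of each other, as \<open>t\<^bsup>-k\<^esup> (1 - t\<^sup>k) = -(1 - t\<^bsup>-k\<^esup>)\<close>. In terms of recursions, the Euler identities of the two factors
  cancel in the product.\<close>

lemma c_V_minus_cancel: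
  "(\<Sum>a\<le>i. scale (inverse t_par ^ a) (times_c a (V_minus (i - a) f))) = (if i = 0 then f else 0)"
proof (cases "i = 0")
  case False
  let ?C = "\<lambda>a f. scale (inverse t_par ^ a) (times_c a f)"
  let ?X = minus_family
  have C_X: "?C a (?X k g) = ?X k (?C a g)" for a k g
    by (simp add: minus_family_def mult_p_eq lin_scale[OF lin_times_b] times_b_commute[of "c_elem a"]
        mult.commute)
  have kX: "scale (of_nat k) (?X k g) = scale (1 - inverse t_par ^ k) (times_b (p_elem k) g)"
    if "k \<ge> 1" for k g
    using that by (simp add: minus_family_def mult_p_eq)
  have C: "scale (of_nat a) (?C a g) = - (\<Sum>k=1..a. scale (of_nat k) (?X k (?C (a - k) g)))" for a g
  proof -
    have "scale (of_nat a) (?C a g) = scale (inverse t_par ^ a) (scale (of_nat a) (times_c a g))"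
      by (rule vs.scale_left_commute)
    also have "\<dots> = (\<Sum>k=1..a. - scale (of_nat k) (?X k (?C (a - k) g)))"
      unfolding times_c_euler vs.scale_sum_right
    proof (intro sum.cong refl)
      fix k assume k: "k \<in> {1..a}"
      then have "inverse t_par ^ a = inverse t_par ^ k * inverse t_par ^ (a - k)"
        by (simp flip: power_add)
      then have "inverse t_par ^ a * (1 - t_par ^ k) = - ((1 - inverse t_par ^ k) * inverse t_par ^ (a - k))"
        by (simp add: power_inverse field_simps)
      then have "scale (inverse t_par ^ a * (1 - t_par ^ k)) (times_b (p_elem k) (times_c (a - k) g)) =
          - scale ((1 - inverse t_par ^ k) * inverse t_par ^ (a - k)) (times_b (p_elem k) (times_c (a - k) g))"
        by simp
      then show "scale (inverse t_par ^ a) (scale (1 - t_par ^ k) (times_b (p_elem k) (times_c (a - k) g))) =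
          - scale (of_nat k) (?X k (?C (a - k) g))"
        using k by (simp add: kX lin_scale[OF lin_times_b])
    qed
    finally show ?thesis by (simp add: sum_negf)
  qed
  have "scale (of_nat i) (\<Sum>a\<le>i. ?C a (V_minus (i - a) f)) =
      (\<Sum>a\<le>i. scale (of_nat a) (?C a (V_minus (i - a) f)) + ?C a (scale (of_nat (i - a)) (V_minus (i - a) f)))"
    unfolding vs.scale_sum_right
  proof (intro sum.cong refl)
    fix a assume "a \<in> {..i}"
    then show "scale (of_nat i) (?C a (V_minus (i - a) f)) =
        scale (of_nat a) (?C a (V_minus (i - a) f)) + ?C a (scale (of_nat (i - a)) (V_minus (i - a) f))"
      using scale_of_nat_add[of a "i - a" "?C a (V_minus (i - a) f)"]
      by (simp add: lin_scale[OF lin_times_b] mult.commute)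
  qed
  also have "\<dots> = - (\<Sum>a\<le>i. \<Sum>k=1..a. scale (of_nat k) (?X k (?C (a - k) (V_minus (i - a) f))))
      + (\<Sum>a\<le>i. \<Sum>k=1..i - a. scale (of_nat k) (?X k (?C a (V_minus (i - a - k) f))))"
    unfolding sum.distrib C sum_negf minus.conv_exp_euler lin_sum[OF lin_times_b] vs.scale_sum_right
    by (intro arg_cong2[where f = "(+)"] refl sum.cong)
       (simp only: lin_scale[OF lin_times_b] vs.scale_left_commute[of "inverse t_par ^ _"] C_X)
  also have "(\<Sum>a\<le>i. \<Sum>k=1..a. scale (of_nat k) (?X k (?C (a - k) (V_minus (i - a) f)))) =
      (\<Sum>a\<le>i. \<Sum>k=1..a. scale (of_nat k) (?X k (?C (a - k) (V_minus (i - (a - k) - k) f))))"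
    by (intro sum.cong refl) simp
  also have "\<dots> = (\<Sum>a\<le>i. \<Sum>k=1..i - a. scale (of_nat k) (?X k (?C a (V_minus (i - a - k) f))))"
    unfolding sum_triangle_diagonal[symmetric, of "\<lambda>k a. scale (of_nat k) (?X k (?C a (V_minus (i - a - k) f)))"]
    by (rule sum_triangle_swap')
  finally have "scale (of_nat i) (\<Sum>a\<le>i. ?C a (V_minus (i - a) f)) = 0" by simp
  then show ?thesis using False by (simp add: vs.scale_eq_0_iff)
qed simp

section \<open>Exchange relations of the combined vertex operator\<close>

lemma lin_combinationI:
  assumes "\<And>f g c. T (f + scale c g) = T f + scale c (T g)"
  shows "lin T"
proof -
  have "T 0 = 0" using assms[of 0 1 0] by simp
  then show ?thesis
    using assms[of _ 1] assms[of 0] by (intro linI) simp_all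
qed

abbreviation half_vertex :: op_series where
  "half_vertex \<equiv> V_B_plus \<star> V_F_vev"

abbreviation vertex :: op_series where
  "vertex \<equiv> V_B_minus \<star> half_vertex"

text \<open>This property depends on the \<open>p\<close>-variables only and is therefore shared by all derivatives
  \<open>\<partial>/\<partial>\<pi>\<^sub>j\<close> of \<open>f\<close>; it truncates every sum coming from \<open>V\<^sub>B\<^bsup>(+)\<^esup>\<close>.\<close>

definition plus_order_le :: "nat \<Rightarrow> superring \<Rightarrow> bool" where
  "plus_order_le d f \<longleftrightarrow> (\<forall>i>d. V_plus i f = 0)"

lemma plus_order_ex: "\<exists>d. plus_order_le d f"
  unfolding plus_order_le_def by (rule V_plus_locally_nilpotent)

lemma plus_order_le_mono: "plus_order_le d f \<Longrightarrow> d \<le> e \<Longrightarrow> plus_order_le e f"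
  by (auto simp: plus_order_le_def)

lemma plus_order_common: "\<exists>d. plus_order_le d f \<and> plus_order_le d g"
proof -
  obtain a b where "plus_order_le a f" "plus_order_le b g" using plus_order_ex by blast
  then have "plus_order_le (max a b) f" "plus_order_le (max a b) g"
    by (auto elim: plus_order_le_mono)
  then show ?thesis by blast
qed

lemma plus_order_le_deriv_\<pi>: "plus_order_le d f \<Longrightarrow> j \<ge> 1 \<Longrightarrow> plus_order_le d (deriv_\<pi> j f)"
  unfolding plus_order_le_def by (simp add: deriv_\<pi>_V_plus[symmetric] lin_0[OF lin_deriv_\<pi>])

lemma half_vertex_apply:
  assumes "plus_order_le d f"
  shows "half_vertex n f = (\<Sum>a\<le>d. V_plus a (V_F_vev (n + 2 * int a) f))"
proof -
  have V: "V_B_plus = series_exp (series_sum {1..} (\<lambda>k. op_monom (- 2 * int k) (plus_family k)))"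
    unfolding V_B_plus_def plus_family_def[abs_def] ..
  have "half_vertex n f = (\<Sum>a\<le>d. V_plus a (V_F_vev (n - (- 2) * int a) f))"
    unfolding series_mult_apply V
    by (rule plus.act_series_exp)
       (use assms in \<open>auto simp: plus_order_le_def V_plus_V_F_vev V_F_vev_0\<close>)
  then show ?thesis by simp
qed

lemma lin_half_vertex: "lin (half_vertex n)"
proof (rule lin_combinationI)
  fix f g c
  obtain d where d: "plus_order_le d f" "plus_order_le d g" using plus_order_common by blast
  then have "plus_order_le d (f + scale c g)"
    by (simp add: plus_order_le_def lin_add[OF plus.lin_conv_exp] lin_scale[OF plus.lin_conv_exp])
  then show "half_vertex n (f + scale c g) = half_vertex n f + scale c (half_vertex n g)"
    using d by (simp add: half_vertex_apply lin_add[OF plus.lin_conv_exp] lin_scale[OF plus.lin_conv_exp]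
        lin_add[OF lin_V_F_vev] lin_scale[OF lin_V_F_vev] sum.distrib vs.scale_sum_right)
qed

lemma deriv_half_vertex:
  assumes "index_le N f" "j \<ge> 1"
  shows "deriv_\<pi> j (half_vertex n f) =
    (\<Sum>l=1..N. scale (ferm_coeff j l) (half_vertex (n - 2 * int j + 2 * int l) (deriv_\<pi> l f)))"
proof -
  obtain d where d: "plus_order_le d f" using plus_order_ex by blast
  have "deriv_\<pi> j (half_vertex n f) = (\<Sum>a\<le>d. \<Sum>l=1..N. scale (ferm_coeff j l)
      (V_plus a (V_F_vev (n - 2 * int j + 2 * int l + 2 * int a) (deriv_\<pi> l f))))"
    unfolding half_vertex_apply[OF d] lin_sum[OF lin_deriv_\<pi>[OF assms(2)]]
  proof (intro sum.cong refl)
    fix a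
    have e: "n + 2 * int a - 2 * int j + 2 * int l = n - 2 * int j + 2 * int l + 2 * int a" for l
      by simp
    show "deriv_\<pi> j (V_plus a (V_F_vev (n + 2 * int a) f)) = (\<Sum>l=1..N. scale (ferm_coeff j l)
        (V_plus a (V_F_vev (n - 2 * int j + 2 * int l + 2 * int a) (deriv_\<pi> l f))))"
      unfolding deriv_\<pi>_V_plus[OF assms(2)] deriv_V_F_vev[OF assms] lin_sum[OF plus.lin_conv_exp]
        lin_scale[OF plus.lin_conv_exp] e ..
  qed
  also have "\<dots> = (\<Sum>l=1..N. scale (ferm_coeff j l)
      (\<Sum>a\<le>d. V_plus a (V_F_vev (n - 2 * int j + 2 * int l + 2 * int a) (deriv_\<pi> l f))))"
    unfolding vs.scale_sum_right by (rule sum.swap)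
  also have "\<dots> = (\<Sum>l=1..N. scale (ferm_coeff j l) (half_vertex (n - 2 * int j + 2 * int l) (deriv_\<pi> l f)))"
    by (intro sum.cong refl) (simp add: half_vertex_apply[OF plus_order_le_deriv_\<pi>[OF d]])
  finally show ?thesis .
qed

text \<open>The fermionic factor commutes with \<open>c\<^sub>j\<close>, so this is the exchange relation for \<open>V\<^sub>B\<^bsup>(+)\<^esup>\<close>.\<close>

lemma half_vertex_c:
  "half_vertex n (times_c j f) =
    (\<Sum>s\<le>j. scale (exchange_coeff s) (times_c (j - s) (half_vertex (n + 2 * int s) f)))"
proof -
  obtain d0 where d0: "plus_order_le d0 f" "plus_order_le d0 (times_c j f)"
    using plus_order_common by blast
  \<comment> \<open>The exchange relation lowers the index of \<open>V\<^sub>B\<^bsup>(+)\<^esup>\<close> by up to \<open>j\<close>, so the truncation needs \<open>j\<close> extra terms.\<close>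
  define d where "d = d0 + j"
  have d: "plus_order_le d (times_c j f)" using d0 plus_order_le_mono by (simp add: d_def)
  have "half_vertex n (times_c j f) = (\<Sum>a\<le>d. V_plus_int (int a) (times_c j (V_F_vev (n + 2 * int a) f)))"
    unfolding half_vertex_apply[OF d] times_b_V_F_vev by (simp add: V_plus_int_def)
  also have "\<dots> = (\<Sum>a\<le>d. \<Sum>s\<le>j. scale (exchange_coeff s)
      (times_c (j - s) (V_plus_int (int a - int s) (V_F_vev (n + 2 * int a) f))))"
    unfolding V_plus_int_c ..
  also have "\<dots> = (\<Sum>s\<le>j. scale (exchange_coeff s)
      (times_c (j - s) (\<Sum>a\<le>d. V_plus_int (int a - int s) (V_F_vev (n + 2 * int a) f))))"
    unfolding lin_sum[OF lin_times_b] vs.scale_sum_right by (rule sum.swap)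
  also have "\<dots> = (\<Sum>s\<le>j. scale (exchange_coeff s) (times_c (j - s) (half_vertex (n + 2 * int s) f)))"
  proof (intro sum.cong refl arg_cong2[where f = scale] arg_cong2[where f = "\<lambda>k. times_c (j - k)"])
    fix s assume s: "s \<in> {..j}"
    have "(\<Sum>a\<le>d. V_plus_int (int a - int s) (V_F_vev (n + 2 * int a) f)) =
        (\<Sum>a\<in>{s..d}. V_plus_int (int a - int s) (V_F_vev (n + 2 * int a) f))"
      by (rule sum.mono_neutral_right) (auto simp: V_plus_int_def)
    also have "\<dots> = (\<Sum>b\<le>d - s. V_plus b (V_F_vev (n + 2 * int s + 2 * int b) f))"
      using s by (intro sum.reindex_bij_witness[where i = "\<lambda>b. b + s" and j = "\<lambda>a. a - s"])
        (auto simp: V_plus_int_def d_def nat_diff_distrib algebra_simps of_nat_diff)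
    also have "\<dots> = half_vertex (n + 2 * int s) f"
      using s d0 by (intro half_vertex_apply[symmetric]) (auto simp: d_def elim: plus_order_le_mono)
    finally show "(\<Sum>a\<le>d. V_plus_int (int a - int s) (V_F_vev (n + 2 * int a) f)) =
      half_vertex (n + 2 * int s) f" .
  qed
  finally show ?thesis .
qed

text \<open>\<open>V\<^sub>B\<^bsup>(+)\<^esup>\<close> lowers exponents, so it needs from the fermionic factor only coefficients with larger
  exponents, all of which vanish.\<close>

lemma pair_op_half_vertex_zero:
  assumes "index_le N f" "n \<ge> - 2"
  shows "pair_op N half_vertex n f = 0"
proof -
  obtain d where d: "plus_order_le d f" using plus_order_ex by blast
  have "pair_op N half_vertex n f = (\<Sum>k=1..N. \<Sum>l=1..N. \<Sum>a\<le>d. V_plus a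
      (scale (q_par ^ k * t_par ^ l) (V_F_vev (n + 2 * int a + 2 * int k + 2 * int l) (deriv_\<pi> k (deriv_\<pi> l f)))))"
    unfolding pair_op_def
  proof (intro sum.cong refl)
    fix k l assume kl: "k \<in> {1..N}" "l \<in> {1..N}"
    then have "plus_order_le d (deriv_\<pi> k (deriv_\<pi> l f))"
      by (simp add: plus_order_le_deriv_\<pi> d)
    then show "scale (q_par ^ k * t_par ^ l) (half_vertex (n + 2 * int k + 2 * int l) (deriv_\<pi> k (deriv_\<pi> l f)))
      = (\<Sum>a\<le>d. V_plus a (scale (q_par ^ k * t_par ^ l)
          (V_F_vev (n + 2 * int a + 2 * int k + 2 * int l) (deriv_\<pi> k (deriv_\<pi> l f)))))"
      by (simp add: half_vertex_apply vs.scale_sum_right lin_scale[OF plus.lin_conv_exp] add_ac)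
  qed
  also have "\<dots> = (\<Sum>k=1..N. \<Sum>a\<le>d. \<Sum>l=1..N. V_plus a
      (scale (q_par ^ k * t_par ^ l) (V_F_vev (n + 2 * int a + 2 * int k + 2 * int l) (deriv_\<pi> k (deriv_\<pi> l f)))))"
    by (intro sum.cong refl sum.swap)
  also have "\<dots> = (\<Sum>a\<le>d. V_plus a (pair_op N V_F_vev (n + 2 * int a) f))"
    unfolding pair_op_def lin_sum[OF plus.lin_conv_exp] by (rule sum.swap)
  also have "\<dots> = 0"
    using assms by (simp add: pair_op_V_F_vev_zero lin_0[OF plus.lin_conv_exp])
  finally show ?thesis .
qed

text \<open>The bound that truncates the sums coming from \<open>V\<^sub>B\<^bsup>(-)\<^esup>\<close>, which has only nonnegative powers of \<open>w\<close>.\<close>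

definition zero_below :: "int \<Rightarrow> superring \<Rightarrow> bool" where
  "zero_below L f \<longleftrightarrow> (\<forall>n<L. half_vertex n f = 0)"

lemma zero_below_ex: "\<exists>L. zero_below L f"
proof -
  obtain N d e where N: "index_le N f" and e: "deg_less e f" and d: "plus_order_le d f"
    using index_le_ex deg_less_ex plus_order_ex by blast
  have "half_vertex n f = 0" if "n < - 2 * int N * int e - 2 * int d" for n
  proof -
    have "V_F_vev (n + 2 * int a) f = 0" if "a \<le> d" for a
      using that \<open>n < _\<close> by (intro V_F_vev_zero_below[OF N e]) linarith
    then show ?thesis
      by (simp add: half_vertex_apply[OF d] lin_0[OF plus.lin_conv_exp])
  qed
  then show ?thesis unfolding zero_below_def by blast
qed

lemma zero_below_common:
  assumes "finite S"
  shows "\<exists>L. \<forall>f\<in>S. zero_below L f"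
  using assms
proof induction
  case (insert f S)
  then obtain L where "\<forall>f\<in>S. zero_below L f" by blast
  moreover obtain L' where "zero_below L' f" using zero_below_ex by blast
  ultimately have "\<forall>f\<in>insert f S. zero_below (min L L') f"
    by (auto simp: zero_below_def)
  then show ?case by blast
qed simp

lemma vertex_apply:
  assumes "zero_below L f" "n - 2 * int K - 2 < L"
  shows "vertex n f = (\<Sum>a\<le>K. V_minus a (half_vertex (n - 2 * int a) f))"
proof -
  have V: "V_B_minus = series_exp (series_sum {1..} (\<lambda>k. op_monom (2 * int k) (minus_family k)))"
    unfolding V_B_minus_def minus_family_def[abs_def] ..
  show ?thesis
    unfolding series_mult_apply[of V_B_minus] unfolding V
    by (rule minus.act_series_exp)
       (use assms in \<open>auto simp: zero_below_def lin_0[OF minus.lin_conv_exp]\<close>)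
qed

lemma lin_vertex: "lin (vertex n)"
proof (rule lin_combinationI)
  fix f g c
  obtain L where "\<forall>h\<in>{f, g}. zero_below L h"
    using zero_below_common[of "{f, g}"] by blast
  then have L: "zero_below L f" "zero_below L g" by auto
  then have L': "zero_below L (f + scale c g)"
    by (simp add: zero_below_def lin_add[OF lin_half_vertex] lin_scale[OF lin_half_vertex])
  have K: "n - 2 * int (nat (n - L)) - 2 < L" by linarith
  show "vertex n (f + scale c g) = vertex n f + scale c (vertex n g)"
    unfolding vertex_apply[OF L(1) K] vertex_apply[OF L(2) K] vertex_apply[OF L' K]
    by (simp add: lin_add[OF minus.lin_conv_exp] lin_scale[OF minus.lin_conv_exp]
        lin_add[OF lin_half_vertex] lin_scale[OF lin_half_vertex] sum.distrib vs.scale_sum_right)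
qed

lemma deriv_vertex:
  assumes "index_le N f" "j \<ge> 1"
  shows "deriv_\<pi> j (vertex n f) =
    (\<Sum>l=1..N. scale (ferm_coeff j l) (vertex (n - 2 * int j + 2 * int l) (deriv_\<pi> l f)))"
proof -
  obtain L where L: "\<forall>h\<in>insert f ((\<lambda>l. deriv_\<pi> l f) ` {1..N}). zero_below L h"
    using zero_below_common[of "insert f ((\<lambda>l. deriv_\<pi> l f) ` {1..N})"] by blast
  define K where "K = nat (n + 2 * int N - L)"
  have W: "vertex m h = (\<Sum>a\<le>K. V_minus a (half_vertex (m - 2 * int a) h))"
    if "h \<in> insert f ((\<lambda>l. deriv_\<pi> l f) ` {1..N})" "m \<le> n + 2 * int N" for m h
    using L that by (intro vertex_apply[of L]) (auto simp: K_def)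
  have "deriv_\<pi> j (vertex n f) = (\<Sum>a\<le>K. \<Sum>l=1..N. scale (ferm_coeff j l)
      (V_minus a (half_vertex (n - 2 * int j + 2 * int l - 2 * int a) (deriv_\<pi> l f))))"
  proof -
    have e: "n - 2 * int a - 2 * int j + 2 * int l = n - 2 * int j + 2 * int l - 2 * int a" for a l
      by simp
    have "vertex n f = (\<Sum>a\<le>K. V_minus a (half_vertex (n - 2 * int a) f))"
      by (rule W) auto
    then show ?thesis
      by (simp only: lin_sum[OF lin_deriv_\<pi>[OF assms(2)]] deriv_\<pi>_V_minus[OF assms(2)]
        deriv_half_vertex[OF assms] lin_sum[OF minus.lin_conv_exp] lin_scale[OF minus.lin_conv_exp] e)
  qed
  also have "\<dots> = (\<Sum>l=1..N. scale (ferm_coeff j l)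
      (\<Sum>a\<le>K. V_minus a (half_vertex (n - 2 * int j + 2 * int l - 2 * int a) (deriv_\<pi> l f))))"
    unfolding vs.scale_sum_right by (rule sum.swap)
  also have "\<dots> = (\<Sum>l=1..N. scale (ferm_coeff j l) (vertex (n - 2 * int j + 2 * int l) (deriv_\<pi> l f)))"
    by (intro sum.cong refl arg_cong2[where f = scale] W[symmetric]) auto
  finally show ?thesis .
qed

lemma vertex_c:
  "vertex n (times_c j f) =
    (\<Sum>s\<le>j. scale (exchange_coeff s) (times_c (j - s) (vertex (n + 2 * int s) f)))"
proof -
  obtain L where "\<forall>h\<in>{f, times_c j f}. zero_below L h"
    using zero_below_common[of "{f, times_c j f}"] by blast
  then have L: "zero_below L f" "zero_below L (times_c j f)" by auto
  define K where "K = nat (n + 2 * int j - L)"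
  have "n - 2 * int K - 2 < L" by (simp add: K_def)
  then have "vertex n (times_c j f) = (\<Sum>a\<le>K. V_minus a (half_vertex (n - 2 * int a) (times_c j f)))"
    by (rule vertex_apply[OF L(2)])
  also have "\<dots> = (\<Sum>a\<le>K. \<Sum>s\<le>j. scale (exchange_coeff s)
      (times_c (j - s) (V_minus a (half_vertex (n + 2 * int s - 2 * int a) f))))"
  proof -
    have e: "n - 2 * int a + 2 * int s = n + 2 * int s - 2 * int a" for a s by simp
    show ?thesis
      unfolding half_vertex_c lin_sum[OF minus.lin_conv_exp] lin_scale[OF minus.lin_conv_exp]
        times_b_V_minus[symmetric] e ..
  qed
  also have "\<dots> = (\<Sum>s\<le>j. scale (exchange_coeff s)
      (times_c (j - s) (\<Sum>a\<le>K. V_minus a (half_vertex (n + 2 * int s - 2 * int a) f))))"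
    unfolding lin_sum[OF lin_times_b] vs.scale_sum_right by (rule sum.swap)
  also have "\<dots> = (\<Sum>s\<le>j. scale (exchange_coeff s) (times_c (j - s) (vertex (n + 2 * int s) f)))"
  proof (intro sum.cong refl)
    fix s assume "s \<in> {..j}"
    then have "n + 2 * int s - 2 * int K - 2 < L" by (auto simp: K_def)
    then show "scale (exchange_coeff s)
        (times_c (j - s) (\<Sum>a\<le>K. V_minus a (half_vertex (n + 2 * int s - 2 * int a) f))) =
        scale (exchange_coeff s) (times_c (j - s) (vertex (n + 2 * int s) f))"
      by (simp add: vertex_apply[OF L(1)])
  qed
  finally show ?thesis .
qed

text \<open>The relation \<open>c(w\<^sup>2/t) V\<^sub>B\<^bsup>(-)\<^esup>(w) = 1\<close>, applied inside \<open>W\<close>. One truncation suffices for all summands: the coefficient of \<open>w\<^bsup>n-2i\<^esup>\<close> needs only the first \<open>K - i\<close>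
  terms of \<open>V\<^sub>B\<^bsup>(-)\<^esup>\<close> when that of \<open>w\<^sup>n\<close> needs \<open>K\<close>.\<close>

lemma c_vertex_cancel:
  assumes "zero_below L f" "n - 2 * int K - 2 < L"
  shows "(\<Sum>i\<le>K. scale (inverse t_par ^ i) (times_c i (vertex (n - 2 * int i) f))) = half_vertex n f"
proof -
  have "(\<Sum>i\<le>K. scale (inverse t_par ^ i) (times_c i (vertex (n - 2 * int i) f))) =
      (\<Sum>i\<le>K. \<Sum>a\<le>K - i. scale (inverse t_par ^ i)
        (times_c i (V_minus a (half_vertex (n - 2 * int (i + a)) f))))"
  proof (intro sum.cong refl)
    fix i assume "i \<in> {..K}"
    then have "n - 2 * int i - 2 * int (K - i) - 2 < L" using assms(2) by auto
    then have "vertex (n - 2 * int i) f = (\<Sum>a\<le>K - i. V_minus a (half_vertex (n - 2 * int i - 2 * int a) f))"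
      by (rule vertex_apply[OF assms(1)])
    moreover have e: "n - 2 * int i - 2 * int a = n - 2 * int (i + a)" for a by simp
    ultimately show "scale (inverse t_par ^ i) (times_c i (vertex (n - 2 * int i) f)) =
        (\<Sum>a\<le>K - i. scale (inverse t_par ^ i)
          (times_c i (V_minus a (half_vertex (n - 2 * int (i + a)) f))))"
      by (simp only: e lin_sum[OF lin_times_b] vs.scale_sum_right)
  qed
  also have "\<dots> = (\<Sum>s\<le>K. \<Sum>i\<le>s. scale (inverse t_par ^ i)
      (times_c i (V_minus (s - i) (half_vertex (n - 2 * int s) f))))"
    unfolding sum_triangle_diagonal' by (intro sum.cong refl) simp
  also have "\<dots> = (\<Sum>s\<le>K. if s = 0 then half_vertex (n - 2 * int s) f else 0)"
    unfolding c_V_minus_cancel ..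
  also have "\<dots> = half_vertex n f"
    by (simp add: sum.delta)
  finally show ?thesis .
qed

section \<open>The anticommutators\<close>

text \<open>For \<open>s = 0\<close> the next two operators are \<open>E\<^bsub>2,0\<^esub>\<close> and \<open>F\<^bsub>1,2\<^esub>\<close>, for \<open>s = 1\<close> they are \<open>F\<^bsub>1,0\<^esub>\<close> and
  \<open>E\<^bsub>2,1\<^esub>\<close>, in each case up to a scalar factor.\<close>

definition c_operator :: "nat \<Rightarrow> operator" where
  "c_operator s = op_sum {1..} (\<lambda>k f. times_c (k - s) (deriv_\<pi> k f))"

definition vertex_operator :: "nat \<Rightarrow> operator" where
  "vertex_operator s = op_sum {1..} (\<lambda>k f.
     vertex (2 * int k - 2 + 2 * int s) (scale (q_par ^ (k - 1 + s)) (deriv_\<pi> k f)))"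

lemma c_operator_apply:
  assumes "index_le N f"
  shows "c_operator s f = (\<Sum>k=1..N. times_c (k - s) (deriv_\<pi> k f))"
  unfolding c_operator_def
  by (rule op_sum_eq_sum) (use assms in \<open>auto simp: index_le_def lin_0[OF lin_times_b]\<close>)

lemma vertex_operator_apply:
  assumes "index_le N f"
  shows "vertex_operator s f =
    (\<Sum>k=1..N. scale (q_par ^ (k - 1 + s)) (vertex (2 * int k - 2 + 2 * int s) (deriv_\<pi> k f)))"
proof -
  have "vertex_operator s f =
    (\<Sum>k=1..N. vertex (2 * int k - 2 + 2 * int s) (scale (q_par ^ (k - 1 + s)) (deriv_\<pi> k f)))"
    unfolding vertex_operator_def
    by (rule op_sum_eq_sum) (use assms in \<open>auto simp: index_le_def lin_0[OF lin_vertex]\<close>)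
  then show ?thesis by (simp add: lin_scale[OF lin_vertex])
qed

lemma index_le_common: "\<exists>N. index_le N f \<and> index_le N g"
proof -
  obtain a b where "index_le a f" "index_le b g" using index_le_ex by blast
  then have "index_le (max a b) f" "index_le (max a b) g"
    by (auto elim: index_le_mono)
  then show ?thesis by blast
qed

lemma lin_c_operator: "lin (c_operator s)"
proof (rule lin_combinationI)
  fix f g c
  obtain N where N: "index_le N f" "index_le N g" using index_le_common by blast
  then have N': "index_le N (f + scale c g)" by (intro index_le_add index_le_scale)
  show "c_operator s (f + scale c g) = c_operator s f + scale c (c_operator s g)"
    unfolding c_operator_apply[OF N(1)] c_operator_apply[OF N(2)] c_operator_apply[OF N']
      vs.scale_sum_right sum.distrib[symmetric]
    by (intro sum.cong refl)
       (simp add: lin_add[OF lin_deriv_\<pi>] lin_scale[OF lin_deriv_\<pi>] lin_add[OF lin_times_b]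
         lin_scale[OF lin_times_b])
qed

lemma lin_vertex_operator: "lin (vertex_operator s)"
proof (rule lin_combinationI)
  fix f g c
  obtain N where N: "index_le N f" "index_le N g" using index_le_common by blast
  then have N': "index_le N (f + scale c g)" by (intro index_le_add index_le_scale)
  show "vertex_operator s (f + scale c g) = vertex_operator s f + scale c (vertex_operator s g)"
    unfolding vertex_operator_apply[OF N(1)] vertex_operator_apply[OF N(2)] vertex_operator_apply[OF N']
      vs.scale_sum_right sum.distrib[symmetric]
    by (intro sum.cong refl)
       (simp add: lin_add[OF lin_deriv_\<pi>] lin_scale[OF lin_deriv_\<pi>] lin_add[OF lin_vertex]
         lin_scale[OF lin_vertex] vs.scale_right_distrib mult.commute)
qed

text \<open>Both products are expanded as \<open>\<Sum>\<^sub>i c\<^sub>i \<Sum>\<^bsub>k,l\<^esub> \<dots> [w\<^bsup>2k+2l-2-2i\<^esup>] W d\<^sub>k d\<^sub>l\<close>, and \<open>exchange_minus_ferm_coeff\<close> is applied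
  with \<open>j = i + s\<close>. For \<open>s = 0\<close> the first product has a term \<open>i = 0\<close> that the second one lacks; this is
  consistent with \<open>n\<^bsub>0l\<^esub> = 0\<close>.\<close>

lemma vertex_c_operator_anticommute:
  assumes s: "s \<le> 1"
  shows "vertex_operator s (c_operator s f) + c_operator s (vertex_operator s f) = 0"
proof -
  obtain N where N: "index_le N f" using index_le_ex by blast
  let ?S = "{1..N}"
  define dd where "dd k l = deriv_\<pi> k (deriv_\<pi> l f)" for k l
  have dd_swap: "dd l k = - dd k l" if "k \<in> ?S" "l \<in> ?S" for k l
    using that deriv_\<pi>_swap[of l k f] by (simp add: dd_def)
  obtain L where L: "\<forall>h\<in>(\<lambda>(k, l). dd k l) ` (?S \<times> ?S). zero_below L h"
    using zero_below_common[of "(\<lambda>(k, l). dd k l) ` (?S \<times> ?S)"] by blast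
  obtain N' where N': "index_le N' (vertex_operator s f)" using index_le_ex by blast
  \<comment> \<open>Large enough for both expansions and for the cancellation of \<open>V\<^sub>B\<^bsup>(-)\<^esup>\<close> in all coefficients that occur.\<close>
  define K where "K = N + N' + nat (4 * int N - L)"
  define w where "w i k l = vertex (2 * int k + 2 * int l - 2 - 2 * int i) (dd k l)" for i k l
  define ex where "ex i l = (if i + s \<le> l then exchange_coeff (l - (i + s)) else 0)" for i l
  let ?q = "\<lambda>k. q_par ^ (k - 1 + s)"
  have 1: "vertex_operator s (c_operator s f) =
      (\<Sum>i\<le>K. times_c i (\<Sum>k\<in>?S. \<Sum>l\<in>?S. scale (?q k * ex i l) (w i k l)))"
  proof -
    have c: "index_le N (c_operator s f)"
      unfolding c_operator_apply[OF N] using N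
      by (intro index_le_sum index_le_times_b index_le_deriv_\<pi>) auto
    have "vertex_operator s (c_operator s f) =
        (\<Sum>k\<in>?S. \<Sum>l\<in>?S. \<Sum>i\<le>K. times_c i (scale (?q k * ex i l) (w i k l)))"
      unfolding vertex_operator_apply[OF c]
    proof (intro sum.cong refl)
      fix k assume k: "k \<in> ?S"
      have "vertex (2 * int k - 2 + 2 * int s) (deriv_\<pi> k (c_operator s f)) =
          (\<Sum>l\<in>?S. vertex (2 * int k - 2 + 2 * int s) (times_c (l - s) (dd k l)))"
        unfolding c_operator_apply[OF N] using k
        by (simp add: lin_sum[OF lin_deriv_\<pi>] lin_sum[OF lin_vertex] deriv_\<pi>_times_b dd_def)
      also have "\<dots> = (\<Sum>l\<in>?S. \<Sum>i\<le>K. times_c i (scale (ex i l) (w i k l)))"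
      proof (intro sum.cong refl)
        fix l assume l: "l \<in> ?S"
        have "vertex (2 * int k - 2 + 2 * int s) (times_c (l - s) (dd k l)) =
            (\<Sum>v\<le>l - s. scale (exchange_coeff v) (times_c (l - s - v)
              (vertex (2 * int k - 2 + 2 * int s + 2 * int v) (dd k l))))"
          by (rule vertex_c)
        also have "\<dots> = (\<Sum>i\<le>l - s. times_c i (scale (ex i l) (w i k l)))"
          using l s
          by (intro sum.reindex_bij_witness[where i = "\<lambda>i. l - s - i" and j = "\<lambda>i. l - s - i"])
             (auto simp: ex_def w_def lin_scale[OF lin_times_b] of_nat_diff algebra_simps)
        also have "\<dots> = (\<Sum>i\<le>K. times_c i (scale (ex i l) (w i k l)))"
          using l s by (intro sum.mono_neutral_left)
            (auto simp: ex_def K_def lin_0[OF lin_times_b])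
        finally show "vertex (2 * int k - 2 + 2 * int s) (times_c (l - s) (dd k l)) =
          (\<Sum>i\<le>K. times_c i (scale (ex i l) (w i k l)))" .
      qed
      finally show "scale (?q k) (vertex (2 * int k - 2 + 2 * int s) (deriv_\<pi> k (c_operator s f))) =
          (\<Sum>l\<in>?S. \<Sum>i\<le>K. times_c i (scale (?q k * ex i l) (w i k l)))"
        by (simp add: vs.scale_sum_right lin_scale[OF lin_times_b])
    qed
    also have "\<dots> = (\<Sum>k\<in>?S. \<Sum>i\<le>K. \<Sum>l\<in>?S. times_c i (scale (?q k * ex i l) (w i k l)))"
      by (intro sum.cong refl sum.swap)
    also have "\<dots> = (\<Sum>i\<le>K. times_c i (\<Sum>k\<in>?S. \<Sum>l\<in>?S. scale (?q k * ex i l) (w i k l)))"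
      unfolding lin_sum[OF lin_times_b] by (rule sum.swap)
    finally show ?thesis .
  qed
  have 2: "c_operator s (vertex_operator s f) =
      (\<Sum>i\<le>K. times_c i (\<Sum>k\<in>?S. \<Sum>l\<in>?S. - scale (?q k * ferm_coeff (i + s) l) (w i k l)))"
  proof -
    let ?h = "\<lambda>i. \<Sum>k\<in>?S. \<Sum>l\<in>?S. - scale (?q k * ferm_coeff (i + s) l) (w i k l)"
    have h: "deriv_\<pi> (i + s) (vertex_operator s f) = ?h i" if "i + s \<ge> 1" for i
    proof -
      have "deriv_\<pi> (i + s) (vertex_operator s f) = (\<Sum>k\<in>?S. scale (?q k)
          (deriv_\<pi> (i + s) (vertex (2 * int k - 2 + 2 * int s) (deriv_\<pi> k f))))"
        unfolding vertex_operator_apply[OF N]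
        by (simp add: lin_sum[OF lin_deriv_\<pi>[OF that]] lin_scale[OF lin_deriv_\<pi>[OF that]])
      also have "\<dots> = ?h i"
      proof (intro sum.cong refl)
        fix k assume k: "k \<in> ?S"
        have "deriv_\<pi> (i + s) (vertex (2 * int k - 2 + 2 * int s) (deriv_\<pi> k f)) =
            (\<Sum>l\<in>?S. scale (ferm_coeff (i + s) l)
              (vertex (2 * int k - 2 + 2 * int s - 2 * int (i + s) + 2 * int l) (dd l k)))"
          unfolding dd_def using k by (intro deriv_vertex index_le_deriv_\<pi> N that) auto
        also have "\<dots> = (\<Sum>l\<in>?S. - scale (ferm_coeff (i + s) l) (w i k l))"
        proof (intro sum.cong refl)
          fix l assume l: "l \<in> ?S"
          have e: "2 * int k - 2 + 2 * int s - 2 * int (i + s) + 2 * int l =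
            2 * int k + 2 * int l - 2 - 2 * int i" by simp
          show "scale (ferm_coeff (i + s) l)
              (vertex (2 * int k - 2 + 2 * int s - 2 * int (i + s) + 2 * int l) (dd l k)) =
              - scale (ferm_coeff (i + s) l) (w i k l)"
            unfolding e dd_swap[OF k l] w_def by (simp add: lin_neg[OF lin_vertex])
        qed
        finally show "scale (?q k) (deriv_\<pi> (i + s) (vertex (2 * int k - 2 + 2 * int s) (deriv_\<pi> k f))) =
            (\<Sum>l\<in>?S. - scale (?q k * ferm_coeff (i + s) l) (w i k l))"
          by (simp add: vs.scale_sum_right)
      qed
      finally show ?thesis .
    qed
    have "index_le (K + s) (vertex_operator s f)"
      using N' by (rule index_le_mono) (simp add: K_def)
    then have "c_operator s (vertex_operator s f) =
        (\<Sum>j=1..K + s. times_c (j - s) (deriv_\<pi> j (vertex_operator s f)))"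
      by (rule c_operator_apply)
    also have "\<dots> = (\<Sum>i=1 - s..K. times_c i (deriv_\<pi> (i + s) (vertex_operator s f)))"
      using s by (intro sum.reindex_bij_witness[where i = "\<lambda>i. i + s" and j = "\<lambda>j. j - s"]) auto
    also have "\<dots> = (\<Sum>i=1 - s..K. times_c i (?h i))"
      using s by (intro sum.cong refl) (auto simp: h)
    also have "\<dots> = (\<Sum>i\<le>K. times_c i (?h i))"
    proof (rule sum.mono_neutral_left)
      have f0: "ferm_coeff 0 l = 0" if "l \<ge> 1" for l
        using that by (simp add: ferm_coeff_def A_coeff_def)
      show "\<forall>i\<in>{..K} - {1 - s..K}. times_c i (?h i) = 0"
      proof
        fix i assume "i \<in> {..K} - {1 - s..K}"
        then have "i + s = 0" by auto
        then have "?h i = 0" by (auto simp: f0 intro!: sum.neutral)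
        then show "times_c i (?h i) = 0" by (simp only: lin_0[OF lin_times_b])
      qed
    qed auto
    finally show ?thesis .
  qed
  define \<rho> where "\<rho> = q_par ^ s / q_par * residue_const * inverse t_par ^ s"
  have 3: "(\<Sum>k\<in>?S. \<Sum>l\<in>?S. scale (?q k * ex i l) (w i k l)) +
      (\<Sum>k\<in>?S. \<Sum>l\<in>?S. - scale (?q k * ferm_coeff (i + s) l) (w i k l)) =
      - (\<Sum>k\<in>?S. \<Sum>l\<in>?S. scale (\<rho> * q_par ^ k * t_par ^ l * inverse t_par ^ i) (w i k l))" for i
  proof -
    define \<kappa>' where "\<kappa>' = (if i + s = 0 then residue_const
      else residue_const * inverse t_par ^ (i + s) * t_par / q_par)"
    define \<kappa> where "\<kappa> = q_par ^ s / q_par * \<kappa>'"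
    have "(\<Sum>k\<in>?S. \<Sum>l\<in>?S. scale (?q k * ex i l) (w i k l)) +
        (\<Sum>k\<in>?S. \<Sum>l\<in>?S. - scale (?q k * ferm_coeff (i + s) l) (w i k l)) =
        (\<Sum>k\<in>?S. \<Sum>l\<in>?S. scale (\<kappa> * q_par ^ k * q_par ^ l) (w i k l)
          - scale (\<rho> * q_par ^ k * t_par ^ l * inverse t_par ^ i) (w i k l))"
      unfolding sum.distrib[symmetric]
    proof (intro sum.cong refl)
      fix k l assume k: "k \<in> ?S" and l: "l \<in> ?S"
      have q: "?q k = q_par ^ s / q_par * q_par ^ k"
        using k by (cases k) (simp_all add: power_add)
      have "?q k * ex i l - ?q k * ferm_coeff (i + s) l = ?q k * (ex i l - ferm_coeff (i + s) l)"
        by (simp add: right_diff_distrib)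
      also have "\<dots> = \<kappa> * q_par ^ k * q_par ^ l - \<rho> * q_par ^ k * t_par ^ l * inverse t_par ^ i"
      proof -
        have "ex i l - ferm_coeff (i + s) l =
            \<kappa>' * q_par ^ l - residue_const * inverse t_par ^ (i + s) * t_par ^ l"
          unfolding ex_def \<kappa>'_def using l by (intro exchange_minus_ferm_coeff) auto
        then show ?thesis
          unfolding q \<kappa>_def \<rho>_def by (simp only: power_add right_diff_distrib mult_ac)
      qed
      finally show "scale (?q k * ex i l) (w i k l) + - scale (?q k * ferm_coeff (i + s) l) (w i k l) =
          scale (\<kappa> * q_par ^ k * q_par ^ l) (w i k l)
          - scale (\<rho> * q_par ^ k * t_par ^ l * inverse t_par ^ i) (w i k l)"
        unfolding vs.scale_left_diff_distrib[symmetric] add_uminus_conv_diff by simp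
    qed
    also have "\<dots> = (\<Sum>k\<in>?S. \<Sum>l\<in>?S. scale (\<kappa> * q_par ^ k * q_par ^ l) (w i k l))
        - (\<Sum>k\<in>?S. \<Sum>l\<in>?S. scale (\<rho> * q_par ^ k * t_par ^ l * inverse t_par ^ i) (w i k l))"
      by (simp add: sum_subtractf)
    also have "(\<Sum>k\<in>?S. \<Sum>l\<in>?S. scale (\<kappa> * q_par ^ k * q_par ^ l) (w i k l)) = 0"
    proof (rule antisymmetric_sum_zero)
      fix k l assume kl: "k \<in> ?S" "l \<in> ?S"
      then show "scale (\<kappa> * q_par ^ k * q_par ^ l) (w i k l) = - scale (\<kappa> * q_par ^ l * q_par ^ k) (w i l k)"
        unfolding w_def dd_swap[OF kl] by (simp add: lin_neg[OF lin_vertex] mult_ac add_ac)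
    qed
    finally show ?thesis by simp
  qed
  have "vertex_operator s (c_operator s f) + c_operator s (vertex_operator s f) =
      (\<Sum>i\<le>K. times_c i (- (\<Sum>k\<in>?S. \<Sum>l\<in>?S.
        scale (\<rho> * q_par ^ k * t_par ^ l * inverse t_par ^ i) (w i k l))))"
    unfolding 1 2 3[symmetric] lin_add[OF lin_times_b] sum.distrib ..
  also have "\<dots> = - scale \<rho> (\<Sum>i\<le>K. \<Sum>k\<in>?S. \<Sum>l\<in>?S.
      scale (q_par ^ k * t_par ^ l) (scale (inverse t_par ^ i) (times_c i (w i k l))))"
    by (simp add: lin_neg[OF lin_times_b] lin_sum[OF lin_times_b] lin_scale[OF lin_times_b]
        sum_negf vs.scale_sum_right mult.assoc)
  also have "(\<Sum>i\<le>K. \<Sum>k\<in>?S. \<Sum>l\<in>?S.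
      scale (q_par ^ k * t_par ^ l) (scale (inverse t_par ^ i) (times_c i (w i k l)))) =
      (\<Sum>k\<in>?S. \<Sum>i\<le>K. \<Sum>l\<in>?S.
      scale (q_par ^ k * t_par ^ l) (scale (inverse t_par ^ i) (times_c i (w i k l))))"
    by (rule sum.swap)
  also have "\<dots> = (\<Sum>k\<in>?S. \<Sum>l\<in>?S. \<Sum>i\<le>K.
      scale (q_par ^ k * t_par ^ l) (scale (inverse t_par ^ i) (times_c i (w i k l))))"
    by (intro sum.cong refl sum.swap)
  also have "\<dots> = pair_op N half_vertex (- 2) f"
    unfolding pair_op_def
  proof (intro sum.cong refl)
    fix k l assume kl: "k \<in> ?S" "l \<in> ?S"
    have "(\<Sum>i\<le>K. scale (inverse t_par ^ i) (times_c i (w i k l))) =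
        half_vertex (2 * int k + 2 * int l - 2) (dd k l)"
      unfolding w_def
    proof (rule c_vertex_cancel)
      show "zero_below L (dd k l)" using L kl by auto
      show "2 * int k + 2 * int l - 2 - 2 * int K - 2 < L" using kl by (auto simp: K_def)
    qed
    moreover have "2 * int k + 2 * int l - 2 = - 2 + 2 * int k + 2 * int l" by simp
    ultimately show "(\<Sum>i\<le>K. scale (q_par ^ k * t_par ^ l) (scale (inverse t_par ^ i) (times_c i (w i k l)))) =
        scale (q_par ^ k * t_par ^ l) (half_vertex (- 2 + 2 * int k + 2 * int l) (deriv_\<pi> k (deriv_\<pi> l f)))"
      unfolding vs.scale_sum_right[symmetric] dd_def by simp
  qed
  also have "\<dots> = 0"
    using N by (rule pair_op_half_vertex_zero) simp
  finally show ?thesis by simp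
qed

lemma anticommutator_scaled:
  assumes "lin A" "lin B" "\<And>f. A (B f) + B (A f) = 0"
  shows "anticommutator (\<lambda>f. scale a (A f)) (\<lambda>f. scale b (B f)) = (\<lambda>_. 0)"
proof (rule ext)
  fix f
  have "anticommutator (\<lambda>f. scale a (A f)) (\<lambda>f. scale b (B f)) f = scale (a * b) (A (B f) + B (A f))"
    using assms(1,2) by (simp add: anticommutator_def lin_scale vs.scale_right_distrib mult.commute)
  then show "anticommutator (\<lambda>f. scale a (A f)) (\<lambda>f. scale b (B f)) f = 0"
    by (simp add: assms(3))
qed

text \<open>The trivial factor 1 gives all four operators the same shape.\<close>

lemma E_2_0_eq: "E_2_0 = (\<lambda>f. scale 1 (c_operator 0 f))"
  by (simp add: E_2_0_def c_operator_def)

lemma F_1_0_eq: "F_1_0 = (\<lambda>f. scale (inverse u_par) (c_operator 1 f))"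
  by (simp add: F_1_0_def c_operator_def)

lemma op_sum_cong: "(\<And>i f. i \<in> S \<Longrightarrow> A i f = B i f) \<Longrightarrow> op_sum S A = op_sum S B"
  unfolding op_sum_def by (intro ext Sum_any.cong) simp

lemma E_2_1_eq: "E_2_1 = (\<lambda>f. scale (- u_par * (t_half / q_half)) (vertex_operator 1 f))"
proof -
  have "op_sum {1..} (\<lambda>k f. contour (w_power (- 2 * int k) vertex) (scale (q_par ^ k) (deriv_\<pi> k f))) =
      vertex_operator 1"
    unfolding vertex_operator_def by (rule op_sum_cong) (simp add: contour_def w_power_def)
  then show ?thesis unfolding E_2_1_def by simp
qed

lemma F_1_2_eq: "F_1_2 = (\<lambda>f. scale u_par (vertex_operator 0 f))"
proof -
  have "op_sum {1..} (\<lambda>k f. contour (w_power (- 2 * int k + 2) vertex)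
      (scale (q_par ^ (k - 1)) (deriv_\<pi> k f))) = vertex_operator 0"
    unfolding vertex_operator_def by (rule op_sum_cong) (simp add: contour_def w_power_def)
  then show ?thesis unfolding F_1_2_def by simp
qed

theorem proposition1p3:
  shows "anticommutator E_2_1 F_1_0 = (\<lambda>_. 0) \<and> anticommutator E_2_0 F_1_2 = (\<lambda>_. 0)"
proof
  show "anticommutator E_2_1 F_1_0 = (\<lambda>_. 0)"
    unfolding E_2_1_eq F_1_0_eq
    by (intro anticommutator_scaled lin_vertex_operator lin_c_operator vertex_c_operator_anticommute) simp
  show "anticommutator E_2_0 F_1_2 = (\<lambda>_. 0)"
    unfolding E_2_0_eq F_1_2_eq
    by (intro anticommutator_scaled lin_vertex_operator lin_c_operator)
       (simp add: add.commute[of "c_operator _ _"] vertex_c_operator_anticommute)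
qed

end
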